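(* Let $(X,d,\mu)$ be a metric-measure space with $\mathrm{diam}\,X<\infty$ and $\mu$ a doubling measure, and let $1\leq p<\infty$ and $n\geq 1$ be an integer. Suppose that $(X,d,\mu)$ supports the $p$-Poincar\'e inequality and that the Nagata dimension of $X$ satisfies $\dim_N X\leq n$. If a separable metric space $Y$ is Lipschitz $(n-1)$-connected, then the Lipschitz mappings $\mathrm{Lip}(X,Y)$ are dense in $N^{1,p}(X,Y)$.
   Context: A metric-measure space is a metric space with a Borel-regular measure $\mu$; $\mu$ is doubling if there is $C_d\ge1$ with $\mu(2B)\le C_d\mu(B)$ for every ball $B$. A Borel function $g:U\to[0,\infty]$ is an upper gradient of $u$ (with values in $\mathbb R$ or in a Banach space $(V,\|\cdot\|)$) on open $U$ if $\|u(\gamma(b))-u(\gamma(a))\|\le\int_\gamma g$ for every rectifiable curve $\gamma:[a,b]\to U$. $X$ supports the $p$-Poincar\'e inequality if there are $C_P>0$, $\sigma\ge1$ such that for every ball $B$, every $u\in L^1(\sigma B)$ and every upper gradient $g$ of $u$ on $\sigma B$: $\frac{1}{\mu(B)}\int_B|u-u_B|\,d\mu\le C_P\,(\mathrm{diam}\,B)\big(\frac{1}{\mu(\sigma B)}\int_{\sigma B}g^p\,d\mu\big)^{1/p}$, where $u_B$ is the average of $u$ on $B$ and $\sigma B$ is the concentric ball with $\sigma$ times the radius. For a Banach space $V$, $N^{1,p}(X,V)$ consists of $u\in L^p(X,V)$ having an upper gradient $g\in L^p(X)$, normed by $\|u\|_{N^{1,p}}=\|u\|_{L^p}+\inf_g\|g\|_{L^p}$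 (infimum over upper gradients; functions at distance $0$ identified). For a separable metric space $Y$, fix an isometric embedding $\lambda:Y\to V$ into a Banach space (e.g. $\ell^\infty$) and set $N^{1,p}(X,Y)=\{u:X\to Y:\lambda\circ u\in N^{1,p}(X,V)\}$ with metric $d(u,v)=\|\lambda\circ u-\lambda\circ v\|_{N^{1,p}}$. The Nagata dimension $\dim_N X$ is the least integer $n$ such that there is $C>0$ so that for every $s>0$ there is a cover $X=\bigcup_{i}A_i$ with $\mathrm{diam}\,A_i\le Cs$ for all $i$ and every ball $B(x,s)$ meeting at most $n+1$ of the sets $A_i$. A metric space $Y$ is Lipschitz $m$-connected if there is $\gamma\ge1$ such that for each $k\in\{0,1,\dots,m\}$ every $L$-Lipschitz map $f:\mathbb S^k\to Y$ has a $\gamma L$-Lipschitz extension $F:\mathbb B^{k+1}\to Y$. *)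

theory Defs
  imports "HOL-Analysis.Analysis"
begin

definition enn_powr :: "ennreal \<Rightarrow> real \<Rightarrow> ennreal" where
  "enn_powr x q = (if x = \<infinity> then \<infinity> else ennreal (enn2real x powr q))"

definition mm_space :: "'a::metric_space measure \<Rightarrow> bool" where
  "mm_space M \<longleftrightarrow> space M = UNIV \<and> sets M = sets borel"

definition doubling :: "'a::metric_space measure \<Rightarrow> real \<Rightarrow> bool" where
  "doubling M Cd \<longleftrightarrow> Cd \<ge> 1 \<and>
     (\<forall>x r. r > 0 \<longrightarrow> 0 < emeasure M (ball x r) \<and> emeasure M (ball x r) < \<infinity>) \<and>
     (\<forall>x r. r > 0 \<longrightarrow> emeasure M (ball x (2 * r)) \<le> ennreal Cd * emeasure M (ball x r))"

definition curve_length :: "(real \<Rightarrow> 'a::metric_space) \<Rightarrow> real \<Rightarrow> real \<Rightarrow> ennreal" where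
  "curve_length \<gamma> a b =
     (SUP (m, t) \<in> {(m, t). t 0 = a \<and> t m = b \<and> (\<forall>i<m. t i \<le> t (Suc i))}.
        ennreal (\<Sum>i<m. dist (\<gamma> (t i)) (\<gamma> (t (Suc i)))))"

definition rectifiable_curve :: "(real \<Rightarrow> 'a::metric_space) \<Rightarrow> real \<Rightarrow> real \<Rightarrow> 'a set \<Rightarrow> bool" where
  "rectifiable_curve \<gamma> a b U \<longleftrightarrow>
     a \<le> b \<and> continuous_on {a..b} \<gamma> \<and> \<gamma> ` {a..b} \<subseteq> U \<and> curve_length \<gamma> a b < \<infinity>"

text \<open>Arc-length parametrisation: gamma = arclen_param o s_gamma with s_gamma(t) = length of gamma on [a,t].\<close>
definition arclen_param :: "(real \<Rightarrow> 'a::metric_space) \<Rightarrow> real \<Rightarrow> real \<Rightarrow> real \<Rightarrow> 'a" where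
  "arclen_param \<gamma> a b s = \<gamma> (SOME t. t \<in> {a..b} \<and> enn2real (curve_length \<gamma> a t) = s)"

definition line_integral :: "('a::metric_space \<Rightarrow> ennreal) \<Rightarrow> (real \<Rightarrow> 'a) \<Rightarrow> real \<Rightarrow> real \<Rightarrow> ennreal" where
  "line_integral g \<gamma> a b =
     (\<integral>\<^sup>+ s. g (arclen_param \<gamma> a b s) * indicator {0..enn2real (curve_length \<gamma> a b)} s \<partial>lborel)"

text \<open>g is an upper gradient of u on the open set U.  The values of g outside U are irrelevant;
  g is required to be Borel.\<close>
definition upper_gradient_on :: "'a::metric_space set \<Rightarrow> ('a \<Rightarrow> 'v::real_normed_vector) \<Rightarrow> ('a \<Rightarrow> ennreal) \<Rightarrow> bool" where
  "upper_gradient_on U u g \<longleftrightarrow> g \<in> borel_measurable borel \<and>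
     (\<forall>\<gamma> a b. rectifiable_curve \<gamma> a b U \<longrightarrow>
        ennreal (norm (u (\<gamma> b) - u (\<gamma> a))) \<le> line_integral g \<gamma> a b)"

definition ball_avg :: "'a::metric_space measure \<Rightarrow> 'a set \<Rightarrow> ('a \<Rightarrow> real) \<Rightarrow> real" where
  "ball_avg M B u = (1 / measure M B) * (LINT y:B|M. u y)"

definition supports_poincare :: "'a::metric_space measure \<Rightarrow> real \<Rightarrow> bool" where
  "supports_poincare M p \<longleftrightarrow> (\<exists>CP \<sigma>. CP > 0 \<and> \<sigma> \<ge> 1 \<and>
     (\<forall>x r (u :: 'a \<Rightarrow> real) g. r > 0 \<longrightarrow> set_integrable M (ball x (\<sigma> * r)) u \<longrightarrow>
        upper_gradient_on (ball x (\<sigma> * r)) u g \<longrightarrow>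
        ennreal (ball_avg M (ball x r) (\<lambda>y. \<bar>u y - ball_avg M (ball x r) u\<bar>))
          \<le> ennreal (CP * diameter (ball x r)) *
             enn_powr ((\<integral>\<^sup>+ y\<in>ball x (\<sigma> * r). enn_powr (g y) p \<partial>M) / emeasure M (ball x (\<sigma> * r))) (1 / p)))"

definition Lp_norm :: "'a measure \<Rightarrow> real \<Rightarrow> ('a \<Rightarrow> ennreal) \<Rightarrow> ennreal" where
  "Lp_norm M p f = enn_powr (\<integral>\<^sup>+ x. enn_powr (f x) p \<partial>M) (1 / p)"

definition in_Lp :: "'a measure \<Rightarrow> real \<Rightarrow> ('a \<Rightarrow> 'v::real_normed_vector) \<Rightarrow> bool" where
  "in_Lp M p u \<longleftrightarrow> u \<in> borel_measurable M \<and> Lp_norm M p (\<lambda>x. ennreal (norm (u x))) < \<infinity>"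

definition in_N1p :: "'a::metric_space measure \<Rightarrow> real \<Rightarrow> ('a \<Rightarrow> 'v::banach) \<Rightarrow> bool" where
  "in_N1p M p u \<longleftrightarrow> in_Lp M p u \<and>
     (\<exists>g. upper_gradient_on UNIV u g \<and> Lp_norm M p g < \<infinity>)"

definition N1p_norm :: "'a::metric_space measure \<Rightarrow> real \<Rightarrow> ('a \<Rightarrow> 'v::banach) \<Rightarrow> ennreal" where
  "N1p_norm M p u = Lp_norm M p (\<lambda>x. ennreal (norm (u x))) +
     (INF g \<in> {g. upper_gradient_on UNIV u g}. Lp_norm M p g)"

text \<open>N^{1,p}(X,Y) via an isometric embedding lam of Y into a Banach space V.\<close>
definition in_N1p_map :: "'a::metric_space measure \<Rightarrow> real \<Rightarrow> ('b \<Rightarrow> 'v::banach) \<Rightarrow> ('a \<Rightarrow> 'b) \<Rightarrow> bool" where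
  "in_N1p_map M p lam u \<longleftrightarrow> in_N1p M p (lam \<circ> u)"

definition N1p_map_dist :: "'a::metric_space measure \<Rightarrow> real \<Rightarrow> ('b \<Rightarrow> 'v::banach) \<Rightarrow> ('a \<Rightarrow> 'b) \<Rightarrow> ('a \<Rightarrow> 'b) \<Rightarrow> ennreal" where
  "N1p_map_dist M p lam u v = N1p_norm M p (\<lambda>x. lam (u x) - lam (v x))"

definition isometric_embedding :: "('b::metric_space \<Rightarrow> 'v::real_normed_vector) \<Rightarrow> bool" where
  "isometric_embedding lam \<longleftrightarrow> (\<forall>y z. norm (lam y - lam z) = dist y z)"

definition Lipschitz_map :: "('a::metric_space \<Rightarrow> 'b::metric_space) \<Rightarrow> bool" where
  "Lipschitz_map f \<longleftrightarrow> (\<exists>L. \<forall>x y. dist (f x) (f y) \<le> L * dist x y)"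

definition nagata_cond :: "'a::metric_space itself \<Rightarrow> nat \<Rightarrow> bool" where
  "nagata_cond _ n \<longleftrightarrow> (\<exists>C > 0. \<forall>s > 0. \<exists>(I :: 'a set) (A :: 'a \<Rightarrow> 'a set).
      (\<Union>i\<in>I. A i) = UNIV \<and>
      (\<forall>i\<in>I. bounded (A i) \<and> diameter (A i) \<le> C * s) \<and>
      (\<forall>x. finite {i\<in>I. A i \<inter> ball x s \<noteq> {}} \<and> card {i\<in>I. A i \<inter> ball x s \<noteq> {}} \<le> n + 1))"

text \<open>Nagata dimension as an element of enat (infinity if no n works).\<close>
definition nagata_dim :: "'a::metric_space itself \<Rightarrow> enat" where
  "nagata_dim X = (INF n \<in> {n. nagata_cond X n}. enat n)"

text \<open>Euclidean space R^(k+1) represented by functions nat => real vanishing from index k+1 on.\<close>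
definition eucl_dist :: "nat \<Rightarrow> (nat \<Rightarrow> real) \<Rightarrow> (nat \<Rightarrow> real) \<Rightarrow> real" where
  "eucl_dist k x y = sqrt (\<Sum>i\<le>k. (x i - y i)\<^sup>2)"

definition unit_sphere :: "nat \<Rightarrow> (nat \<Rightarrow> real) set" where
  "unit_sphere k = {x. (\<forall>i>k. x i = 0) \<and> (\<Sum>i\<le>k. (x i)\<^sup>2) = 1}"

definition unit_ball :: "nat \<Rightarrow> (nat \<Rightarrow> real) set" where
  "unit_ball k = {x. (\<forall>i>k. x i = 0) \<and> (\<Sum>i\<le>k. (x i)\<^sup>2) \<le> 1}"

definition lipschitz_from_eucl :: "nat \<Rightarrow> real \<Rightarrow> (nat \<Rightarrow> real) set \<Rightarrow> ((nat \<Rightarrow> real) \<Rightarrow> 'b::metric_space) \<Rightarrow> bool" where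
  "lipschitz_from_eucl k L S f \<longleftrightarrow> (\<forall>x\<in>S. \<forall>y\<in>S. dist (f x) (f y) \<le> L * eucl_dist k x y)"

definition lipschitz_connected :: "'b::metric_space itself \<Rightarrow> nat \<Rightarrow> bool" where
  "lipschitz_connected _ m \<longleftrightarrow> (\<exists>\<gamma>::real. \<gamma> \<ge> 1 \<and>
     (\<forall>k \<le> m. \<forall>L (f :: (nat \<Rightarrow> real) \<Rightarrow> 'b). L \<ge> 0 \<longrightarrow> lipschitz_from_eucl k L (unit_sphere k) f \<longrightarrow>
        (\<exists>F :: (nat \<Rightarrow> real) \<Rightarrow> 'b. lipschitz_from_eucl k (\<gamma> * L) (unit_ball k) F \<and>
           (\<forall>x\<in>unit_sphere k. F x = f x))))"

end

(* Lipschitz truncation. Let H = g^p + |u|^p, where g is an upper gradient of u. Where all averages of H over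
   a countable family of balls are at most t^p, the Poincare inequality bounds the oscillation of the
   real functions dist (u x) b, b in a countable dense set, on balls at all dyadic scales, so u is
   O(t)-Lipschitz there off a null set; the exceptional set has measure o(t^-p). By inner regularity u is
   O(t)-Lipschitz on a closed set E with complement of measure o(t^-p), and the Lang-Schlichenmaier theorem
   extends u from E to an O(t)-Lipschitz map v on X. Closedness of E makes (g + O(t)) * indicator (-E) an
   upper gradient of u - v: a curve meets E for a first and a last time. Its L^p norm and that of u - v tend
   to 0.

   For the extension, Nagata dimension <= n gives Whitney-type covers of X - E in n + 1 colours, hence a
   Lipschitz map from X - E to a nerve of dimension <= n, and the vertex map of the nerve into Y is extended
   skeleton by skeleton by the Lipschitz (n-1)-connectedness. *)
theory Submission
  imports Defs
begin

section \<open>Curves and truncated upper gradients\<close>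

text \<open>The extension constant must not depend on E or t. Then whatever is added off E is at
  most a fixed multiple of t, and the p-th power of its norm is a multiple of t^p times the measure
  of the complement of E, which has to become small and not merely bounded. A bare weak-type bound
  for H gives O(t^-p); the little o comes from applying it to the part of H above half the level,
  whose integral tends to 0. The summand |u|^p in H makes u bounded by t on E, and bounded diameter
  turns this into a bound O(t) for v everywhere, which the L^p norm of u - v needs. Real functions
  enter because the Poincare inequality speaks of real u only. Pointwise values are recovered from
  means by Borel-Cantelli on nets: the oscillation at scale r is O(tr), hence summable over dyadic
  scales. In the extension, the natural size of a simplex of the nerve varies with the distance to
  E. Bounds on a simplex are therefore relative to the spread of its vertex values, and this spread
  cancels against a partition of unity whose Lipschitz constant is of the order of the reciprocal of
  that distance.\<close>

lemma curve_length_upper: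
  assumes "t 0 = a" "t m = b" "\<And>i. i < m \<Longrightarrow> t i \<le> t (Suc i)"
  shows "ennreal (\<Sum>i<m. dist (\<gamma> (t i)) (\<gamma> (t (Suc i)))) \<le> curve_length \<gamma> a b"
  unfolding curve_length_def using assms
  by (intro SUP_upper2[where i="(m,t)"]) auto

lemma curve_length_least:
  assumes "\<And>m t. t 0 = a \<Longrightarrow> t m = b \<Longrightarrow> (\<And>i. i < m \<Longrightarrow> t i \<le> t (Suc i)) \<Longrightarrow>
     ennreal (\<Sum>i<m. dist (\<gamma> (t i)) (\<gamma> (t (Suc i)))) \<le> L"
  shows "curve_length \<gamma> a b \<le> L"
  unfolding curve_length_def using assms by (intro SUP_least) auto

lemma dist_le_curve_length:
  assumes "a \<le> b" shows "ennreal (dist (\<gamma> a) (\<gamma> b)) \<le> curve_length \<gamma> a b"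
  using curve_length_upper[of "\<lambda>i. if i = 0 then a else b" a 1 b \<gamma>] assms by simp

lemma partition_bounds:
  fixes t :: "nat \<Rightarrow> real"
  assumes "\<And>i. i < m \<Longrightarrow> t i \<le> t (Suc i)" "i \<le> m"
  shows "t 0 \<le> t i" "t i \<le> t m"
proof -
  show "t 0 \<le> t i" using assms(2)
    by (induction i) (use assms(1) in \<open>auto intro: order_trans\<close>)
  show "t i \<le> t m" using assms(2)
    by (induction i rule: inc_induct) (use assms(1) in \<open>auto intro: order_trans\<close>)
qed

lemma curve_length_self [simp]: "curve_length \<gamma> a a = 0"
proof -
  have "curve_length \<gamma> a a \<le> 0"
  proof (rule curve_length_least)
    fix m and t :: "nat \<Rightarrow> real"
    assume t: "t 0 = a" "t m = a" "\<And>i. i < m \<Longrightarrow> t i \<le> t (Suc i)"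
    have "t i = a" if "i \<le> m" for i using partition_bounds[of m t i] t that by (intro antisym) auto
    then show "ennreal (\<Sum>i<m. dist (\<gamma> (t i)) (\<gamma> (t (Suc i)))) \<le> 0" by simp
  qed
  then show ?thesis by simp
qed

lemma curve_length_add:
  assumes "a \<le> c" "c \<le> b"
  shows "curve_length \<gamma> a b = curve_length \<gamma> a c + curve_length \<gamma> c b"
proof (rule antisym)
  show "curve_length \<gamma> a b \<le> curve_length \<gamma> a c + curve_length \<gamma> c b"
  proof (rule curve_length_least)
    fix m and t :: "nat \<Rightarrow> real"
    assume t: "t 0 = a" "t m = b" "\<And>i. i < m \<Longrightarrow> t i \<le> t (Suc i)"
    let ?d = "\<lambda>t i. dist (\<gamma> (t i)) (\<gamma> (t (Suc i)))"
    \<comment> \<open>Clipping at \<open>c\<close> by \<open>min\<close> and \<open>max\<close>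
      replaces the insertion of \<open>c\<close> as a partition point; only a step straddling
      \<open>c\<close> needs the triangle inequality, every other step has one zero summand.\<close>
    have "?d t i \<le> ?d (\<lambda>i. min (t i) c) i + ?d (\<lambda>i. max (t i) c) i" if "i < m" for i
    proof -
      consider "t (Suc i) \<le> c" | "c \<le> t i" | "t i \<le> c" "c \<le> t (Suc i)" by linarith
      then show ?thesis
      proof cases
        case 3
        then show ?thesis by (simp add: min_def max_def dist_triangle)
      qed (use t(3)[OF that] in \<open>auto simp: min_def max_def\<close>)
    qed
    then have "(\<Sum>i<m. ?d t i) \<le> (\<Sum>i<m. ?d (\<lambda>i. min (t i) c) i) + (\<Sum>i<m. ?d (\<lambda>i. max (t i) c) i)"
      unfolding sum.distrib[symmetric] by (intro sum_mono) auto
    then have "ennreal (\<Sum>i<m. ?d t i) \<le> ennreal (\<Sum>i<m. ?d (\<lambda>i. min (t i) c) i) + ennreal (\<Sum>i<m. ?d (\<lambda>i. max (t i) c) i)"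
      by (subst ennreal_plus[symmetric]) (auto intro!: sum_nonneg ennreal_leI simp del: ennreal_plus)
    also have "\<dots> \<le> curve_length \<gamma> a c + curve_length \<gamma> c b"
      by (intro add_mono curve_length_upper) (use t assms in \<open>auto intro: min.coboundedI1 max.coboundedI1\<close>)
    finally show "ennreal (\<Sum>i<m. ?d t i) \<le> curve_length \<gamma> a c + curve_length \<gamma> c b" .
  qed
next
  let ?P = "\<lambda>a b. {(m, t). t 0 = a \<and> t m = b \<and> (\<forall>i<m. t i \<le> t (Suc i))} :: (nat \<times> (nat \<Rightarrow> real)) set"
  let ?S = "\<lambda>(m, t). ennreal (\<Sum>i<m. dist (\<gamma> (t i)) (\<gamma> (t (Suc i))))"
  have ne: "?P a b \<noteq> {}" if "a \<le> b" for a b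
    using that by (auto intro!: exI[of _ 1] exI[of _ "\<lambda>i. if i = 0 then a else b"])
  have key: "?S p + ?S q \<le> curve_length \<gamma> a b" if pq: "p \<in> ?P a c" "q \<in> ?P c b" for p q
  proof -
    obtain m t where p: "p = (m, t)" by (cases p)
    obtain l s where q: "q = (l, s)" by (cases q)
    have t: "t 0 = a" "t m = c" "\<And>i. i < m \<Longrightarrow> t i \<le> t (Suc i)" using pq p by auto
    have s: "s 0 = c" "s l = b" "\<And>i. i < l \<Longrightarrow> s i \<le> s (Suc i)" using pq q by auto
    define r where "r i = (if i \<le> m then t i else s (i - m))" for i
    have rs: "r (m + i) = s i" for i unfolding r_def using t s by auto
    have split: "(\<Sum>i<m + l. f i) = (\<Sum>i<m. f i) + (\<Sum>i<l. f (m + i))" for f :: "nat \<Rightarrow> real"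
      by (induction l) auto
    have "(\<Sum>i<m + l. dist (\<gamma> (r i)) (\<gamma> (r (Suc i)))) =
       (\<Sum>i<m. dist (\<gamma> (r i)) (\<gamma> (r (Suc i)))) + (\<Sum>i<l. dist (\<gamma> (s i)) (\<gamma> (s (Suc i))))"
      unfolding split using rs[of "Suc _"] by (simp add: rs)
    also have "(\<Sum>i<m. dist (\<gamma> (r i)) (\<gamma> (r (Suc i)))) = (\<Sum>i<m. dist (\<gamma> (t i)) (\<gamma> (t (Suc i))))"
      by (auto simp: r_def intro!: sum.cong)
    finally have eq: "(\<Sum>i<m + l. dist (\<gamma> (r i)) (\<gamma> (r (Suc i)))) =
       (\<Sum>i<m. dist (\<gamma> (t i)) (\<gamma> (t (Suc i)))) + (\<Sum>i<l. dist (\<gamma> (s i)) (\<gamma> (s (Suc i))))" .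
    have mono: "r i \<le> r (Suc i)" if "i < m + l" for i
    proof (cases "i < m")
      case True then show ?thesis using t by (auto simp: r_def)
    next
      case False
      then obtain j where "i = m + j" using le_Suc_ex not_less by blast
      then show ?thesis using rs[of j] rs[of "Suc j"] s(3)[of j] that by simp
    qed
    have "ennreal (\<Sum>i<m + l. dist (\<gamma> (r i)) (\<gamma> (r (Suc i)))) \<le> curve_length \<gamma> a b"
      by (rule curve_length_upper) (use mono t s rs[of l] in \<open>auto simp: r_def\<close>)
    then show ?thesis unfolding eq p q by (simp add: sum_nonneg)
  qed
  have "curve_length \<gamma> a c + curve_length \<gamma> c b = (SUP p\<in>?P a c. ?S p + curve_length \<gamma> c b)"
    unfolding curve_length_def[of \<gamma> a c] using ne[of a c] assms by (subst ennreal_SUP_add_left) auto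
  also have "\<dots> \<le> curve_length \<gamma> a b"
  proof (rule SUP_least)
    fix p assume p: "p \<in> ?P a c"
    have "?S p + curve_length \<gamma> c b = (SUP q\<in>?P c b. ?S p + ?S q)"
      unfolding curve_length_def[of \<gamma> c b] using ne[of c b] assms by (subst ennreal_SUP_add_right) auto
    also have "\<dots> \<le> curve_length \<gamma> a b" using key[OF p] by (intro SUP_least) auto
    finally show "?S p + curve_length \<gamma> c b \<le> curve_length \<gamma> a b" .
  qed
  finally show "curve_length \<gamma> a c + curve_length \<gamma> c b \<le> curve_length \<gamma> a b" .
qed

section \<open>Arc-length parametrisation of a rectifiable curve\<close>

locale rect_curve =
  fixes \<gamma> :: "real \<Rightarrow> 'a::metric_space" and a b :: real
  assumes ab: "a \<le> b" and cont: "continuous_on {a..b} \<gamma>" and fin: "curve_length \<gamma> a b < \<infinity>"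
begin

definition len :: "real \<Rightarrow> real \<Rightarrow> real" where "len s t = enn2real (curve_length \<gamma> s t)"

lemma curve_length_finite: assumes "a \<le> s" "s \<le> t" "t \<le> b" shows "curve_length \<gamma> s t < \<infinity>"
proof -
  have "curve_length \<gamma> a b = curve_length \<gamma> a s + (curve_length \<gamma> s t + curve_length \<gamma> t b)"
    using assms by (simp add: curve_length_add[of a s b] curve_length_add[of s t b])
  then show ?thesis using fin by (auto simp: less_top)
qed

lemma ennreal_len: assumes "a \<le> s" "s \<le> t" "t \<le> b" shows "ennreal (len s t) = curve_length \<gamma> s t"
  unfolding len_def using curve_length_finite[OF assms] by simp

lemma len_nonneg [simp]: "0 \<le> len s t" unfolding len_def by simp

lemma len_self [simp]: "len s s = 0" unfolding len_def by simp

lemma len_add: assumes "a \<le> s" "s \<le> t" "t \<le> u" "u \<le> b" shows "len s u = len s t + len t u"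
proof -
  have "ennreal (len s u) = ennreal (len s t + len t u)"
    using assms by (simp add: ennreal_len curve_length_add[of s t u])
  then show ?thesis by (simp flip: ennreal_plus)
qed

lemma dist_le_len: assumes "a \<le> s" "s \<le> t" "t \<le> b" shows "dist (\<gamma> s) (\<gamma> t) \<le> len s t"
  using dist_le_curve_length[OF assms(2), of \<gamma>] unfolding ennreal_len[OF assms, symmetric] by simp

lemma len_mono: assumes "a \<le> s" "s \<le> t" "t \<le> b" shows "len a s \<le> len a t"
  using len_add[of a s t] assms by simp

lemma len_approx:
  assumes "a \<le> s" "s \<le> t" "t \<le> b" "0 < e"
  shows "\<exists>m p. p 0 = s \<and> p m = t \<and> (\<forall>i<m. p i \<le> p (Suc i)) \<and>
    len s t - e < (\<Sum>i<m. dist (\<gamma> (p i)) (\<gamma> (p (Suc i))))"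
proof (cases "len s t - e < 0")
  case True
  then have "len s t - e < dist (\<gamma> s) (\<gamma> t)" by (rule less_le_trans) simp
  then show ?thesis
    by (intro exI[of _ 1] exI[of _ "\<lambda>i. if i = 0 then s else t"]) (use assms in auto)
next
  case False
  then have "ennreal (len s t - e) < ennreal (len s t)" using assms by (subst ennreal_less_iff) auto
  also have "\<dots> = curve_length \<gamma> s t" using assms by (simp add: ennreal_len)
  finally show ?thesis unfolding curve_length_def less_SUP_iff
    using False by (clarsimp simp: ennreal_less_iff)
qed

text \<open>Lower semicontinuity of length: a partition of \<open>[a, s]\<close> that is optimal up
  to \<open>e\<close>, clipped at \<open>t\<close>, has a sum continuous in \<open>t\<close>, and
  for \<open>t \<le> s\<close> that sum is a lower bound for the length up to
  \<open>t\<close>.\<close>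

lemma lsc_left:
  assumes s: "a \<le> s" "s \<le> b" and e: "0 < e"
  shows "\<exists>d>0. \<forall>t\<in>{a..b}. \<bar>t - s\<bar> < d \<longrightarrow> len a s - e < len a t"
proof -
  obtain m p where p: "p 0 = a" "p m = s" "\<And>i. i < m \<Longrightarrow> p i \<le> p (Suc i)"
    and gt: "len a s - e < (\<Sum>i<m. dist (\<gamma> (p i)) (\<gamma> (p (Suc i))))"
    using len_approx[of a s e] s e by blast
  have pb: "a \<le> p i" "p i \<le> s" if "i \<le> m" for i using partition_bounds[of m p i] p that by auto
  have pb': "a \<le> p i" "p i \<le> b" if "i \<le> m" for i using pb[OF that] s by auto
  define S where "S t = (\<Sum>i<m. dist (\<gamma> (min (p i) t)) (\<gamma> (min (p (Suc i)) t)))" for t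
  have eq: "S s = (\<Sum>i<m. dist (\<gamma> (p i)) (\<gamma> (p (Suc i))))"
    unfolding S_def using pb by (intro sum.cong) (auto simp: min_absorb1)
  have c1: "continuous_on {a..b} (\<lambda>t. \<gamma> (min x t))" if "a \<le> x" "x \<le> b" for x
    using that by (intro continuous_on_compose2[OF cont] continuous_intros) auto
  have "continuous_on {a..b} S" unfolding S_def
    by (intro continuous_on_sum continuous_on_dist c1) (use pb' in auto)
  moreover have "0 < S s - (len a s - e)" "s \<in> {a..b}" using gt eq s by auto
  ultimately have "\<exists>d>0. \<forall>t\<in>{a..b}. dist t s < d \<longrightarrow> dist (S t) (S s) < S s - (len a s - e)"
    unfolding continuous_on_iff by blast
  then obtain d where d: "d > 0" "\<And>t. t \<in> {a..b} \<Longrightarrow> dist t s < d \<Longrightarrow> dist (S t) (S s) < S s - (len a s - e)" by blast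
  show ?thesis
  proof (intro exI[of _ d] conjI ballI impI d)
    fix t assume t: "t \<in> {a..b}" "\<bar>t - s\<bar> < d"
    then have St: "len a s - e < S t" using d(2)[of t] by (auto simp: dist_real_def)
    show "len a s - e < len a t"
    proof (cases "t \<le> s")
      case True
      have "ennreal (S t) \<le> curve_length \<gamma> a t" unfolding S_def
        by (rule curve_length_upper) (use p t True in \<open>auto intro: min.coboundedI1\<close>)
      then show ?thesis using St t by (simp add: ennreal_len[symmetric])
    next
      case False
      then show ?thesis using len_mono[of s t] s t e by auto
    qed
  qed
qed

lemma lsc_right:
  assumes s: "a \<le> s" "s \<le> b" and e: "0 < e"
  shows "\<exists>d>0. \<forall>t\<in>{a..b}. \<bar>t - s\<bar> < d \<longrightarrow> len s b - e < len t b"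
proof -
  obtain m p where p: "p 0 = s" "p m = b" "\<And>i. i < m \<Longrightarrow> p i \<le> p (Suc i)"
    and gt: "len s b - e < (\<Sum>i<m. dist (\<gamma> (p i)) (\<gamma> (p (Suc i))))"
    using len_approx[of s b e] s e by blast
  have pb: "s \<le> p i" "p i \<le> b" if "i \<le> m" for i using partition_bounds[of m p i] p that by auto
  have pb': "a \<le> p i" "p i \<le> b" if "i \<le> m" for i using pb[OF that] s by auto
  define S where "S t = (\<Sum>i<m. dist (\<gamma> (max (p i) t)) (\<gamma> (max (p (Suc i)) t)))" for t
  have eq: "S s = (\<Sum>i<m. dist (\<gamma> (p i)) (\<gamma> (p (Suc i))))"
    unfolding S_def using pb by (intro sum.cong) (auto simp: max_absorb1)
  have c1: "continuous_on {a..b} (\<lambda>t. \<gamma> (max x t))" if "a \<le> x" "x \<le> b" for x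
    using that by (intro continuous_on_compose2[OF cont] continuous_intros) auto
  have "continuous_on {a..b} S" unfolding S_def
    by (intro continuous_on_sum continuous_on_dist c1) (use pb' in auto)
  moreover have "0 < S s - (len s b - e)" "s \<in> {a..b}" using gt eq s by auto
  ultimately have "\<exists>d>0. \<forall>t\<in>{a..b}. dist t s < d \<longrightarrow> dist (S t) (S s) < S s - (len s b - e)"
    unfolding continuous_on_iff by blast
  then obtain d where d: "d > 0" "\<And>t. t \<in> {a..b} \<Longrightarrow> dist t s < d \<Longrightarrow> dist (S t) (S s) < S s - (len s b - e)" by blast
  show ?thesis
  proof (intro exI[of _ d] conjI ballI impI d)
    fix t assume t: "t \<in> {a..b}" "\<bar>t - s\<bar> < d"
    then have St: "len s b - e < S t" using d(2)[of t] by (auto simp: dist_real_def)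
    show "len s b - e < len t b"
    proof (cases "s \<le> t")
      case True
      have "ennreal (S t) \<le> curve_length \<gamma> t b" unfolding S_def
        by (rule curve_length_upper) (use p t True in \<open>auto intro: max.coboundedI1\<close>)
      then show ?thesis using St t by (simp add: ennreal_len[symmetric])
    next
      case False
      then have "len t b = len t s + len s b" using s t by (intro len_add) auto
      moreover have "0 \<le> len t s" by simp
      ultimately show ?thesis using e by linarith
    qed
  qed
qed

text \<open>\<open>len a t\<close> and \<open>len t b\<close> are both lower semicontinuous in
  \<open>t\<close> and add up to the constant \<open>len a b\<close>, so each is continuous.\<close>

lemma continuous_len: "continuous_on {a..b} (len a)"
  unfolding continuous_on_iff
proof (intro ballI allI impI)
  fix s e :: real assume s: "s \<in> {a..b}" and e: "0 < e"
  obtain d1 where d1: "d1 > 0" "\<And>t. t \<in> {a..b} \<Longrightarrow> \<bar>t - s\<bar> < d1 \<Longrightarrow> len a s - e < len a t"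
    using lsc_left[of s e] s e by auto
  obtain d2 where d2: "d2 > 0" "\<And>t. t \<in> {a..b} \<Longrightarrow> \<bar>t - s\<bar> < d2 \<Longrightarrow> len s b - e < len t b"
    using lsc_right[of s e] s e by auto
  show "\<exists>d>0. \<forall>t\<in>{a..b}. dist t s < d \<longrightarrow> dist (len a t) (len a s) < e"
  proof (intro exI[of _ "min d1 d2"] conjI ballI impI)
    fix t assume t: "t \<in> {a..b}" "dist t s < min d1 d2"
    have "len a b = len a s + len s b" "len a b = len a t + len t b"
      using s t by (auto intro: len_add)
    then show "dist (len a t) (len a s) < e"
      using d1(2)[of t] d2(2)[of t] t by (auto simp: dist_real_def)
  qed (use d1 d2 in auto)
qed

definition sg :: "real \<Rightarrow> 'a" where "sg = arclen_param \<gamma> a b"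

lemma len_surj: assumes "0 \<le> s" "s \<le> len a b" obtains t where "t \<in> {a..b}" "len a t = s"
  using IVT'[of "len a" a s b] assms ab continuous_len by auto

text \<open>The curve is constant where its length does not grow; this makes the choice of a
  preimage in \<open>arclen_param\<close> harmless.\<close>

lemma gamma_eq: assumes "s \<in> {a..b}" "t \<in> {a..b}" "len a s = len a t" shows "\<gamma> s = \<gamma> t"
proof -
  have "\<gamma> s = \<gamma> t" if "s \<in> {a..b}" "t \<in> {a..b}" "len a s = len a t" "s \<le> t" for s t
    using len_add[of a s t] dist_le_len[of s t] that by simp
  then show ?thesis using assms by (metis linorder_linear)
qed

lemma sg_len: assumes "t \<in> {a..b}" shows "sg (len a t) = \<gamma> t"
proof -
  let ?P = "\<lambda>t'. t' \<in> {a..b} \<and> enn2real (curve_length \<gamma> a t') = len a t"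
  have "?P (SOME t'. ?P t')" by (rule someI[of ?P t]) (use assms in \<open>auto simp: len_def\<close>)
  then show ?thesis unfolding sg_def arclen_param_def using gamma_eq[OF _ assms] by (auto simp: len_def)
qed

lemma sg_lipschitz: assumes "s \<in> {0..len a b}" "t \<in> {0..len a b}" shows "dist (sg s) (sg t) \<le> \<bar>s - t\<bar>"
proof -
  have "dist (sg s) (sg t) \<le> \<bar>s - t\<bar>" if st: "s \<in> {0..len a b}" "t \<in> {0..len a b}" "s \<le> t" for s t
  proof -
    obtain s' where s': "s' \<in> {a..b}" "len a s' = s" using len_surj[of s] st by auto
    obtain t' where t': "t' \<in> {a..b}" "len a t' = t" using len_surj[of t] st by auto
    show ?thesis
    proof (cases "s' \<le> t'")
      case True
      then show ?thesis using dist_le_len[of s' t'] len_add[of a s' t'] s' t' sg_len[of s'] sg_len[of t'] by auto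
    next
      case False
      then show ?thesis using len_mono[of t' s'] s' t' st by auto
    qed
  qed
  then show ?thesis using assms by (metis abs_minus_commute dist_commute linorder_linear)
qed

lemma sg_continuous: "continuous_on {0..len a b} sg"
  unfolding continuous_on_iff
proof (intro ballI allI impI)
  fix s e :: real assume "s \<in> {0..len a b}" "0 < e"
  then show "\<exists>d>0. \<forall>t\<in>{0..len a b}. dist t s < d \<longrightarrow> dist (sg t) (sg s) < e"
    using sg_lipschitz by (intro exI[of _ e]) (auto simp: dist_real_def intro: le_less_trans[OF sg_lipschitz])
qed

text \<open>\<open>sg\<close> is under control only on \<open>{0..len a b}\<close>, since the choice
  defining it is arbitrary elsewhere; the indicator removes those values.\<close>

lemma measurable_sg:
  assumes [measurable]: "g \<in> borel_measurable borel" and D: "D \<subseteq> {0..len a b}" "D \<in> sets borel"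
  shows "(\<lambda>s. (g (sg s) :: ennreal) * indicator D s) \<in> borel_measurable borel"
proof -
  have "sg \<in> borel_measurable (restrict_space borel {0..len a b})"
    by (rule borel_measurable_continuous_on_restrict[OF sg_continuous])
  then have "(\<lambda>s. g (sg s)) \<in> borel_measurable (restrict_space borel {0..len a b})" by measurable
  then have "(\<lambda>s. g (sg s) * indicator {0..len a b} s) \<in> borel_measurable borel"
    by (subst (asm) borel_measurable_restrict_space_iff_ennreal) auto
  then have "(\<lambda>s. (g (sg s) * indicator {0..len a b} s) * indicator D s) \<in> borel_measurable borel"
    using D(2) by measurable
  also have "(\<lambda>s. (g (sg s) * indicator {0..len a b} s) * indicator D s) = (\<lambda>s. g (sg s) * indicator D s)"
    using D(1) by (auto simp: indicator_def fun_eq_iff subset_iff)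
  finally show ?thesis .
qed

lemma sub_curve: assumes "a \<le> c" "c \<le> d" "d \<le> b" shows "rect_curve \<gamma> c d"
  by unfold_locales (use assms curve_length_finite[of c d] cont in \<open>auto intro: continuous_on_subset\<close>)

lemma sub_param:
  assumes cd: "a \<le> c" "c \<le> d" "d \<le> b" and s: "0 \<le> s" "s \<le> len c d"
  shows "arclen_param \<gamma> c d s = sg (len a c + s)"
proof -
  interpret S: rect_curve \<gamma> c d by (rule sub_curve[OF cd])
  obtain t where t: "t \<in> {c..d}" "len c t = s" using S.len_surj[of s] s by auto
  have "arclen_param \<gamma> c d s = \<gamma> t" using S.sg_len[of t] t unfolding S.sg_def by simp
  also have "\<dots> = sg (len a t)" using t cd by (intro sg_len[symmetric]) auto
  also have "len a t = len a c + s" using len_add[of a c t] t cd by auto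
  finally show ?thesis .
qed

text \<open>The arc-length parametrisation of a subcurve is a translate of the one for the whole
  curve, so integrals along successive subcurves become integrals over disjoint intervals and can be
  added.\<close>

lemma line_integral_sub:
  assumes cd: "a \<le> c" "c \<le> d" "d \<le> b" and g: "g \<in> borel_measurable borel"
  shows "line_integral g \<gamma> c d = (\<integral>\<^sup>+ s. g (sg s) * indicator {len a c..len a d} s \<partial>lborel)"
proof -
  have d: "len a d = len a c + len c d" using cd by (intro len_add) auto
  have "(\<integral>\<^sup>+ s. g (sg s) * indicator {len a c..len a d} s \<partial>lborel) =
     (\<integral>\<^sup>+ s. g (sg (len a c + 1 * s)) * indicator {len a c..len a d} (len a c + 1 * s) \<partial>lborel)"
    using g len_mono[of d b] ab cd
    by (subst nn_integral_real_affine[where c=1 and t="len a c"])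
       (auto intro!: measurable_sg len_nonneg order_trans[OF len_nonneg])
  also have "\<dots> = (\<integral>\<^sup>+ s. g (arclen_param \<gamma> c d s) * indicator {0..len c d} s \<partial>lborel)"
    by (intro nn_integral_cong) (auto simp: indicator_def d sub_param[OF cd])
  finally show ?thesis unfolding line_integral_def len_def by simp
qed

end

section \<open>Truncation of upper gradients off a closed set\<close>

lemma measurable_truncated_gradient:
  assumes [measurable]: "g \<in> borel_measurable borel" and "closed E"
  shows "(\<lambda>x. (g x + ennreal \<Lambda>) * indicator (- E) x) \<in> borel_measurable borel"
proof -
  have [measurable]: "- E \<in> sets borel" using assms by auto
  show ?thesis by measurable
qed

text \<open>Between the first and the last visit to \<open>E\<close> the difference
  \<open>u - v\<close> has no net change, as it vanishes at both times. What remains are two outer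
  arcs off \<open>E\<close>, where \<open>g\<close> pays for \<open>u\<close> and
  \<open>\<Lambda>\<close> for \<open>v\<close>.\<close>

lemma upper_gradient_truncate:
  fixes u v :: "'a::metric_space \<Rightarrow> 'v::real_normed_vector"
  assumes E: "closed E" and zero: "\<And>x. x \<in> E \<Longrightarrow> u x = v x"
    and g: "upper_gradient_on UNIV u g"
    and v: "\<And>x y. norm (v x - v y) \<le> \<Lambda> * dist x y" and L: "0 \<le> \<Lambda>"
  shows "upper_gradient_on UNIV (\<lambda>x. u x - v x) (\<lambda>x. (g x + ennreal \<Lambda>) * indicator (- E) x)"
  unfolding upper_gradient_on_def
proof (intro conjI allI impI)
  have gm [measurable]: "g \<in> borel_measurable borel" using g by (simp add: upper_gradient_on_def)
  let ?g = "\<lambda>x. (g x + ennreal \<Lambda>) * indicator (- E) x"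
  show gm': "?g \<in> borel_measurable borel" by (rule measurable_truncated_gradient[OF gm E])
  fix \<gamma> :: "real \<Rightarrow> 'a" and a b :: real assume rc: "rectifiable_curve \<gamma> a b UNIV"
  interpret rect_curve \<gamma> a b using rc by unfold_locales (auto simp: rectifiable_curve_def)
  define h where "h t = u (\<gamma> t) - v (\<gamma> t)" for t
  \<comment> \<open>The interval on the right is open because the ends of the arc may lie in
    \<open>E\<close>, where the truncated gradient is 0; the two end parameters form a null
    set.\<close>
  have key: "ennreal (norm (h d - h c)) \<le> (\<integral>\<^sup>+ s. ?g (sg s) * indicator {len a c<..<len a d} s \<partial>lborel)"
    if cd: "a \<le> c" "c \<le> d" "d \<le> b" and out: "\<And>t. c < t \<Longrightarrow> t < d \<Longrightarrow> \<gamma> t \<notin> E" for c d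
  proof -
    have sub: "{len a c..len a d} \<subseteq> {0..len a b}" using len_mono[of d b] cd by (auto intro: order_trans[OF len_nonneg])
    have "rectifiable_curve \<gamma> c d UNIV"
      using sub_curve[OF cd] by (auto simp: rectifiable_curve_def rect_curve_def)
    then have 1: "ennreal (norm (u (\<gamma> d) - u (\<gamma> c))) \<le> line_integral g \<gamma> c d"
      using g by (auto simp: upper_gradient_on_def)
    have "norm (v (\<gamma> d) - v (\<gamma> c)) \<le> \<Lambda> * dist (\<gamma> d) (\<gamma> c)" by (rule v)
    also have "\<dots> \<le> \<Lambda> * len c d" using dist_le_len[OF cd] L by (simp add: dist_commute mult_left_mono)
    finally have 2: "ennreal (norm (v (\<gamma> d) - v (\<gamma> c))) \<le> ennreal (\<Lambda> * len c d)" by (rule ennreal_leI)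
    have "len a d = len a c + len c d" using cd by (intro len_add) auto
    then have 3: "ennreal (\<Lambda> * len c d) = (\<integral>\<^sup>+ s. ennreal \<Lambda> * indicator {len a c..len a d} s \<partial>lborel)"
      using L by (subst nn_integral_cmult_indicator) (auto simp: ennreal_mult)
    have "norm (h d - h c) \<le> norm (u (\<gamma> d) - u (\<gamma> c)) + norm (v (\<gamma> d) - v (\<gamma> c))"
      unfolding h_def using norm_triangle_ineq4[of "u (\<gamma> d) - u (\<gamma> c)" "v (\<gamma> d) - v (\<gamma> c)"]
      by (simp add: algebra_simps)
    then have "ennreal (norm (h d - h c)) \<le> ennreal (norm (u (\<gamma> d) - u (\<gamma> c))) + ennreal (norm (v (\<gamma> d) - v (\<gamma> c)))"
      by (simp flip: ennreal_plus)
    also have "\<dots> \<le> (\<integral>\<^sup>+ s. g (sg s) * indicator {len a c..len a d} s \<partial>lborel)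
        + (\<integral>\<^sup>+ s. ennreal \<Lambda> * indicator {len a c..len a d} s \<partial>lborel)"
      using 1 2 unfolding 3 line_integral_sub[OF cd gm] by (rule add_mono)
    also have "\<dots> = (\<integral>\<^sup>+ s. g (sg s) * indicator {len a c..len a d} s + ennreal \<Lambda> * indicator {len a c..len a d} s \<partial>lborel)"
      by (subst nn_integral_add) (use measurable_sg[OF gm sub] in auto)
    also have "\<dots> \<le> (\<integral>\<^sup>+ s. ?g (sg s) * indicator {len a c<..<len a d} s \<partial>lborel)"
    proof (rule nn_integral_mono_AE)
      have "AE s in lborel. s \<noteq> len a c" "AE s in lborel. s \<noteq> len a d" by (rule AE_lborel_singleton)+
      then show "AE s in lborel. g (sg s) * indicator {len a c..len a d} s + ennreal \<Lambda> * indicator {len a c..len a d} s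
          \<le> ?g (sg s) * indicator {len a c<..<len a d} s"
      proof eventually_elim
        case (elim s)
        show ?case
        proof (cases "s \<in> {len a c..len a d}")
          case True
          then have s: "len a c < s" "s < len a d" using elim by auto
          have "0 \<le> s" "s \<le> len a b" using True sub by (meson atLeastAtMost_iff subsetD)+
          then obtain t where t: "t \<in> {a..b}" "len a t = s" by (rule len_surj)
          have "c < t" using len_mono[of t c] s t cd by (cases "c < t") auto
          moreover have "t < d" using len_mono[of d t] s t cd by (cases "t < d") auto
          ultimately have "sg s \<notin> E" using out[of t] sg_len[OF t(1)] t(2) by auto
          then show ?thesis using s by (auto simp: indicator_def)
        qed auto
      qed
    qed
    finally show ?thesis .
  qed
  show "ennreal (norm (u (\<gamma> b) - v (\<gamma> b) - (u (\<gamma> a) - v (\<gamma> a)))) \<le> line_integral ?g \<gamma> a b"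
  proof (cases "\<exists>t\<in>{a..b}. \<gamma> t \<in> E")
    case False
    then have "ennreal (norm (h b - h a)) \<le> (\<integral>\<^sup>+ s. ?g (sg s) * indicator {len a a<..<len a b} s \<partial>lborel)"
      using ab by (intro key) auto
    also have "\<dots> \<le> line_integral ?g \<gamma> a b"
      unfolding line_integral_sub[OF order_refl ab order_refl gm']
      by (intro nn_integral_mono) (auto simp: indicator_def)
    finally show ?thesis by (simp add: h_def)
  next
    case True
    define T where "T = {a..b} \<inter> \<gamma> -` E"
    have cT: "closed T" unfolding T_def using continuous_closed_preimage[OF cont _ E] by simp
    have "compact T" using cT by (simp add: compact_eq_bounded_closed T_def) (meson bounded_closed_interval bounded_subset inf_le1)
    moreover have "T \<noteq> {}" using True by (auto simp: T_def)
    ultimately obtain t1 t2 where t: "t1 \<in> T" "\<And>t. t \<in> T \<Longrightarrow> t1 \<le> t" "t2 \<in> T" "\<And>t. t \<in> T \<Longrightarrow> t \<le> t2"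
      using compact_attains_inf[of T] compact_attains_sup[of T] by metis
    have t': "a \<le> t1" "t1 \<le> t2" "t2 \<le> b" "\<gamma> t1 \<in> E" "\<gamma> t2 \<in> E" using t by (auto simp: T_def)
    have z: "h t1 = 0" "h t2 = 0" using t' zero by (auto simp: h_def)
    have 1: "ennreal (norm (h t1 - h a)) \<le> (\<integral>\<^sup>+ s. ?g (sg s) * indicator {len a a<..<len a t1} s \<partial>lborel)"
    proof (rule key)
      show "\<gamma> t \<notin> E" if "a < t" "t < t1" for t using t(2)[of t] that t' by (auto simp: T_def)
    qed (use t' in auto)
    have 2: "ennreal (norm (h b - h t2)) \<le> (\<integral>\<^sup>+ s. ?g (sg s) * indicator {len a t2<..<len a b} s \<partial>lborel)"
    proof (rule key)
      show "\<gamma> t \<notin> E" if "t2 < t" "t < b" for t using t(4)[of t] that t' by (auto simp: T_def)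
    qed (use t' in auto)
    have mm: "len a t1 \<le> len a t2" "len a t2 \<le> len a b" using t' by (auto intro: len_mono)
    have l0: "0 \<le> len a t2" by simp
    with mm have "{len a a<..<len a t1} \<subseteq> {0..len a b}" "{len a t2<..<len a b} \<subseteq> {0..len a b}" by (auto simp del: len_nonneg)
    then have m1: "(\<lambda>s. ?g (sg s) * indicator {len a a<..<len a t1} s) \<in> borel_measurable lborel"
      and m2: "(\<lambda>s. ?g (sg s) * indicator {len a t2<..<len a b} s) \<in> borel_measurable lborel"
      using measurable_sg[OF gm'] by simp_all
    have "norm (h b - h a) \<le> norm (h t1 - h a) + norm (h b - h t2)"
      unfolding z using norm_triangle_ineq4[of "h b" "h a"] by simp
    then have "ennreal (norm (h b - h a)) \<le> ennreal (norm (h t1 - h a)) + ennreal (norm (h b - h t2))"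
      by (simp flip: ennreal_plus)
    also have "\<dots> \<le> (\<integral>\<^sup>+ s. ?g (sg s) * indicator {len a a<..<len a t1} s \<partial>lborel)
         + (\<integral>\<^sup>+ s. ?g (sg s) * indicator {len a t2<..<len a b} s \<partial>lborel)" by (intro add_mono 1 2)
    also have "\<dots> = (\<integral>\<^sup>+ s. ?g (sg s) * indicator {len a a<..<len a t1} s + ?g (sg s) * indicator {len a t2<..<len a b} s \<partial>lborel)"
      by (rule nn_integral_add[symmetric, OF m1 m2])
    also have "\<dots> \<le> line_integral ?g \<gamma> a b"
      unfolding line_integral_sub[OF order_refl ab order_refl gm']
      using mm l0 by (intro nn_integral_mono) (auto simp: indicator_def simp del: len_nonneg)
    finally show ?thesis by (simp add: h_def)
  qed
qed

section \<open>Doubling measures\<close>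

text \<open>Strictness of the bound \<open>R\<close> makes each open ball of radius \<open>R\<close>
  the whole space. Hence \<open>M\<close> is finite, and \<open>R\<close> can serve as the coarsest
  dyadic scale.\<close>

locale bounded_doubling =
  fixes M :: "'a::metric_space measure" and Cd R :: real
  assumes mm: "mm_space M" and dbl: "doubling M Cd"
    and R_pos: "0 < R" and dist_less_R: "\<And>x y :: 'a. dist x y < R"
begin

lemma space_M [simp]: "space M = UNIV" and sets_M [measurable_cong, simp]: "sets M = sets borel"
  using mm by (auto simp: mm_space_def)

lemma Cd_ge_1: "1 \<le> Cd" using dbl by (simp add: doubling_def)

lemma ball_R: "ball (x :: 'a) R = UNIV" using dist_less_R by auto

sublocale finite_measure M
proof
  have "emeasure M (ball undefined R) < \<infinity>" using dbl R_pos unfolding doubling_def by blast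
  then show "emeasure M (space M) \<noteq> \<infinity>" by (simp add: ball_R)
qed

lemma ball_sets [simp, measurable]: "ball x r \<in> sets M" by simp

lemma measure_ball_pos: "0 < r \<Longrightarrow> 0 < measure M (ball x r)"
  using dbl unfolding doubling_def by (metis emeasure_eq_measure ennreal_0 less_irrefl measure_nonneg order_le_less)

lemma measure_ball_double: "0 < r \<Longrightarrow> measure M (ball x (2 * r)) \<le> Cd * measure M (ball x r)"
  using dbl Cd_ge_1 unfolding doubling_def
  by (simp add: emeasure_eq_measure ennreal_mult[symmetric])

lemma measure_ball_power: "0 < r \<Longrightarrow> measure M (ball x (2 ^ k * r)) \<le> Cd ^ k * measure M (ball x r)"
proof (induction k)
  case (Suc k)
  have "measure M (ball x (2 ^ Suc k * r)) \<le> Cd * measure M (ball x (2 ^ k * r))"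
    using measure_ball_double[of "2 ^ k * r" x] Suc by (simp add: mult.assoc)
  also have "\<dots> \<le> Cd * (Cd ^ k * measure M (ball x r))"
    using Suc Cd_ge_1 by (intro mult_left_mono) auto
  finally show ?case by (simp add: mult.assoc)
qed auto

lemma measure_le_ball:
  assumes "0 < r" "s \<le> 2 ^ k * r" "A \<subseteq> ball x s"
  shows "measure M A \<le> Cd ^ k * measure M (ball x r)"
proof -
  have "A \<subseteq> ball x (2 ^ k * r)" using assms by auto
  then have "measure M A \<le> measure M (ball x (2 ^ k * r))" by (intro finite_measure_mono) auto
  then show ?thesis using measure_ball_power[OF assms(1), of x k] by linarith
qed

definition is_net :: "'a set \<Rightarrow> real \<Rightarrow> bool" where
  "is_net S r \<longleftrightarrow> finite S \<and> (\<forall>x. \<exists>z\<in>S. dist x z < r) \<and> (\<forall>z\<in>S. \<forall>w\<in>S. z \<noteq> w \<longrightarrow> r \<le> dist z w)"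

lemma sum_separated_le:
  assumes "finite S" "\<And>z w. z \<in> S \<Longrightarrow> w \<in> S \<Longrightarrow> z \<noteq> w \<Longrightarrow> r \<le> dist z w"
  shows "(\<Sum>z\<in>S. measure M (ball z (r / 2))) \<le> measure M UNIV"
proof -
  have "disjoint_family_on (\<lambda>z. ball z (r / 2)) S"
    unfolding disjoint_family_on_def
  proof (intro ballI impI)
    fix z w assume zw: "z \<in> S" "w \<in> S" "z \<noteq> w"
    show "ball z (r / 2) \<inter> ball w (r / 2) = {}"
    proof safe
      fix y assume "y \<in> ball z (r / 2)" "y \<in> ball w (r / 2)"
      then have "dist z w < r" using dist_triangle[of z w y] by (simp add: dist_commute)
      then show "y \<in> {}" using assms(2)[OF zw] by simp
    qed
  qed
  then have "(\<Sum>z\<in>S. measure M (ball z (r / 2))) = measure M (\<Union>z\<in>S. ball z (r / 2))"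
    using assms(1) by (subst finite_measure_finite_Union) auto
  also have "\<dots> \<le> measure M UNIV" by (intro finite_measure_mono) auto
  finally show ?thesis .
qed

text \<open>A separated set of greatest cardinality is a net. Cardinalities are bounded because the
  balls of half the radius are disjoint and each carries at least the fraction
  \<open>1 / Cd ^ k\<close> of the total measure.\<close>

lemma net_exists: assumes r: "0 < r" shows "\<exists>S. is_net S r"
proof -
  obtain k where k: "R / (r / 2) < 2 ^ k" using real_arch_pow[of 2 "R / (r / 2)"] by auto
  define P where "P S \<longleftrightarrow> finite S \<and> (\<forall>z\<in>S. \<forall>w\<in>S. z \<noteq> w \<longrightarrow> r \<le> dist z w)" for S :: "'a set"
  have bound: "real (card S) \<le> Cd ^ k" if "P S" for S
  proof -
    have "measure M UNIV \<le> Cd ^ k * measure M (ball z (r / 2))" for z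
      using r k ball_R[of z] by (intro measure_le_ball[where s=R]) (auto simp: field_simps)
    then have "(\<Sum>z\<in>S. measure M UNIV) \<le> (\<Sum>z\<in>S. Cd ^ k * measure M (ball z (r / 2)))"
      by (intro sum_mono) auto
    also have "\<dots> \<le> Cd ^ k * measure M UNIV"
      unfolding sum_distrib_left[symmetric] using that Cd_ge_1 sum_separated_le[of S r]
      by (intro mult_left_mono) (auto simp: P_def)
    finally show ?thesis using measure_ball_pos[OF R_pos] by (simp add: ball_R)
  qed
  have "\<forall>S. P S \<longrightarrow> card S < nat \<lceil>Cd ^ k\<rceil> + 1"
    using bound by (metis Suc_eq_plus1 le_imp_less_Suc nat_ceiling_le_eq nat_le_real_less not_less of_nat_ceiling order_trans of_nat_le_iff)
  moreover have "P {}" by (simp add: P_def)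
  ultimately obtain S where S: "P S" "\<And>T. P T \<Longrightarrow> card T \<le> card S"
    using ex_has_greatest_nat[of P "{}" card] by blast
  have "\<exists>z\<in>S. dist x z < r" for x
  proof (rule ccontr)
    assume "\<not> ?thesis"
    then have "P (insert x S)" "x \<notin> S" using S(1) r by (auto simp: P_def dist_commute not_less)
    then show False using S(2)[of "insert x S"] S(1) by (auto simp: P_def)
  qed
  then show ?thesis using S(1) by (auto simp: is_net_def P_def)
qed

end

section \<open>Vitali covering and the weak-type estimate\<close>

lemma finite_vitali:
  fixes F :: "('a::metric_space \<times> real) set"
  assumes "finite F"
  shows "\<exists>G\<subseteq>F. disjoint_family_on (\<lambda>p. ball (fst p) (snd p)) G \<and>
     (\<Union>p\<in>F. ball (fst p) (snd p)) \<subseteq> (\<Union>p\<in>G. ball (fst p) (3 * snd p))"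
  using assms
proof (induction "card F" arbitrary: F rule: less_induct)
  case less
  let ?B = "\<lambda>p :: 'a \<times> real. ball (fst p) (snd p)"
  show ?case
  proof (cases "\<exists>p\<in>F. ?B p \<noteq> {}")
    case False
    then show ?thesis by (intro exI[of _ "{}"]) (auto simp: disjoint_family_on_def)
  next
    case True
    \<comment> \<open>A ball of greatest radius, tripled, contains every ball of the family that
      meets it; the other balls are disjoint from it and are left to the induction.\<close>
    have "Max (snd ` F) \<in> snd ` F" using True less.prems by (intro Max_in) auto
    then obtain p where p: "p \<in> F" "snd p = Max (snd ` F)" by auto
    then have pmax: "snd q \<le> snd p" if "q \<in> F" for q using that less.prems by simp
    have ppos: "0 < snd p" using True pmax by (force intro: less_le_trans)
    define F' where "F' = {q\<in>F. ?B q \<inter> ?B p = {}}"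
    have "p \<notin> F'" using ppos by (auto simp: F'_def)
    then have "F' \<noteq> F" using p by blast
    moreover have "F' \<subseteq> F" by (auto simp: F'_def)
    ultimately have "F' \<subset> F" by blast
    then have "card F' < card F" using less.prems by (rule psubset_card_mono[rotated])
    moreover have "finite F'" using less.prems by (simp add: F'_def)
    ultimately obtain G where G: "G \<subseteq> F'" "disjoint_family_on ?B G"
      "(\<Union>p\<in>F'. ?B p) \<subseteq> (\<Union>p\<in>G. ball (fst p) (3 * snd p))" using less.hyps by blast
    have "disjoint_family_on ?B (insert p G)"
      using G(1,2) \<open>p \<notin> F'\<close> by (subst disjoint_family_on_insert) (auto simp: F'_def)
    moreover have "(\<Union>p\<in>F. ?B p) \<subseteq> (\<Union>p\<in>insert p G. ball (fst p) (3 * snd p))"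
    proof safe
      fix x q1 q2 assume q: "(q1, q2) \<in> F" "x \<in> ?B (q1, q2)"
      show "x \<in> (\<Union>p\<in>insert p G. ball (fst p) (3 * snd p))"
      proof (cases "(q1, q2) \<in> F'")
        case True
        then show ?thesis using G(3) q(2) by blast
      next
        case False
        then obtain y where y: "dist q1 y < q2" "dist (fst p) y < snd p" using q by (auto simp: F'_def)
        have "q2 \<le> snd p" using pmax[OF q(1)] by simp
        moreover have "dist q1 x < q2" using q by simp
        ultimately have "dist (fst p) x < 3 * snd p"
          using y dist_triangle[of "fst p" x y] dist_triangle[of y x q1] by (simp add: dist_commute)
        then show ?thesis by auto
      qed
    qed
    ultimately show ?thesis using G(1) p(1) by (intro exI[of _ "insert p G"]) (auto simp: F'_def)
  qed
qed

context bounded_doubling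
begin

text \<open>The averages are summed over a disjoint subfamily whose tripled balls still cover the
  union; \<open>Cd ^ 2\<close> is the cost of tripling, as \<open>3 \<le> 2 ^ 2\<close>.\<close>

lemma weak_type_finite:
  fixes f :: "'a \<Rightarrow> ennreal"
  assumes F: "finite F" and f [measurable]: "f \<in> borel_measurable M"
    and avg: "\<And>p. p \<in> F \<Longrightarrow> s * emeasure M (ball (fst p) (snd p)) \<le> (\<integral>\<^sup>+x\<in>ball (fst p) (snd p). f x \<partial>M)"
  shows "s * emeasure M (\<Union>p\<in>F. ball (fst p) (snd p)) \<le> ennreal (Cd ^ 2) * (\<integral>\<^sup>+x. f x \<partial>M)"
proof -
  let ?B = "\<lambda>p :: 'a \<times> real. ball (fst p) (snd p)"
  obtain G where G: "G \<subseteq> F" "disjoint_family_on ?B G" "(\<Union>p\<in>F. ?B p) \<subseteq> (\<Union>p\<in>G. ball (fst p) (3 * snd p))"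
    using finite_vitali[OF F] by blast
  have fG: "finite G" using G(1) F finite_subset by blast
  have e3: "emeasure M (ball x (3 * r)) \<le> ennreal (Cd ^ 2) * emeasure M (ball x r)" for x r
  proof (cases "0 < r")
    case True
    have "measure M (ball x (3 * r)) \<le> Cd ^ 2 * measure M (ball x r)"
      using True by (intro measure_le_ball[where s="3 * r"]) auto
    then show ?thesis using Cd_ge_1 by (simp add: emeasure_eq_measure ennreal_mult[symmetric])
  qed (simp add: ball_empty)
  have "s * emeasure M (\<Union>p\<in>F. ?B p) \<le> s * (\<Sum>p\<in>G. emeasure M (ball (fst p) (3 * snd p)))"
    by (intro mult_left_mono order_trans[OF emeasure_mono[OF G(3)] emeasure_subadditive_finite]) (auto simp: fG)
  also have "\<dots> \<le> s * (\<Sum>p\<in>G. ennreal (Cd ^ 2) * emeasure M (?B p))"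
    by (intro mult_left_mono sum_mono e3) auto
  also have "\<dots> = ennreal (Cd ^ 2) * (\<Sum>p\<in>G. s * emeasure M (?B p))"
    by (simp add: sum_distrib_left mult_ac)
  also have "\<dots> \<le> ennreal (Cd ^ 2) * (\<Sum>p\<in>G. \<integral>\<^sup>+x\<in>?B p. f x \<partial>M)"
    using G(1) by (intro mult_left_mono sum_mono avg) auto
  also have "(\<Sum>p\<in>G. \<integral>\<^sup>+x\<in>?B p. f x \<partial>M) = (\<integral>\<^sup>+x. (\<Sum>p\<in>G. f x * indicator (?B p) x) \<partial>M)"
    by (subst nn_integral_sum) auto
  also have "\<dots> \<le> (\<integral>\<^sup>+x. f x \<partial>M)"
  proof (rule nn_integral_mono)
    fix x
    have "(\<Sum>p\<in>G. f x * indicator (?B p) x) = f x * (\<Sum>p\<in>G. indicator (?B p) x)" by (simp add: sum_distrib_left)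
    also have "(\<Sum>p\<in>G. indicator (?B p) x :: ennreal) = indicator (\<Union>p\<in>G. ?B p) x"
      using indicator_UN_disjoint[OF fG G(2)] by metis
    also have "f x * \<dots> \<le> f x" by (auto simp: indicator_def)
    finally show "(\<Sum>p\<in>G. f x * indicator (?B p) x) \<le> f x" .
  qed
  finally show ?thesis by (simp add: mult_left_mono)
qed

lemma weak_type:
  fixes f :: "'a \<Rightarrow> ennreal"
  assumes F: "countable F" and f [measurable]: "f \<in> borel_measurable M"
    and avg: "\<And>p. p \<in> F \<Longrightarrow> s * emeasure M (ball (fst p) (snd p)) \<le> (\<integral>\<^sup>+x\<in>ball (fst p) (snd p). f x \<partial>M)"
  shows "s * emeasure M (\<Union>p\<in>F. ball (fst p) (snd p)) \<le> ennreal (Cd ^ 2) * (\<integral>\<^sup>+x. f x \<partial>M)"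
proof (cases "F = {}")
  case False
  let ?B = "\<lambda>p :: 'a \<times> real. ball (fst p) (snd p)"
  define e where "e = from_nat_into F"
  have e: "range e = F" using range_from_nat_into[OF False F] by (simp add: e_def)
  have "(\<Union>p\<in>F. ?B p) = (\<Union>n. \<Union>p\<in>e ` {..<n}. ?B p)" unfolding e[symmetric] by auto
  moreover have inc: "incseq (\<lambda>n. \<Union>p\<in>e ` {..<n}. ?B p)"
    unfolding incseq_def by (intro allI impI UN_mono image_mono) auto
  ultimately have "emeasure M (\<Union>p\<in>F. ?B p) = (SUP n. emeasure M (\<Union>p\<in>e ` {..<n}. ?B p))"
    using inc by (simp only:) (subst SUP_emeasure_incseq, auto)
  then have "s * emeasure M (\<Union>p\<in>F. ?B p) = (SUP n. s * emeasure M (\<Union>p\<in>e ` {..<n}. ?B p))"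
    by (simp add: SUP_mult_left_ennreal)
  also have "\<dots> \<le> ennreal (Cd ^ 2) * (\<integral>\<^sup>+x. f x \<partial>M)"
    using avg e by (intro SUP_least weak_type_finite) auto
  finally show ?thesis .
qed simp

end

text \<open>The sets with such a two-sided approximation form a sigma-algebra; approximating from
  both sides makes complements immediate. It contains the closed sets, which are decreasing
  intersections of open neighbourhoods.\<close>

lemma closed_inner_open_outer:
  fixes M :: "'a::metric_space measure"
  assumes "finite_measure M" "sets M = sets borel" "A \<in> sets borel" "0 < e"
  shows "\<exists>F U. closed F \<and> open U \<and> F \<subseteq> A \<and> A \<subseteq> U \<and> measure M (U - F) < e"
proof -
  interpret finite_measure M by fact
  note [simp] = assms(2)
  have sp: "space M = UNIV" using sets_eq_imp_space_eq[OF assms(2)] by simp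
  have "A \<in> sigma_sets UNIV (Collect closed)" using assms(3) by (simp add: borel_eq_closed)
  then show ?thesis using assms(4)
  proof (induction arbitrary: e rule: sigma_sets.induct)
    case (Basic A)
    then have A: "closed A" by simp
    show ?case
    \<comment> \<open>The empty set is split off because \<open>infdist x {}\<close> is 0, which
      would make each \<open>U n\<close> the whole space.\<close>
    proof (cases "A = {}")
      case False
      define U where "U n = {x. infdist x A < 1 / Suc n}" for n
      have U: "open (U n)" for n
        unfolding U_def by (intro open_Collect_less continuous_intros)
      have U_mono: "U n \<subseteq> U m" if "m \<le> n" for m n
      proof -
        have "1 / real (Suc n) \<le> 1 / real (Suc m)" using that by (intro frac_le) auto
        then show ?thesis by (auto simp: U_def)
      qed
      have "(\<Inter>n. U n) = A"
      proof safe
        fix x assume "x \<in> (\<Inter>n. U n)"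
        then have "infdist x A < inverse (real (Suc n))" for n by (auto simp: U_def field_simps)
        then have "infdist x A \<le> 0" by (metis less_irrefl not_le reals_Archimedean order.strict_trans)
        then show "x \<in> A" using in_closed_iff_infdist_zero[OF A False, of x] infdist_nonneg[of x A] by simp
      qed (auto simp: U_def)
      moreover have "(\<lambda>n. measure M (U n)) \<longlonglongrightarrow> measure M (\<Inter>n. U n)"
        using U by (intro finite_Lim_measure_decseq)
          (auto simp: decseq_def U_mono)
      ultimately have "(\<lambda>n. measure M (U n)) \<longlonglongrightarrow> measure M A" by simp
      then have "\<forall>\<^sub>F n in sequentially. measure M (U n) < measure M A + e"
        using Basic by (intro order_tendstoD) auto
      then obtain n where n: "measure M (U n) < measure M A + e" by (auto simp: eventually_sequentially)
      have "A \<subseteq> U n" by (auto simp: U_def)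
      then have "measure M (U n - A) < e" using n U[of n] A by (subst finite_measure_Diff) auto
      then show ?thesis using U A \<open>A \<subseteq> U n\<close> by blast
    next
      case True
      then show ?thesis using Basic by (intro exI[of _ "{}"]) simp
    qed
  next
    case Empty
    then show ?case by (intro exI[of _ "{}"]) simp
  next
    case (Compl A)
    obtain F U where "closed F" "open U" "F \<subseteq> A" "A \<subseteq> U" "measure M (U - F) < e"
      using Compl.IH[OF Compl.prems] by metis
    moreover have "- F - - U = U - F" by auto
    ultimately show ?case
      by (intro exI[of _ "- U"] exI[of _ "- F"]) auto
  next
    case (Union A)
    have "\<exists>F U. closed F \<and> open U \<and> F \<subseteq> A i \<and> A i \<subseteq> U \<and> measure M (U - F) < e / 2 * (1/2) ^ Suc i" for i
      using Union.prems by (intro Union.IH) simp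
    then obtain F U where FU: "closed (F i)" "open (U i)" "F i \<subseteq> A i" "A i \<subseteq> U i"
      "measure M (U i - F i) < e / 2 * (1/2) ^ Suc i" for i by metis
    define O' where "O' = (\<Union>i. U i)"
    \<comment> \<open>The union of all \<open>F i\<close> need not be closed, so a finite union is
      used; the sets \<open>O' - G n\<close> decrease to a set of measure at most
      \<open>e / 2\<close>.\<close>
    define G where "G n = (\<Union>i<n. F i)" for n
    have G: "closed (G n)" for n unfolding G_def using FU by auto
    have "(\<lambda>n. measure M (O' - G n)) \<longlonglongrightarrow> measure M (\<Inter>n. O' - G n)"
      using FU G by (intro finite_Lim_measure_decseq)
        (force simp: decseq_def G_def O'_def)+
    moreover have "measure M (\<Inter>n. O' - G n) \<le> e / 2"
    proof -
      have s: "summable (\<lambda>i. e / 2 * (1/2) ^ Suc i)"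
        using sums_mult[OF power_half_series, of "e / 2"] by (rule sums_summable)
      have sm: "summable (\<lambda>i. measure M (U i - F i))"
        by (rule summable_comparison_test'[OF s, of 0]) (simp only: real_norm_def abs_of_nonneg measure_nonneg less_imp_le[OF FU(5)])
      have "(\<Inter>n. O' - G n) \<subseteq> (\<Union>i. U i - F i)" by (auto simp: O'_def G_def)
      then have "measure M (\<Inter>n. O' - G n) \<le> measure M (\<Union>i. U i - F i)"
        using FU by (intro finite_measure_mono) auto
      also have "\<dots> \<le> (\<Sum>i. measure M (U i - F i))"
        using FU sm by (intro finite_measure_subadditive_countably) auto
      also have "\<dots> \<le> (\<Sum>i. e / 2 * (1/2) ^ Suc i)"
        using FU(5) sm s by (intro suminf_le less_imp_le)
      also have "\<dots> = e / 2" using sums_mult[OF power_half_series, of "e / 2"] by (simp add: sums_iff)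
      finally show ?thesis .
    qed
    then have "measure M (\<Inter>n. O' - G n) < e" using Union.prems by simp
    ultimately have "\<forall>\<^sub>F n in sequentially. measure M (O' - G n) < e"
      by (intro order_tendstoD)
    then obtain n where "measure M (O' - G n) < e" by (auto simp: eventually_sequentially)
    moreover have "G n \<subseteq> (\<Union>i. A i)" unfolding G_def using FU(3) by blast
    moreover have "(\<Union>i. A i) \<subseteq> O'" unfolding O'_def using FU(4) by blast
    moreover have "open O'" using FU by (auto simp: O'_def)
    ultimately show ?case using G[of n] by (intro exI[of _ "G n"] exI[of _ O']) simp
  qed
qed

section \<open>From oscillation on balls to a pointwise Lipschitz bound\<close>

lemma ball_subset_ball_dist:
  fixes x y :: "'a::metric_space"
  assumes "dist x y + r \<le> s" shows "ball x r \<subseteq> ball y s"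
proof
  fix z assume "z \<in> ball x r"
  then show "z \<in> ball y s" using assms dist_triangle[of y z x] by (simp add: dist_commute)
qed

context bounded_doubling
begin

text \<open>Both constants approximate \<open>u\<close> in mean on the common ball
  \<open>ball x r\<close>, whose measure is comparable to those of \<open>B1\<close> and
  \<open>B2\<close>; \<open>Cd ^ 4\<close> stems from \<open>16 = 2 ^ 4\<close>.\<close>

lemma mean_compare:
  fixes u :: "'a \<Rightarrow> real"
  assumes u: "integrable M u" and r: "0 < r"
    and sub: "ball x r \<subseteq> B1" "ball x r \<subseteq> B2" "B1 \<subseteq> ball x (16 * r)" "B2 \<subseteq> ball x (16 * r)"
    and B: "B1 \<in> sets M" "B2 \<in> sets M"
    and osc: "(LINT y:B1|M. \<bar>u y - c1\<bar>) \<le> K1 * measure M B1" "(LINT y:B2|M. \<bar>u y - c2\<bar>) \<le> K2 * measure M B2"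
    and K: "0 \<le> K1" "0 \<le> K2"
  shows "\<bar>c1 - c2\<bar> \<le> Cd ^ 4 * (K1 + K2)"
proof -
  have int: "set_integrable M A (\<lambda>y. \<bar>u y - c\<bar>)" if "A \<in> sets M" for A c
    unfolding set_integrable_def using u that by (intro integrable_mult_indicator) auto
  let ?B = "ball x r"
  have m: "measure M B1 \<le> Cd ^ 4 * measure M ?B" "measure M B2 \<le> Cd ^ 4 * measure M ?B"
    using r sub(3,4) by (auto intro!: measure_le_ball[where s="16 * r"])
  have "\<bar>c1 - c2\<bar> * measure M ?B = (LINT y:?B|M. \<bar>c1 - c2\<bar>)"
    by (simp add: set_lebesgue_integral_def)
  also have "\<dots> \<le> (LINT y:?B|M. \<bar>u y - c1\<bar> + \<bar>u y - c2\<bar>)"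
  proof (rule set_integral_mono)
    show "set_integrable M ?B (\<lambda>y. \<bar>c1 - c2\<bar>)"
      unfolding set_integrable_def by (intro integrable_mult_indicator) auto
    show "set_integrable M ?B (\<lambda>y. \<bar>u y - c1\<bar> + \<bar>u y - c2\<bar>)"
      by (intro set_integral_add(1) int) auto
  qed auto
  also have "\<dots> = (LINT y:?B|M. \<bar>u y - c1\<bar>) + (LINT y:?B|M. \<bar>u y - c2\<bar>)"
    using int[of ?B] by (intro set_integral_add) auto
  also have "\<dots> \<le> (LINT y:B1|M. \<bar>u y - c1\<bar>) + (LINT y:B2|M. \<bar>u y - c2\<bar>)"
    unfolding set_lebesgue_integral_def using sub(1,2)
    by (intro add_mono integral_mono int[unfolded set_integrable_def] B ball_sets) (auto simp: indicator_def)
  also have "\<dots> \<le> K1 * (Cd ^ 4 * measure M ?B) + K2 * (Cd ^ 4 * measure M ?B)"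
    using osc m K by (meson add_mono mult_left_mono order_trans)
  finally have "\<bar>c1 - c2\<bar> * measure M ?B \<le> (Cd ^ 4 * (K1 + K2)) * measure M ?B"
    by (simp add: algebra_simps)
  then show ?thesis using measure_ball_pos[OF r, of x] by simp
qed

text \<open>Constants approximating \<open>u\<close> on neighbouring balls, at the same or at
  successive scales, differ by a multiple of \<open>K * r k\<close>. Summing this geometric series
  down to a point compares \<open>u x\<close> with the constant at the scale of
  \<open>dist x y\<close>.\<close>

lemma lipschitz_off_null_set:
  fixes u :: "'a \<Rightarrow> real" and N :: "nat \<Rightarrow> 'a set" and c :: "'a \<Rightarrow> nat \<Rightarrow> real"
  defines "r \<equiv> \<lambda>k. R / 2 ^ k"
  assumes u: "integrable M u" and E [measurable]: "E \<in> sets M" and K: "0 \<le> K"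
    and net: "\<And>k. is_net (N k) (r k)"
    and osc: "\<And>k z. z \<in> N k \<Longrightarrow> ball z (r k) \<inter> E \<noteq> {} \<Longrightarrow>
      (LINT y:ball z (4 * r k)|M. \<bar>u y - c z k\<bar>) \<le> K * r k * measure M (ball z (4 * r k))"
  shows "\<exists>Z\<in>null_sets M. \<forall>x\<in>E - Z. \<forall>y\<in>E - Z. \<bar>u x - u y\<bar> \<le> 20 * Cd ^ 4 * K * dist x y"
proof -
  have [measurable]: "u \<in> borel_measurable M" using u by auto
  have r_pos: "0 < r k" and r_Suc: "r (Suc k) = r k / 2" for k using R_pos by (auto simp: r_def)
  have fin: "finite (N k)" for k using net by (simp add: is_net_def)
  \<comment> \<open>The radius \<open>4 * r k\<close> is what lets the ball around \<open>z\<close>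
    contain \<open>ball w (r l)\<close>: the centres are less than \<open>2 * r k + r l\<close>
    apart, and \<open>r l \<le> r k\<close>.\<close>
  have close: "\<bar>c z k - c w l\<bar> \<le> 2 * Cd ^ 4 * K * r k"
    if z: "z \<in> N k" "x \<in> E" "dist x z < r k" and w: "w \<in> N l" "y \<in> E" "dist y w < r l"
      and xy: "dist x y \<le> r k" and l: "l = k \<or> l = Suc k" for z w k l x y
  proof -
    have rl: "r l \<le> r k" "r k \<le> 2 * r l" using l r_pos[of k] by (auto simp: r_Suc)
    have zw: "dist z w < 2 * r k + r l"
      using dist_triangle[of z w x] dist_triangle[of x w y] z w xy by (simp add: dist_commute)
    have "\<bar>c z k - c w l\<bar> \<le> Cd ^ 4 * (K * r k + K * r l)"
    proof (rule mean_compare[OF u r_pos[of l], where x=w])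
      show "ball w (r l) \<subseteq> ball z (4 * r k)" using zw rl by (intro ball_subset_ball_dist) (simp add: dist_commute)
      show "ball z (4 * r k) \<subseteq> ball w (16 * r l)" using zw rl by (intro ball_subset_ball_dist) simp
      show "ball w (r l) \<subseteq> ball w (4 * r l)" "ball w (4 * r l) \<subseteq> ball w (16 * r l)" using r_pos[of l] by auto
      show "(LINT y:ball z (4 * r k)|M. \<bar>u y - c z k\<bar>) \<le> K * r k * measure M (ball z (4 * r k))"
        using z by (intro osc) (auto simp: dist_commute disjoint_iff)
      show "(LINT y:ball w (4 * r l)|M. \<bar>u y - c w l\<bar>) \<le> K * r l * measure M (ball w (4 * r l))"
        using w by (intro osc) (auto simp: dist_commute disjoint_iff)
    qed (use K r_pos[of k] r_pos[of l] in auto)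
    also have "\<dots> \<le> Cd ^ 4 * (K * r k + K * r k)"
      using rl K Cd_ge_1 by (intro mult_left_mono add_left_mono) auto
    finally show ?thesis by (simp add: algebra_simps)
  qed
  define q where "q x k = (SOME z. z \<in> N k \<and> dist x z < r k)" for x k
  have "\<exists>z. z \<in> N k \<and> dist x z < r k" for x k using net[of k] by (auto simp: is_net_def)
  then have q: "q x k \<in> N k" "dist x (q x k) < r k" for x k
    using someI_ex[of "\<lambda>z. z \<in> N k \<and> dist x z < r k"] by (auto simp: q_def)
  \<comment> \<open>By Chebyshev the bad sets of scale \<open>k\<close> have total measure
    O(\<open>(4/3) ^ k * r k\<close>), that is O(\<open>(2/3) ^ k\<close>). Any base strictly
    between 1/2 and 1 would serve: the thresholds tend to 0 while the measures remain
    summable.\<close>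
  define bad where "bad k z = {x \<in> ball z (4 * r k). (3/4) ^ k < \<bar>u x - c z k\<bar>}" for k z
  define N' where "N' k = {z\<in>N k. ball z (r k) \<inter> E \<noteq> {}}" for k
  define F where "F k = (\<Union>z\<in>N' k. bad k z)" for k
  have bad [measurable]: "bad k z \<in> sets M" for k z unfolding bad_def by measurable
  have F [measurable]: "F k \<in> sets M" for k unfolding F_def N'_def using fin[of k] bad by (intro sets.finite_UN) auto
  \<comment> \<open>The bound is expressed by balls of half the net radius, since these are disjoint
    and their measures can be summed over the net.\<close>
  have bad_le: "measure M (bad k z) \<le> (4/3) ^ k * (K * r k * (Cd ^ 3 * measure M (ball z (r k / 2))))"
    if z: "z \<in> N' k" for k z
  proof -
    have int: "set_integrable M (ball z (4 * r k)) (\<lambda>y. \<bar>u y - c z k\<bar>)"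
      unfolding set_integrable_def using u by (intro integrable_mult_indicator) auto
    have "(3/4) ^ k * measure M (bad k z) = (LINT y|M. indicator (bad k z) y * (3/4) ^ k)" by simp
    also have "\<dots> \<le> (LINT y:ball z (4 * r k)|M. \<bar>u y - c z k\<bar>)"
      unfolding set_lebesgue_integral_def
    proof (rule integral_mono)
      have "integrable M (indicator (bad k z) :: 'a \<Rightarrow> real)"
        using bad by (intro integrable_real_indicator) (auto simp: emeasure_eq_measure)
      then show "integrable M (\<lambda>y. indicator (bad k z) y * (3/4) ^ k :: real)" by simp
      show "integrable M (\<lambda>y. indicator (ball z (4 * r k)) y *\<^sub>R \<bar>u y - c z k\<bar>)"
        using int by (simp add: set_integrable_def)
    qed (auto simp: bad_def indicator_def)
    also have "\<dots> \<le> K * r k * measure M (ball z (4 * r k))"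
      using z by (intro osc) (auto simp: N'_def)
    also have "\<dots> \<le> K * r k * (Cd ^ 3 * measure M (ball z (r k / 2)))"
      using K r_pos[of k] by (intro mult_left_mono measure_le_ball[where s="4 * r k"]) auto
    finally show ?thesis by (simp add: field_simps power_divide)
  qed
  have F_le: "measure M (F k) \<le> (K * R * Cd ^ 3 * measure M UNIV) * (2/3) ^ k" for k
  proof -
    have "measure M (F k) \<le> (\<Sum>z\<in>N' k. measure M (bad k z))"
      unfolding F_def using fin[of k] bad by (intro measure_UNION_le) (auto simp: N'_def)
    also have "\<dots> \<le> (\<Sum>z\<in>N' k. (4/3) ^ k * (K * r k * (Cd ^ 3 * measure M (ball z (r k / 2)))))"
      by (intro sum_mono bad_le)
    also have "\<dots> = (4/3) ^ k * (K * r k * (Cd ^ 3 * (\<Sum>z\<in>N' k. measure M (ball z (r k / 2)))))"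
      by (simp add: sum_distrib_left)
    also have "\<dots> \<le> (4/3) ^ k * (K * r k * (Cd ^ 3 * measure M UNIV))"
    proof (intro mult_left_mono)
      show "(\<Sum>z\<in>N' k. measure M (ball z (r k / 2))) \<le> measure M UNIV"
        using net[of k] by (intro sum_separated_le) (auto simp: N'_def is_net_def)
    qed (use K r_pos[of k] Cd_ge_1 in auto)
    also have "\<dots> = (K * R * Cd ^ 3 * measure M UNIV) * ((4/3) ^ k * (1/2) ^ k)"
      by (simp add: r_def power_divide)
    finally show ?thesis by (simp flip: power_mult_distrib)
  qed
  have "summable (\<lambda>k. measure M (F k))"
    by (rule summable_comparison_test'[where g="\<lambda>k. (K * R * Cd ^ 3 * measure M UNIV) * (2/3) ^ k" and N=0])
      (use F_le in \<open>auto intro!: summable_mult summable_geometric\<close>)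
  \<comment> \<open>By Borel-Cantelli almost every point lies in only finitely many
    \<open>F k\<close>; at such points of \<open>E\<close> the constants \<open>c (q x k) k\<close>
    tend to \<open>u x\<close>.\<close>
  then have "AE x in M. \<forall>\<^sub>F k in sequentially. x \<in> space M - F k"
    using F by (intro borel_cantelli_AE1) (auto simp: emeasure_eq_measure)
  then obtain Z where Z: "Z \<in> null_sets M" "{x \<in> space M. \<not> (\<forall>\<^sub>F k in sequentially. x \<in> space M - F k)} \<subseteq> Z"
    by (auto elim!: AE_E simp: null_sets_def)
  define D where "D = 2 * Cd ^ 4 * K"
  have D: "0 \<le> D" using K Cd_ge_1 by (simp add: D_def)
  have near: "\<bar>u x - c (q x k) k\<bar> \<le> 2 * D * r k" if x: "x \<in> E - Z" for x k
  proof -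
    have tel: "\<bar>c (q x k) k - c (q x (k + m)) (k + m)\<bar> \<le> 2 * D * r k * (1 - (1/2) ^ m)" for m
    proof (induction m)
      case (Suc m)
      have "\<bar>c (q x (k + m)) (k + m) - c (q x (Suc (k + m))) (Suc (k + m))\<bar> \<le> D * r (k + m)"
        unfolding D_def using x q less_imp_le[OF r_pos] by (intro close[where x=x and y=x]) auto
      also have "r (k + m) = r k * (1/2) ^ m" by (simp add: r_def power_add power_divide)
      finally show ?case using Suc by (simp add: algebra_simps)
    qed auto
    have "\<forall>\<^sub>F k in sequentially. x \<notin> F k" using x Z(2) by (auto elim: eventually_mono)
    then have ev: "\<forall>\<^sub>F k in sequentially. \<bar>u x - c (q x k) k\<bar> \<le> (3/4) ^ k"
    proof eventually_elim
      case (elim k)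
      have "q x k \<in> N' k" "x \<in> ball (q x k) (4 * r k)"
        using q[of x k] x r_pos[of k] by (auto simp: N'_def dist_commute)
      then show ?case using elim by (force simp: F_def bad_def)
    qed
    have "(\<lambda>k. (3/4) ^ k :: real) \<longlonglongrightarrow> 0" by (rule LIMSEQ_power_zero) simp
    then have "(\<lambda>k. u x - c (q x k) k) \<longlonglongrightarrow> 0"
      using ev by (intro Lim_null_comparison[of "\<lambda>k. u x - c (q x k) k"]) auto
    from LIMSEQ_ignore_initial_segment[OF this, of k]
    have "(\<lambda>m. u x - c (q x (k + m)) (k + m)) \<longlonglongrightarrow> 0"
      by (simp add: add.commute)
    then have "(\<lambda>m. (u x - c (q x k) k) - (u x - c (q x (k + m)) (k + m))) \<longlonglongrightarrow> (u x - c (q x k) k) - 0"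
      by (intro tendsto_diff tendsto_const)
    then have "(\<lambda>m. \<bar>c (q x k) k - c (q x (k + m)) (k + m)\<bar>) \<longlonglongrightarrow> \<bar>u x - c (q x k) k\<bar>"
      by (auto dest: tendsto_rabs simp: abs_minus_commute)
    moreover have "\<bar>c (q x k) k - c (q x (k + m)) (k + m)\<bar> \<le> 2 * D * r k" for m
      using tel[of m] D r_pos[of k] by (smt (verit, best) mult_left_le mult_nonneg_nonneg zero_le_power zero_le_divide_1_iff)
    ultimately show ?thesis by (intro LIMSEQ_le_const2) auto
  qed
  have "\<bar>u x - u y\<bar> \<le> 20 * Cd ^ 4 * K * dist x y" if xy: "x \<in> E - Z" "y \<in> E - Z" for x y
  proof (cases "x = y")
    case False
    have "(\<lambda>k. r k) \<longlonglongrightarrow> 0"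
      unfolding r_def by (rule LIMSEQ_divide_realpow_zero) simp
    then have "\<forall>\<^sub>F k in sequentially. r k < dist x y" using False by (intro order_tendstoD) auto
    then obtain k where k: "r k < dist x y" by (auto simp: eventually_sequentially)
    \<comment> \<open>\<open>j\<close> is the first scale below \<open>dist x y\<close>. It is not 0
      because \<open>r 0 = R\<close> exceeds all distances, and the scale \<open>i\<close> before it
      is comparable to \<open>dist x y\<close>. The final constant is \<open>2 + 1 + 2\<close> times
      \<open>D\<close>, doubled since \<open>r i = 2 * r j\<close>.\<close>
    define j where "j = (LEAST k. r k < dist x y)"
    have j: "r j < dist x y" unfolding j_def using k by (rule LeastI)
    have "r 0 = R" by (simp add: r_def)
    then have "j \<noteq> 0" using j dist_less_R[of x y] by (intro notI) simp
    then obtain i where i: "j = Suc i" using not0_implies_Suc by blast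
    have "\<not> r i < dist x y" using not_less_Least[of i "\<lambda>k. r k < dist x y"] i by (simp add: j_def)
    then have "\<bar>c (q x i) i - c (q y i) i\<bar> \<le> D * r i"
      unfolding D_def using xy q[of x i] q[of y i] by (intro close[where x=x and y=y]) auto
    then have "\<bar>u x - u y\<bar> \<le> 5 * D * r i" using near[OF xy(1), of i] near[OF xy(2), of i] by (simp add: algebra_simps)
    also have "\<dots> \<le> 5 * D * (2 * dist x y)" using j D by (intro mult_left_mono) (auto simp: i r_Suc)
    finally show ?thesis by (simp add: D_def)
  qed auto
  then show ?thesis using Z(1) by blast
qed

end

section \<open>Coloured covers and Whitney families\<close>

lemma infdist_lessD:
  assumes "infdist x A < t" "A \<noteq> {}" shows "\<exists>a\<in>A. dist x a < t"
proof (rule ccontr)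
  assume "\<not> ?thesis"
  then have "t \<le> infdist x A" unfolding infdist_notempty[OF assms(2)]
    using assms(2) by (intro cINF_greatest) (auto simp: not_less)
  then show False using assms(1) by simp
qed

text \<open>Pigeonhole: below \<open>f i0\<close> there are \<open>n + 1\<close> windows
  \<open>[j * s, (j + 1) * s)\<close> but at most \<open>n\<close> other values, so some window is
  empty; \<open>Q\<close> collects the indices whose values lie above it.\<close>

lemma separated_gap:
  fixes f :: "'i \<Rightarrow> real"
  assumes P: "finite P" "card P \<le> n + 1" and i0: "i0 \<in> P" "f i0 = real (n + 1) * s" and s: "0 < s"
  shows "\<exists>Q\<subseteq>P. i0 \<in> Q \<and> (\<forall>i\<in>Q. s \<le> f i) \<and> (\<forall>i\<in>Q. \<forall>j\<in>P - Q. f j + s \<le> f i)"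
proof -
  define l where "l i = nat \<lfloor>f i / s\<rfloor>" for i
  have "card (l ` (P - {i0})) \<le> n"
    using P i0 card_image_le[of "P - {i0}" l] by (simp add: card_Diff_singleton)
  then have "\<not> {..n} \<subseteq> l ` (P - {i0})"
    using P card_mono[of "l ` (P - {i0})" "{..n}"] by auto
  then obtain j where j: "j \<le> n" "j \<notin> l ` (P - {i0})" by auto
  have *: "f i < real j * s \<or> real (j + 1) * s \<le> f i" if i: "i \<in> P" for i
  proof (cases "i = i0")
    case True
    have "real (j + 1) * s \<le> real (n + 1) * s" using j(1) s by (intro mult_right_mono) auto
    then show ?thesis using True i0 by simp
  next
    case False
    then have "l i \<noteq> j" using i j by auto
    then have "\<lfloor>f i / s\<rfloor> \<noteq> int j" by (auto simp: l_def)
    then have "\<not> (real j \<le> f i / s \<and> f i / s < real j + 1)"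
      by (metis floor_unique of_int_of_nat_eq)
    then show ?thesis using s by (auto simp: field_simps)
  qed
  define Q where "Q = {i\<in>P. real (j + 1) * s \<le> f i}"
  have "real (j + 1) * s \<le> real (n + 1) * s" using j(1) s by (intro mult_right_mono) auto
  then have "i0 \<in> Q" using i0 by (simp add: Q_def)
  moreover have Q: "real j * s + s \<le> f i" if "i \<in> Q" for i
    using that by (simp add: Q_def algebra_simps)
  have nn: "0 \<le> real j * s" using s by simp
  have lt: "f k < real j * s" if "k \<in> P - Q" for k
    using that *[of k] by (auto simp: Q_def)
  have "s \<le> f i" if "i \<in> Q" for i using Q[OF that] nn by linarith
  moreover have "f k + s \<le> f i" if "i \<in> Q" "k \<in> P - Q" for i k
    using Q[OF that(1)] lt[OF that(2)] by linarith
  moreover have "Q \<subseteq> P" by (auto simp: Q_def)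
  ultimately show ?thesis using \<open>i0 \<in> Q\<close> by (intro exI[of _ Q] conjI ballI)
qed

definition colored_cover :: "nat \<Rightarrow> real \<Rightarrow> real \<Rightarrow> (nat \<Rightarrow> 'a::metric_space set set) \<Rightarrow> bool" where
  "colored_cover n D s \<V> \<longleftrightarrow> (\<Union>k\<le>n. \<Union>(\<V> k)) = UNIV \<and>
     (\<forall>k. \<forall>V\<in>\<V> k. \<forall>x\<in>V. \<forall>y\<in>V. dist x y \<le> D) \<and>
     (\<forall>k. \<forall>V\<in>\<V> k. \<forall>W\<in>\<V> k. V \<noteq> W \<longrightarrow> (\<forall>x\<in>V. \<forall>y\<in>W. s \<le> dist x y))"

text \<open>A point is coloured by the number of cover elements that are markedly nearer to it than all
  the others.\<close>

lemma nagata_colored: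
  assumes "nagata_cond TYPE('a::metric_space) n"
  obtains C where "1 \<le> C" "\<And>s. 0 < s \<Longrightarrow> \<exists>\<V> :: nat \<Rightarrow> 'a set set. colored_cover n (C * s) s \<V>"
proof -
  obtain C where C: "C > 0" and cov: "\<forall>s > 0. \<exists>(I :: 'a set) (A :: 'a \<Rightarrow> 'a set).
      (\<Union>i\<in>I. A i) = UNIV \<and>
      (\<forall>i\<in>I. bounded (A i) \<and> diameter (A i) \<le> C * s) \<and>
      (\<forall>x. finite {i\<in>I. A i \<inter> ball x s \<noteq> {}} \<and> card {i\<in>I. A i \<inter> ball x s \<noteq> {}} \<le> n + 1)"
    using assms unfolding nagata_cond_def by (elim exE conjE)
  show ?thesis
  proof (rule that[of "(C + 2) * real (n + 1)"])
    have "1 * 1 \<le> (C + 2) * real (n + 1)" using C by (intro mult_mono) auto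
    then show "1 \<le> (C + 2) * real (n + 1)" by simp
  next
    fix s :: real assume s: "0 < s"
    \<comment> \<open>The Nagata cover is taken at a scale that leaves room for \<open>n + 1\<close>
      windows of width \<open>s\<close>. The factor \<open>C + 2\<close> in the size bound comes
      from the diameter of one \<open>A i\<close> and a step of length \<open>t\<close> at each
      end.\<close>
    define t where "t = real (n + 1) * s"
    have t: "0 < t" using s by (simp add: t_def)
    obtain I :: "'a set" and A :: "'a \<Rightarrow> 'a set" where A1: "(\<Union>i\<in>I. A i) = UNIV"
      and A2: "\<forall>i\<in>I. bounded (A i) \<and> diameter (A i) \<le> C * t"
      and A3: "\<forall>x. finite {i\<in>I. A i \<inter> ball x t \<noteq> {}} \<and> card {i\<in>I. A i \<inter> ball x t \<noteq> {}} \<le> n + 1"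
      using cov[rule_format, OF t] by (elim exE conjE)
    \<comment> \<open>Empty members would distort \<open>f\<close>, because
      \<open>infdist x {}\<close> is 0.\<close>
    define J where "J = {i\<in>I. A i \<noteq> {}}"
    define f where "f i x = max 0 (t - infdist x (A i))" for i x
    have f_lip: "\<bar>f i x - f i y\<bar> \<le> dist x y" for i x y
      using infdist_triangle_abs[of x "A i" y] by (auto simp: f_def max_def)
    have f_pos: "A i \<inter> ball x t \<noteq> {}" if ix: "i \<in> J" "0 < f i x" for i x
    proof -
      have "infdist x (A i) < t" using ix(2) by (simp add: f_def)
      then obtain a where "a \<in> A i" "dist x a < t"
        using infdist_lessD[of x "A i" t] ix(1) by (auto simp: J_def)
      then show ?thesis by auto
    qed
    define U where "U Q = {x. \<forall>i\<in>Q. s \<le> f i x \<and> (\<forall>j\<in>J - Q. f j x + s \<le> f i x)}" for Q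
    define \<V> where "\<V> k = U ` {Q. Q \<subseteq> J \<and> finite Q \<and> card Q = Suc k}" for k
    have "x \<in> (\<Union>k\<le>n. \<Union>(\<V> k))" for x
    proof -
      define P where "P = {i\<in>J. 0 < f i x}"
      have "P \<subseteq> {i\<in>I. A i \<inter> ball x t \<noteq> {}}" using f_pos by (auto simp: P_def J_def)
      then have P: "finite P" "card P \<le> n + 1" using A3[rule_format, of x] card_mono
        by (auto intro: finite_subset order_trans)
      obtain i0 where "i0 \<in> I" "x \<in> A i0" using A1 by blast
      then have i0: "i0 \<in> P" "f i0 x = real (n + 1) * s"
        using t by (auto simp: P_def J_def f_def t_def)
      obtain Q where Q: "Q \<subseteq> P" "i0 \<in> Q" "\<And>i. i \<in> Q \<Longrightarrow> s \<le> f i x" "\<And>i j. i \<in> Q \<Longrightarrow> j \<in> P - Q \<Longrightarrow> f j x + s \<le> f i x"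
        using separated_gap[where f="\<lambda>i. f i x", OF P i0 s] by blast
      have "f j x + s \<le> f i x" if ij: "i \<in> Q" "j \<in> J - Q" for i j
        proof (cases "j \<in> P")
          case False
          then have "f j x = 0" using ij by (auto simp: P_def f_def)
          then show ?thesis using Q(3)[OF ij(1)] by simp
        qed (use ij Q(4) in auto)
      then have "x \<in> U Q" using Q(3) by (auto simp: U_def)
      moreover have fQ: "finite Q" using Q(1) P(1) finite_subset by blast
      moreover have "card Q \<le> n + 1" using card_mono[OF P(1) Q(1)] P(2) by simp
      moreover have "card Q > 0" using fQ Q(2) card_gt_0_iff by blast
      moreover have "Q \<subseteq> J" using Q(1) by (auto simp: P_def)
      ultimately show ?thesis unfolding \<V>_def
        by (intro UN_I[of "card Q - 1"] UnionI[of "U Q"]) auto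
    qed
    then have 1: "(\<Union>k\<le>n. \<Union>(\<V> k)) = UNIV" by blast
    have 2: "dist x y \<le> (C + 2) * real (n + 1) * s" if V: "V \<in> \<V> k" "x \<in> V" "y \<in> V" for k V x y
    proof -
      obtain Q where Q: "Q \<subseteq> J" "finite Q" "card Q = Suc k" "V = U Q" using V by (auto simp: \<V>_def)
      obtain i where i: "i \<in> Q" using Q by (metis card.empty equals0I old.nat.distinct(1))
      have "A i \<inter> ball x t \<noteq> {}" "A i \<inter> ball y t \<noteq> {}"
        using V i Q s by (intro f_pos; force simp: U_def)+
      then obtain a b where ab: "a \<in> A i" "dist x a < t" "b \<in> A i" "dist y b < t" by auto
      have "dist a b \<le> C * t" using A2[rule_format, of i] i Q ab diameter_bounded_bound[of "A i" a b] by (auto simp: J_def)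
      then have "dist x y \<le> C * t + 2 * t"
        using ab dist_triangle[of x y a] dist_triangle[of a y b] by (simp add: dist_commute)
      then show ?thesis by (simp add: t_def algebra_simps)
    qed
    have 3: "s \<le> dist x y" if V: "V \<in> \<V> k" "W \<in> \<V> k" "V \<noteq> W" "x \<in> V" "y \<in> W" for k V W x y
    proof -
      obtain Q where Q: "Q \<subseteq> J" "finite Q" "card Q = Suc k" "V = U Q" using V by (auto simp: \<V>_def)
      obtain S where S: "S \<subseteq> J" "finite S" "card S = Suc k" "W = U S" using V by (auto simp: \<V>_def)
      \<comment> \<open>Different index sets of the same size are incomparable, so each has an index
        that the other lacks. The two gap inequalities then point in opposite directions, and their
        sum gives the separation since each \<open>f i\<close> is 1-Lipschitz.\<close>
      have "Q \<noteq> S" using V Q S by auto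
      then have "\<not> Q \<subseteq> S" "\<not> S \<subseteq> Q" using Q S card_subset_eq by metis+
      then obtain i j where ij: "i \<in> Q" "i \<notin> S" "j \<in> S" "j \<notin> Q" by auto
      have "f j x + s \<le> f i x" "f i y + s \<le> f j y"
        using V ij Q S by (auto simp: U_def)
      then show ?thesis using f_lip[of i x y] f_lip[of j x y] by linarith
    qed
    have "colored_cover n ((C + 2) * real (n + 1) * s) s \<V>"
      unfolding colored_cover_def using 1 2 3 by blast
    then show "\<exists>\<V> :: nat \<Rightarrow> 'a set set. colored_cover n ((C + 2) * real (n + 1) * s) s \<V>" by blast
  qed
qed

section \<open>Coloured covers of a complement at the Whitney scale\<close>

definition rel_separated :: "'a::metric_space set \<Rightarrow> real \<Rightarrow> 'a set set \<Rightarrow> bool" where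
  "rel_separated Z a \<V> \<longleftrightarrow>
     (\<forall>V\<in>\<V>. \<forall>W\<in>\<V>. V \<noteq> W \<longrightarrow> (\<forall>x\<in>V. \<forall>y\<in>W. a * infdist x Z \<le> dist x y))"

definition rel_bounded :: "'a::metric_space set \<Rightarrow> real \<Rightarrow> 'a set set \<Rightarrow> bool" where
  "rel_bounded Z D \<V> \<longleftrightarrow> (\<forall>V\<in>\<V>. \<forall>x\<in>V. \<forall>y\<in>V. dist x y \<le> D * infdist x Z)"

lemma rel_separatedD:
  "rel_separated Z a \<V> \<Longrightarrow> V \<in> \<V> \<Longrightarrow> W \<in> \<V> \<Longrightarrow> V \<noteq> W \<Longrightarrow> x \<in> V \<Longrightarrow> y \<in> W \<Longrightarrow> a * infdist x Z \<le> dist x y"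
  by (auto simp: rel_separated_def)

lemma rel_boundedD:
  "rel_bounded Z D \<V> \<Longrightarrow> V \<in> \<V> \<Longrightarrow> x \<in> V \<Longrightarrow> y \<in> V \<Longrightarrow> dist x y \<le> D * infdist x Z"
  by (auto simp: rel_bounded_def)

text \<open>Every fine set that comes close to a coarse one is absorbed by it.\<close>

lemma absorb_families:
  fixes \<V> \<U> :: "'a::metric_space set set"
  assumes c: "1 \<le> c" and pos: "\<And>x. x \<in> \<Union>\<V> \<union> \<Union>\<U> \<Longrightarrow> 0 < infdist x Z"
    and \<V>: "rel_separated Z (1 / (40 * c)) \<V>" "rel_bounded Z (1 / 40) \<V>"
    and \<U>: "rel_separated Z (1 / 2) \<U>" "rel_bounded Z (c / 2) \<U>"
  shows "\<exists>\<W>. \<Union>\<W> = \<Union>\<V> \<union> \<Union>\<U> \<and> rel_separated Z (1 / (80 * c)) \<W> \<and> rel_bounded Z c \<W>"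
proof -
  define a where "a = 1 / (40 * c)"
  have a: "0 < a" "a \<le> 1 / 40" using c by (auto simp: a_def field_simps)
  let ?d = "\<lambda>x. infdist x Z"
  have tri: "?d x \<le> ?d y + dist x y" for x y by (rule infdist_triangle)
  have half_le: "a / 2 * ?d z \<le> a * ?d z" for z
    using a by (intro mult_right_mono infdist_nonneg) simp
  define near where "near V U \<longleftrightarrow> (\<exists>x\<in>V. \<exists>y\<in>U. dist x y < a * ?d x)" for V U
  define ext where "ext U = U \<union> \<Union>{V\<in>\<V>. near V U}" for U
  \<comment> \<open>One round of absorption is enough: enlarged coarse sets stay apart from each
    other by \<open>extext\<close>, and the fine sets left over stay apart from them by
    \<open>Vext\<close>.\<close>
  define \<W> where "\<W> = ext ` \<U> \<union> {V\<in>\<V>. \<forall>U\<in>\<U>. \<not> near V U}"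
  \<comment> \<open>Points gained by absorption are off by at most
    \<open>1/40 + 1/40 * 41/40 < 1/16\<close> of their distance to \<open>Z\<close>, too little to
    close the gaps of relative size 1/2 between coarse sets.\<close>
  have anchor: "\<exists>x0\<in>U. dist x x0 \<le> ?d x / 16" if U: "U \<in> \<U>" "x \<in> ext U" for x U
  proof (cases "x \<in> U")
    case True
    then show ?thesis using infdist_nonneg[of x Z] by (intro bexI[of _ x]) auto
  next
    case False
    then obtain V x1 x0 where V: "V \<in> \<V>" "x \<in> V" "x1 \<in> V" "x0 \<in> U" "dist x1 x0 < a * ?d x1"
      using U by (auto simp: ext_def near_def)
    have 1: "dist x x1 \<le> 1 / 40 * ?d x" using rel_boundedD[OF \<V>(2)] V by auto
    have "a * ?d x1 \<le> 1 / 40 * ?d x1" using a infdist_nonneg by (intro mult_right_mono) auto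
    then have "dist x x0 \<le> ?d x / 16"
      using V(5) 1 tri[of x1 x] dist_triangle[of x x0 x1] infdist_nonneg[of x Z] by (simp add: dist_commute)
    then show ?thesis using V by blast
  qed
  have posW: "0 < ?d x" if "x \<in> ext U" "U \<in> \<U>" for x U using that by (intro pos) (auto simp: ext_def)
  have extext: "a / 2 * ?d x \<le> dist x y"
    if U: "U \<in> \<U>" "W \<in> \<U>" "U \<noteq> W" "x \<in> ext U" "y \<in> ext W" for x y U W
  proof (rule ccontr)
    assume n: "\<not> ?thesis"
    obtain x0 y0 where 0: "x0 \<in> U" "dist x x0 \<le> ?d x / 16" "y0 \<in> W" "dist y y0 \<le> ?d y / 16"
      using anchor[of U x] anchor[of W y] U by blast
    have "1 / 2 * ?d x0 \<le> dist x0 y0" using rel_separatedD[OF \<U>(1)] U 0 by blast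
    moreover have "a * ?d x \<le> 1 / 40 * ?d x" using a infdist_nonneg by (intro mult_right_mono) auto
    ultimately show False
      using n 0 posW[of x U] U tri[of y x, unfolded dist_commute[of y x]] tri[of x x0]
        dist_triangle[of x0 y0 x, unfolded dist_commute[of x0 x]] dist_triangle[of x y0 y] by linarith
  qed
  have Vext: "a / 2 * ?d x \<le> dist x y \<and> a / 2 * ?d y \<le> dist x y"
    if V: "V \<in> \<V>" "\<And>U. U \<in> \<U> \<Longrightarrow> \<not> near V U" and U: "U \<in> \<U>" and xy: "x \<in> V" "y \<in> ext U" for x y V U
  proof (cases "y \<in> U")
    case True
    then have far: "a * ?d x \<le> dist x y" using V(2)[OF U] xy by (auto simp: near_def not_less)
    have "a * ?d y \<le> a * (?d x + dist x y)"
      using a tri[of y x] by (intro mult_left_mono) (auto simp: dist_commute)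
    also have "\<dots> = a * ?d x + a * dist x y" by (rule distrib_left)
    also have "a * dist x y \<le> 1 / 40 * dist x y" using a by (intro mult_right_mono) auto
    finally have "a * ?d y \<le> a * ?d x + 1 / 40 * dist x y" by simp
    moreover have "0 \<le> a * ?d x" using a by (simp add: infdist_nonneg)
    ultimately show ?thesis using far zero_le_dist[of x y] by (intro conjI) linarith+
  next
    case False
    then obtain V' where V': "V' \<in> \<V>" "near V' U" "y \<in> V'" using xy by (auto simp: ext_def)
    then have "V \<noteq> V'" using V(2)[OF U] by auto
    then have "a * ?d x \<le> dist x y" "a * ?d y \<le> dist y x"
      using rel_separatedD[OF \<V>(1)] V V' xy unfolding a_def by blast+
    then show ?thesis using half_le[of x] half_le[of y] by (auto simp: dist_commute)
  qed
  have "rel_separated Z (a / 2) \<W>"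
    unfolding rel_separated_def
  proof (intro ballI impI)
    fix A B x y assume AB: "A \<in> \<W>" "B \<in> \<W>" "A \<noteq> B" and xy: "x \<in> A" "y \<in> B"
    consider U W where "U \<in> \<U>" "A = ext U" "W \<in> \<U>" "B = ext W"
      | U where "U \<in> \<U>" "A = ext U" "B \<in> \<V>" "\<forall>U\<in>\<U>. \<not> near B U"
      | U where "U \<in> \<U>" "B = ext U" "A \<in> \<V>" "\<forall>U\<in>\<U>. \<not> near A U"
      | "A \<in> \<V>" "B \<in> \<V>"
      using AB unfolding \<W>_def by blast
    then show "a / 2 * ?d x \<le> dist x y"
    proof cases
      case 1
      then show ?thesis using extext[of U W x y] AB xy by auto
    next
      case 2
      then show ?thesis using Vext[of B U y x] xy by (auto simp: dist_commute)
    next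
      case 3
      then show ?thesis using Vext[of A U x y] xy by auto
    next
      case 4
      then have "a * ?d x \<le> dist x y" using rel_separatedD[OF \<V>(1)] AB xy unfolding a_def by blast
      then show ?thesis using half_le[of x] by simp
    qed
  qed
  moreover have "rel_bounded Z c \<W>"
    unfolding rel_bounded_def
  proof (intro ballI)
    fix A x y assume A: "A \<in> \<W>" and xy: "x \<in> A" "y \<in> A"
    have cd: "1 * ?d z \<le> c * ?d z" for z using c infdist_nonneg by (intro mult_right_mono) auto
    consider U where "U \<in> \<U>" "A = ext U" | "A \<in> \<V>" using A unfolding \<W>_def by blast
    then show "dist x y \<le> c * ?d x"
    proof cases
      case 1
      obtain x0 y0 where 0: "x0 \<in> U" "dist x x0 \<le> ?d x / 16" "y0 \<in> U" "dist y y0 \<le> ?d y / 16"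
        using anchor[of U x] anchor[of U y] 1 xy by blast
      have "dist x0 y0 \<le> c / 2 * ?d x0" using rel_boundedD[OF \<U>(2)] 1 0 by auto
      moreover have "c / 2 * ?d x0 \<le> c / 2 * (17 / 16 * ?d x)"
        using c 0 tri[of x0 x] by (intro mult_left_mono) (auto simp: dist_commute)
      ultimately show ?thesis
        using 0 cd[of x] tri[of y y0] tri[of y0 x0] tri[of x0 x] dist_triangle[of x y x0] dist_triangle[of x0 y y0]
          infdist_nonneg[of x Z]
        by (simp add: dist_commute)
    next
      case 2
      then have "dist x y \<le> 1 / 40 * ?d x" using rel_boundedD[OF \<V>(2)] xy by auto
      then show ?thesis using cd[of x] infdist_nonneg[of x Z] by linarith
    qed
  qed
  moreover have "\<Union>\<W> = \<Union>\<V> \<union> \<Union>\<U>"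
    unfolding \<W>_def ext_def by blast
  moreover have "a / 2 = 1 / (80 * c)" by (simp add: a_def)
  ultimately show ?thesis by metis
qed

lemma dyadic_layer:
  fixes R d :: real assumes "0 < d" "d < R"
  shows "\<exists>j. R / 2 ^ Suc j \<le> d \<and> d < R / 2 ^ j"
proof -
  have "(\<lambda>k. R / 2 ^ k) \<longlonglongrightarrow> 0" by (rule LIMSEQ_divide_realpow_zero) simp
  then have "\<forall>\<^sub>F k in sequentially. R / 2 ^ k < d" using assms by (intro order_tendstoD) auto
  then obtain k where k: "R / 2 ^ k \<le> d" by (auto simp: eventually_sequentially intro: less_imp_le)
  define j where "j = (LEAST k. R / 2 ^ k \<le> d)"
  have j: "R / 2 ^ j \<le> d" unfolding j_def using k by (rule LeastI)
  have "j \<noteq> 0" using j assms by (intro notI) simp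
  then obtain i where i: "j = Suc i" using not0_implies_Suc by blast
  have "\<not> R / 2 ^ i \<le> d" using not_less_Least[of i "\<lambda>k. R / 2 ^ k \<le> d"] i by (simp add: j_def)
  then show ?thesis using j i by auto
qed

text \<open>Each dyadic layer around \<open>Z\<close> is cut out of a coloured cover at its own
  scale. Distinct layers of equal parity are at least two steps apart, so \<open>infdist\<close>
  differs by a factor 2 and this alone separates them. Neighbouring layers touch, and merging the
  two parities is left to \<open>absorb_families\<close>.\<close>

lemma layer_family:
  fixes Z :: "'a::metric_space set"
  assumes R: "0 < R" and a: "0 < a" "a \<le> 1 / 2" and C: "0 \<le> C"
    and cov: "\<And>s. 0 < s \<Longrightarrow> \<exists>\<V> :: nat \<Rightarrow> 'a set set. colored_cover n (C * s) s \<V>"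
  shows "\<exists>\<V> :: nat \<Rightarrow> 'a set set.
      (\<Union>k\<le>n. \<Union>(\<V> k)) = {x. \<exists>j. j mod 2 = q \<and> R / 2 ^ Suc j \<le> infdist x Z \<and> infdist x Z < R / 2 ^ j} \<and>
      (\<forall>k. \<Union>(\<V> k) \<subseteq> {x. 0 < infdist x Z}) \<and>
      (\<forall>k. rel_separated Z a (\<V> k) \<and> rel_bounded Z (2 * C * a) (\<V> k))"
proof -
  let ?d = "\<lambda>x. infdist x Z"
  define s where "s j = a * (R / 2 ^ j)" for j
  have s: "0 < s j" for j using R a by (simp add: s_def)
  define L where "L j = {x. R / 2 ^ Suc j \<le> ?d x \<and> ?d x < R / 2 ^ j}" for j
  obtain \<C> :: "nat \<Rightarrow> nat \<Rightarrow> 'a set set" where \<C>: "\<And>j. colored_cover n (C * s j) (s j) (\<C> j)"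
    using cov[OF s] by metis
  have cov: "\<exists>k\<le>n. \<exists>V\<in>\<C> j k. x \<in> V" for j x
  proof -
    have "x \<in> (\<Union>k\<le>n. \<Union>(\<C> j k))" using \<C>[of j] by (simp add: colored_cover_def)
    then show ?thesis by auto
  qed
  have bdd: "dist x y \<le> C * s j" if "V \<in> \<C> j k" "x \<in> V" "y \<in> V" for j k V x y using \<C>[of j] that unfolding colored_cover_def by blast
  have sep: "s j \<le> dist x y" if "V \<in> \<C> j k" "W \<in> \<C> j k" "V \<noteq> W" "x \<in> V" "y \<in> W" for j k V W x y
    using \<C>[of j] that unfolding colored_cover_def by blast
  define \<V> where "\<V> k = {V \<inter> L j | V j. j mod 2 = q \<and> V \<in> \<C> j k}" for k
  have "(\<Union>k\<le>n. \<Union>(\<V> k)) = {x. \<exists>j. j mod 2 = q \<and> x \<in> L j}"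
  proof (intro equalityI subsetI)
    fix x assume "x \<in> {x. \<exists>j. j mod 2 = q \<and> x \<in> L j}"
    then obtain j where j: "j mod 2 = q" "x \<in> L j" by auto
    obtain k V where "k \<le> n" "V \<in> \<C> j k" "x \<in> V" using cov by metis
    then show "x \<in> (\<Union>k\<le>n. \<Union>(\<V> k))" using j by (auto simp: \<V>_def)
  qed (auto simp: \<V>_def)
  moreover have "?d x > 0" if "x \<in> L j" for x j
  proof -
    have "0 < R / 2 ^ Suc j" using R by simp
    also have "\<dots> \<le> ?d x" using that by (simp add: L_def)
    finally show ?thesis .
  qed
  then have "\<Union>(\<V> k) \<subseteq> {x. 0 < ?d x}" for k by (auto simp: \<V>_def)
  moreover have "rel_bounded Z (2 * C * a) (\<V> k)" for k
    unfolding rel_bounded_def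
  proof (intro ballI)
    fix A x y assume "A \<in> \<V> k" "x \<in> A" "y \<in> A"
    then obtain V j where V: "V \<in> \<C> j k" "x \<in> V" "y \<in> V" "x \<in> L j" unfolding \<V>_def by blast
    have "dist x y \<le> C * s j" using bdd V by blast
    moreover have "s j \<le> a * (2 * ?d x)" unfolding s_def using V(4) a by (intro mult_left_mono) (auto simp: L_def)
    then have "C * s j \<le> C * (a * (2 * ?d x))" using C by (rule mult_left_mono)
    ultimately show "dist x y \<le> 2 * C * a * ?d x" by (simp add: mult_ac)
  qed
  moreover have "rel_separated Z a (\<V> k)" for k
    unfolding rel_separated_def
  proof (intro ballI impI)
    fix A B x y assume AB: "A \<in> \<V> k" "B \<in> \<V> k" "A \<noteq> B" and xy: "x \<in> A" "y \<in> B"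
    obtain V i where V: "A = V \<inter> L i" "V \<in> \<C> i k" "i mod 2 = q" using AB unfolding \<V>_def by blast
    obtain W j where W: "B = W \<inter> L j" "W \<in> \<C> j k" "j mod 2 = q" using AB unfolding \<V>_def by blast
    have x: "x \<in> V" "R / 2 ^ Suc i \<le> ?d x" "?d x < R / 2 ^ i" using V xy by (auto simp: L_def)
    have y: "y \<in> W" "R / 2 ^ Suc j \<le> ?d y" "?d y < R / 2 ^ j" using W xy by (auto simp: L_def)
    have half: "\<bar>?d x - ?d y\<bar> \<le> dist x y" by (rule infdist_triangle_abs)
    show "a * ?d x \<le> dist x y"
    proof (cases "i = j")
      case True
      then have "V \<noteq> W" using AB V W by auto
      then have "s i \<le> dist x y" using sep V W x y True by blast
      moreover have "a * ?d x \<le> s i" unfolding s_def using x a by (intro mult_left_mono) auto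
      ultimately show ?thesis by simp
    next
      case False
      have gap: "2 * u \<le> v" if "l + 2 \<le> m" "R / 2 ^ Suc l \<le> v" "u < R / 2 ^ m" for l m u v
      proof -
        have "R / 2 ^ m \<le> R / 2 ^ (l + 2)" using that(1) R by (intro divide_left_mono power_increasing) auto
        then show ?thesis using that by simp
      qed
      have "i + 2 \<le> j \<or> j + 2 \<le> i" using False V W by presburger
      then have "2 * ?d y \<le> ?d x \<or> 2 * ?d x \<le> ?d y" using gap x y by blast
      then have "1 / 2 * ?d x \<le> dist x y" using half infdist_nonneg[of x Z] by auto
      moreover have "a * ?d x \<le> 1 / 2 * ?d x" using a infdist_nonneg by (intro mult_right_mono) auto
      ultimately show ?thesis by linarith
    qed
  qed
  ultimately show ?thesis unfolding L_def by (intro exI[of _ \<V>]) auto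
qed

lemma whitney_families:
  assumes nag: "nagata_cond TYPE('a::metric_space) n" and R: "0 < R" "\<And>x y :: 'a. dist x y < R"
  obtains a \<beta> where "0 < a" "a \<le> 1" "0 \<le> \<beta>" "\<And>Z :: 'a set. closed Z \<Longrightarrow> Z \<noteq> {} \<Longrightarrow> \<exists>\<W> :: nat \<Rightarrow> 'a set set.
      (\<Union>k\<le>n. \<Union>(\<W> k)) = - Z \<and> (\<forall>k. rel_separated Z a (\<W> k) \<and> rel_bounded Z \<beta> (\<W> k))"
proof -
  obtain C where C: "1 \<le> C" and cov: "\<And>s. 0 < s \<Longrightarrow> \<exists>\<V> :: nat \<Rightarrow> 'a set set. colored_cover n (C * s) s \<V>"
    using nagata_colored[OF nag] by metis
  \<comment> \<open>With \<open>c = 2 * C\<close> the odd layers, taken with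
    \<open>a = 1 / (40 * c)\<close>, get the bound \<open>1 / 40\<close>, and the even ones, taken
    with \<open>a = 1 / 2\<close>, get \<open>c / 2\<close>, as \<open>absorb_families\<close>
    demands.\<close>
  define c where "c = 2 * C"
  have c: "1 \<le> c" using C by (simp add: c_def)
  show ?thesis
  proof (rule that[of "1 / (80 * c)" c])
    fix Z :: "'a set" assume Z: "closed Z" "Z \<noteq> {}"
    let ?d = "\<lambda>x. infdist x Z"
    let ?L = "\<lambda>q. {x. \<exists>j. j mod 2 = q \<and> R / 2 ^ Suc j \<le> ?d x \<and> ?d x < R / 2 ^ j}"
    have small: "1 / (40 * c) \<le> 1 / 2" "0 < 1 / (40 * c)" "0 \<le> C" using c C by (auto simp: field_simps)
    let ?P = "\<lambda>q a \<V>. (\<Union>k\<le>n. \<Union>(\<V> k)) = ?L q \<and> (\<forall>k. \<Union>(\<V> k) \<subseteq> {x. 0 < ?d x}) \<and>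
      (\<forall>k. rel_separated Z a (\<V> k) \<and> rel_bounded Z (2 * C * a) (\<V> k))"
    have "\<exists>\<V> :: nat \<Rightarrow> 'a set set. ?P 1 (1 / (40 * c)) \<V>"
      by (rule layer_family[OF R(1) small(2,1,3) cov])
    then obtain \<V> :: "nat \<Rightarrow> 'a set set" where \<V>: "?P 1 (1 / (40 * c)) \<V>" by (elim exE)
    have "\<exists>\<U> :: nat \<Rightarrow> 'a set set. ?P 0 (1 / 2) \<U>"
      by (rule layer_family[OF R(1) _ _ small(3) cov]) auto
    then obtain \<U> :: "nat \<Rightarrow> 'a set set" where \<U>: "?P 0 (1 / 2) \<U>" by (elim exE)
    have "\<exists>\<W>. \<Union>\<W> = \<Union>(\<V> k) \<union> \<Union>(\<U> k) \<and> rel_separated Z (1 / (80 * c)) \<W> \<and> rel_bounded Z c \<W>" for k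
    proof (rule absorb_families[OF c])
      have sub: "\<Union>(\<V> k) \<subseteq> {x. 0 < ?d x}" "\<Union>(\<U> k) \<subseteq> {x. 0 < ?d x}"
        using \<V>[THEN conjunct2, THEN conjunct1] \<U>[THEN conjunct2, THEN conjunct1] by simp_all
      show "0 < ?d x" if "x \<in> \<Union>(\<V> k) \<union> \<Union>(\<U> k)" for x
        using subsetD[OF sub(1), of x] subsetD[OF sub(2), of x] that by auto
      have e: "2 * C * (1 / (40 * c)) = 1 / 40" "2 * C * (1 / 2) = c / 2" using C by (auto simp: c_def)
      show "rel_separated Z (1 / (40 * c)) (\<V> k)" "rel_bounded Z (1 / 40) (\<V> k)"
        "rel_separated Z (1 / 2) (\<U> k)" "rel_bounded Z (c / 2) (\<U> k)"
        using \<V>[THEN conjunct2, THEN conjunct2, rule_format, of k, unfolded e]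
          \<U>[THEN conjunct2, THEN conjunct2, rule_format, of k, unfolded e]
        by simp_all
    qed
    then have "\<forall>k. \<exists>\<W>. \<Union>\<W> = \<Union>(\<V> k) \<union> \<Union>(\<U> k) \<and> rel_separated Z (1 / (80 * c)) \<W> \<and> rel_bounded Z c \<W>" ..
    then obtain \<W> :: "nat \<Rightarrow> 'a set set" where \<W>: "\<forall>k. \<Union>(\<W> k) = \<Union>(\<V> k) \<union> \<Union>(\<U> k) \<and>
      rel_separated Z (1 / (80 * c)) (\<W> k) \<and> rel_bounded Z c (\<W> k)" by (elim choice[THEN exE])
    then have "(\<Union>k\<le>n. \<Union>(\<W> k)) = (\<Union>k\<le>n. \<Union>(\<V> k)) \<union> (\<Union>k\<le>n. \<Union>(\<U> k))" by auto
    also have "\<dots> = ?L 1 \<union> ?L 0" using \<V> \<U> by simp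
    also have "\<dots> = - Z"
    proof (rule set_eqI)
      fix x
      obtain z where z: "z \<in> Z" using Z by blast
      \<comment> \<open>No distance reaches \<open>R\<close>, so the layers from
        \<open>j = 0\<close> on exhaust the complement of \<open>Z\<close>.\<close>
      have "?d x < R" using infdist_le[OF z, of x] R(2)[of x z] by simp
      moreover have "x \<notin> Z \<longleftrightarrow> 0 < ?d x"
        using Z in_closed_iff_infdist_zero[of Z x] infdist_nonneg[of x Z] by auto
      moreover have "0 < ?d x" if "R / 2 ^ Suc j \<le> ?d x" for j
        using that R(1) by (intro less_le_trans[OF _ that]) simp
      moreover have "j mod 2 = 1 \<or> j mod 2 = 0" for j :: nat by presburger
      ultimately show "x \<in> ?L 1 \<union> ?L 0 \<longleftrightarrow> x \<in> - Z"
        using dyadic_layer[of "?d x" R] by (simp only: Un_iff mem_Collect_eq Compl_iff) metis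
    qed
    finally show "\<exists>\<W> :: nat \<Rightarrow> 'a set set. (\<Union>k\<le>n. \<Union>(\<W> k)) = - Z \<and>
        (\<forall>k. rel_separated Z (1 / (80 * c)) (\<W> k) \<and> rel_bounded Z c (\<W> k))"
      using \<W> by (intro exI[of _ \<W>]) auto
  qed (use c in \<open>auto simp: field_simps\<close>)
qed

section \<open>Maps from simplices and nerves\<close>

text \<open>Barycentric coordinates are total functions vanishing off \<open>T\<close>: a face is
  literally a subset of each simplex containing it, and maps on different simplices can be compared
  without identifications.\<close>

definition std_simplex :: "'w set \<Rightarrow> ('w \<Rightarrow> real) set" where
  "std_simplex T = {\<theta>. (\<forall>w. 0 \<le> \<theta> w) \<and> (\<forall>w. w \<notin> T \<longrightarrow> \<theta> w = 0) \<and> sum \<theta> T = 1}"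

definition simplex_boundary :: "'w set \<Rightarrow> ('w \<Rightarrow> real) set" where
  "simplex_boundary T = {\<theta>\<in>std_simplex T. \<exists>w\<in>T. \<theta> w = 0}"

definition l1_dist :: "'w set \<Rightarrow> ('w \<Rightarrow> real) \<Rightarrow> ('w \<Rightarrow> real) \<Rightarrow> real" where
  "l1_dist T \<theta> \<eta> = (\<Sum>w\<in>T. \<bar>\<theta> w - \<eta> w\<bar>)"

lemma l1_dist_nonneg [simp]: "0 \<le> l1_dist T \<theta> \<eta>" by (simp add: l1_dist_def sum_nonneg)

lemma l1_dist_commute: "l1_dist T \<theta> \<eta> = l1_dist T \<eta> \<theta>" by (simp add: l1_dist_def abs_minus_commute)

lemma l1_dist_triangle: "l1_dist T \<theta> \<zeta> \<le> l1_dist T \<theta> \<eta> + l1_dist T \<eta> \<zeta>"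
  unfolding l1_dist_def sum.distrib[symmetric] by (intro sum_mono) auto

lemma l1_dist_mono: "finite T \<Longrightarrow> S \<subseteq> T \<Longrightarrow> l1_dist S \<theta> \<eta> \<le> l1_dist T \<theta> \<eta>"
  unfolding l1_dist_def by (intro sum_mono2) auto

lemma l1_dist_coord: "finite T \<Longrightarrow> w \<in> T \<Longrightarrow> \<bar>\<theta> w - \<eta> w\<bar> \<le> l1_dist T \<theta> \<eta>"
  unfolding l1_dist_def by (rule member_le_sum) auto

text \<open>A homeomorphism between the simplex and the Euclidean ball.  Points of the hyperplane
  carrying the simplex, recentred at the barycentre, are recovered from all but one of their
  coordinates by \<open>lift\<close>; \<open>mink\<close> is the Minkowski functional of the recentred simplex and
  \<open>radial\<close> carries its level sets to spheres.\<close>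

locale simplex_ball =
  fixes k :: nat
begin

definition lift :: "(nat \<Rightarrow> real) \<Rightarrow> nat \<Rightarrow> real" where
  "lift y i = (if i \<le> k then y i else - (\<Sum>j\<le>k. y j))"

definition mink :: "(nat \<Rightarrow> real) \<Rightarrow> real" where
  "mink y = real (k + 2) * Max ((\<lambda>i. - lift y i) ` {..Suc k})"

definition n1 :: "(nat \<Rightarrow> real) \<Rightarrow> real" where "n1 y = (\<Sum>i\<le>k. \<bar>y i\<bar>)"

definition n2 :: "(nat \<Rightarrow> real) \<Rightarrow> real" where "n2 y = L2_set y {..k}"

definition radial :: "(nat \<Rightarrow> real) \<Rightarrow> nat \<Rightarrow> real" where "radial y i = mink y / n2 y * y i"

lemma eucl_dist_eq: "eucl_dist k x y = n2 (\<lambda>i. x i - y i)"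
  by (simp add: eucl_dist_def n2_def L2_set_def)

lemma n1_nonneg [simp]: "0 \<le> n1 y" by (simp add: n1_def sum_nonneg)

lemma n2_nonneg [simp]: "0 \<le> n2 y" by (simp add: n2_def)

lemma n2_le_n1: "n2 y \<le> n1 y" unfolding n2_def n1_def by (rule L2_set_le_sum_abs)

lemma n1_le_n2: "n1 y \<le> real (k + 1) * n2 y"
proof -
  have "n1 y \<le> (\<Sum>i\<le>k. n2 y)"
    unfolding n1_def n2_def by (intro sum_mono) (use member_le_L2_set[of "{..k}" _ "\<lambda>i. \<bar>y i\<bar>"] in \<open>auto simp: L2_set_def\<close>)
  then show ?thesis by simp
qed

lemma n2_scale: "n2 (\<lambda>i. c * y i) = \<bar>c\<bar> * n2 y"
  by (simp add: n2_def L2_set_def power_mult_distrib real_sqrt_mult flip: sum_distrib_left)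

lemma n2_add: "n2 (\<lambda>i. x i + y i) \<le> n2 x + n2 y"
  unfolding n2_def by (rule L2_set_triangle_ineq)

lemma n2_diff: "\<bar>n2 x - n2 y\<bar> \<le> n2 (\<lambda>i. x i - y i)"
proof -
  have "n2 x \<le> n2 (\<lambda>i. x i - y i) + n2 y" for x y
    using n2_add[of "\<lambda>i. x i - y i" y] by simp
  from this[of x y] this[of y x]
  show ?thesis using n2_scale[of "-1" "\<lambda>i. x i - y i"] by (simp add: abs_le_iff)
qed

lemma sum_lift: "(\<Sum>i\<le>Suc k. lift y i) = 0" by (simp add: lift_def)

lemma lift_diff: "\<bar>lift y i - lift z i\<bar> \<le> n1 (\<lambda>i. y i - z i)"
proof (cases "i \<le> k")
  case True
  then show ?thesis unfolding lift_def n1_def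
    using member_le_sum[of i "{..k}" "\<lambda>i. \<bar>y i - z i\<bar>"] by auto
next
  case False
  then have "\<bar>lift y i - lift z i\<bar> = \<bar>\<Sum>j\<le>k. z j - y j\<bar>" by (simp add: lift_def sum_subtractf)
  also have "\<dots> \<le> (\<Sum>j\<le>k. \<bar>z j - y j\<bar>)" by (rule sum_abs)
  finally show ?thesis by (simp add: n1_def abs_minus_commute)
qed

lemma lift_scale: "lift (\<lambda>i. c * y i) i = c * lift y i"
  by (simp add: lift_def sum_distrib_left)

lemma mink_ge: "i \<le> Suc k \<Longrightarrow> - (real (k + 2) * lift y i) \<le> mink y"
  unfolding mink_def mult_minus_right[symmetric] by (intro mult_left_mono Max_ge) auto

lemma mink_attain: "\<exists>i\<le>Suc k. mink y = - (real (k + 2) * lift y i)"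
proof -
  have "Max ((\<lambda>i. - lift y i) ` {..Suc k}) \<in> (\<lambda>i. - lift y i) ` {..Suc k}" by (intro Max_in) auto
  then obtain i where "Max ((\<lambda>i. - lift y i) ` {..Suc k}) = - lift y i" "i \<in> {..Suc k}" by (rule imageE)
  then show ?thesis unfolding mink_def by (intro exI[of _ i]) (simp del: atMost_Suc)
qed

lemma mink_le: "(\<And>i. i \<le> Suc k \<Longrightarrow> - (real (k + 2) * lift y i) \<le> c) \<Longrightarrow> mink y \<le> c"
  using mink_attain[of y] by auto

lemma mink_nonneg: "0 \<le> mink y"
proof (rule ccontr)
  assume "\<not> ?thesis"
  then have "real (k + 2) * lift y i > 0" if "i \<le> Suc k" for i using mink_ge[OF that, of y] by linarith
  then have "lift y i > 0" if "i \<le> Suc k" for i using that by (simp add: zero_less_mult_iff)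
  then have "(\<Sum>i\<le>Suc k. lift y i) > 0" by (intro sum_pos) auto
  then show False using sum_lift by simp
qed

lemma mink_diff: "\<bar>mink y - mink z\<bar> \<le> real (k + 2) * n1 (\<lambda>i. y i - z i)"
proof -
  have *: "mink y \<le> mink z + real (k + 2) * n1 (\<lambda>i. y i - z i)" for y z
  proof (rule mink_le)
    fix i assume i: "i \<le> Suc k"
    have "real (k + 2) * (lift z i - lift y i) \<le> real (k + 2) * n1 (\<lambda>i. y i - z i)"
      using lift_diff[of y i z] by (intro mult_left_mono) auto
    then show "- (real (k + 2) * lift y i) \<le> mink z + real (k + 2) * n1 (\<lambda>i. y i - z i)"
      using mink_ge[OF i, of z] by (simp add: right_diff_distrib)
  qed
  have "n1 (\<lambda>i. z i - y i) = n1 (\<lambda>i. y i - z i)" by (simp add: n1_def abs_minus_commute)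
  then show ?thesis using *[of y z] *[of z y] by (simp add: abs_le_iff)
qed

lemma mink_zero: "mink (\<lambda>i. 0) = 0"
  by (intro antisym mink_le mink_nonneg) (simp add: lift_def)

lemma mink_upper: "mink y \<le> real (k + 2) * n1 y"
  using mink_diff[of y "\<lambda>i. 0"] by (simp add: mink_zero)

lemma mink_scale: assumes "0 \<le> c" shows "mink (\<lambda>i. c * y i) = c * mink y"
proof (rule antisym)
  show "mink (\<lambda>i. c * y i) \<le> c * mink y"
  proof (rule mink_le)
    fix i assume "i \<le> Suc k"
    then have "c * - (real (k + 2) * lift y i) \<le> c * mink y" using assms mink_ge by (intro mult_left_mono)
    then show "- (real (k + 2) * lift (\<lambda>i. c * y i) i) \<le> c * mink y" by (simp add: lift_scale mult_ac)
  qed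
  obtain i where i: "i \<le> Suc k" "mink y = - (real (k + 2) * lift y i)" using mink_attain by blast
  then show "c * mink y \<le> mink (\<lambda>i. c * y i)" using mink_ge[OF i(1), of "\<lambda>i. c * y i"] by (simp add: lift_scale mult_ac)
qed

text \<open>By definition \<open>mink\<close> controls the coordinates only from below; the upper
  bound follows because all \<open>k + 2\<close> coordinates sum to 0.\<close>

lemma lift_le_mink: assumes i: "i \<le> Suc k" shows "\<bar>lift y i\<bar> \<le> mink y"
proof -
  have lower: "- lift y j \<le> mink y / real (k + 2)" if "j \<le> Suc k" for j
    using mink_ge[OF that, of y] by (simp add: field_simps)
  have "mink y / real (k + 2) \<le> mink y / 1" using mink_nonneg by (intro divide_left_mono) auto
  then have 1: "- lift y i \<le> mink y" using lower[OF i] by simp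
  have "(\<Sum>j\<le>Suc k. lift y j) = lift y i + (\<Sum>j\<in>{..Suc k} - {i}. lift y j)"
    using i by (intro sum.remove) auto
  then have "lift y i = (\<Sum>j\<in>{..Suc k} - {i}. - lift y j)" using sum_lift[of y] by (simp add: sum_negf)
  also have "\<dots> \<le> (\<Sum>j\<in>{..Suc k} - {i}. mink y / real (k + 2))" using lower by (intro sum_mono) auto
  also have "\<dots> = real (k + 1) / real (k + 2) * mink y" using i by (simp add: card_Diff_singleton)
  also have "\<dots> \<le> 1 * mink y" using mink_nonneg by (intro mult_right_mono) auto
  finally show ?thesis using 1 by simp
qed

lemma n1_le_mink: "n1 y \<le> real (k + 1) * mink y"
proof -
  have "n1 y \<le> (\<Sum>i\<le>k. mink y)"
    unfolding n1_def
  proof (rule sum_mono)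
    fix i assume "i \<in> {..k}"
    then show "\<bar>y i\<bar> \<le> mink y" using lift_le_mink[of i y] by (simp add: lift_def)
  qed
  then show ?thesis by simp
qed

lemma n2_radial: "n2 (radial y) = mink y"
proof (cases "n2 y = 0")
  case True
  then have "n1 y = 0" using n1_le_n2[of y] n1_nonneg[of y] by simp
  then have "mink y = 0" using mink_upper[of y] mink_nonneg[of y] by simp
  moreover have "radial y = (\<lambda>i. 0 * y i)" using True by (simp add: radial_def fun_eq_iff)
  ultimately show ?thesis by (simp only: n2_scale)
next
  case False
  have "radial y = (\<lambda>i. (mink y / n2 y) * y i)" by (simp add: radial_def fun_eq_iff)
  then have "n2 (radial y) = \<bar>mink y / n2 y\<bar> * n2 y" by (simp only: n2_scale)
  then show ?thesis using False mink_nonneg[of y] by simp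
qed

text \<open>\<open>mink\<close> and \<open>n2\<close> are both Lipschitz and positively homogeneous
  of degree 1, and their ratio is bounded by \<open>real (k + 2) ^ 2\<close>.\<close>

lemma radial_diff: "n2 (\<lambda>i. radial y i - radial z i) \<le> 3 * real (k + 2) ^ 2 * n1 (\<lambda>i. y i - z i)"
proof -
  let ?K = "real (k + 2)" and ?d = "n1 (\<lambda>i. y i - z i)"
  have rat: "mink z / n2 z \<le> ?K ^ 2" for z
  proof (cases "n2 z = 0")
    case False
    have "real (k + 1) * n2 z \<le> ?K * n2 z" by (intro mult_right_mono) auto
    then have "?K * n1 z \<le> ?K * (?K * n2 z)" using n1_le_n2[of z] by (intro mult_left_mono) auto
    then have "mink z \<le> ?K * (?K * n2 z)" using mink_upper[of z] by linarith
    moreover have "0 < n2 z" using False n2_nonneg[of z] by linarith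
    ultimately show ?thesis by (simp only: pos_divide_le_eq power2_eq_square mult.assoc)
  qed simp
  have Kd: "?K * ?d \<le> ?K ^ 2 * ?d" unfolding power2_eq_square by (intro mult_right_mono) (auto simp: mult_le_cancel_right1)
  have K0: "0 \<le> ?K ^ 2 * ?d" by simp
  consider "n2 y = 0" | "n2 z = 0" | "n2 y \<noteq> 0" "n2 z \<noteq> 0" by blast
  then show ?thesis
  proof cases
    case 1
    then have "radial y = (\<lambda>i. 0)" by (simp add: radial_def fun_eq_iff)
    then have "n2 (\<lambda>i. radial y i - radial z i) = mink z"
      using n2_radial[of z] n2_scale[of "-1" "radial z"] by simp
    moreover have "mink y = 0" using n2_radial[of y] \<open>radial y = _\<close> n2_scale[of 0 y] by simp
    ultimately show ?thesis using mink_diff[of y z] Kd K0 by simp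
  next
    case 2
    then have "radial z = (\<lambda>i. 0)" by (simp add: radial_def fun_eq_iff)
    then have "n2 (\<lambda>i. radial y i - radial z i) = mink y" using n2_radial[of y] by simp
    moreover have "mink z = 0" using n2_radial[of z] \<open>radial z = _\<close> n2_scale[of 0 z] by simp
    ultimately show ?thesis using mink_diff[of y z] Kd K0 by simp
  next
    case 3
    let ?c = "mink z / n2 z"
    \<comment> \<open>\<open>?a\<close> is the difference of the two ratios
      \<open>mink / n2\<close>, written so that multiplication by \<open>n2 y\<close> cancels every
      denominator \<open>n2 y\<close>; this keeps the estimate uniform near 0.\<close>
    let ?a = "(mink y - mink z) / n2 y + ?c * ((n2 z - n2 y) / n2 y)"
    have c: "0 \<le> ?c" using mink_nonneg by simp
    have nd: "n2 (\<lambda>i. y i - z i) \<le> ?d" by (rule n2_le_n1)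
    have "radial y i - radial z i = ?a * y i + ?c * (y i - z i)" for i
      using 3 by (simp add: radial_def field_simps)
    then have "n2 (\<lambda>i. radial y i - radial z i) \<le> n2 (\<lambda>i. ?a * y i) + n2 (\<lambda>i. ?c * (y i - z i))"
      using n2_add by (simp only:)
    also have "n2 (\<lambda>i. ?c * (y i - z i)) = ?c * n2 (\<lambda>i. y i - z i)" using c by (simp only: n2_scale abs_of_nonneg)
    also have "n2 (\<lambda>i. ?a * y i) = \<bar>?a * n2 y\<bar>" by (simp only: n2_scale abs_mult abs_of_nonneg[OF n2_nonneg])
    also have "?a * n2 y = (mink y - mink z) + ?c * (n2 z - n2 y)" using 3 by (simp add: field_simps)
    also have "\<bar>\<dots>\<bar> \<le> \<bar>mink y - mink z\<bar> + ?c * \<bar>n2 z - n2 y\<bar>"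
      using abs_triangle_ineq[of "mink y - mink z" "?c * (n2 z - n2 y)"]
      by (simp only: abs_mult abs_of_nonneg[OF c])
    also have "\<dots> \<le> ?K * ?d + ?K ^ 2 * ?d"
      using mink_diff[of y z] n2_diff[of y z] nd rat[of z] c
      by (intro add_mono mult_mono) (auto simp: abs_minus_commute)
    finally have "n2 (\<lambda>i. radial y i - radial z i) \<le> ?K * ?d + ?K ^ 2 * ?d + ?c * n2 (\<lambda>i. y i - z i)" by simp
    moreover have "?c * n2 (\<lambda>i. y i - z i) \<le> ?K ^ 2 * ?d" using rat[of z] nd by (intro mult_mono) auto
    ultimately show ?thesis using Kd by linarith
  qed
qed

lemma sphere_mink: assumes "n2 x = 1" shows "1 \<le> real (k + 1) * mink x" "0 < mink x"
proof -
  show 1: "1 \<le> real (k + 1) * mink x" using n2_le_n1[of x] n1_le_mink[of x] assms by linarith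
  show "0 < mink x" using 1 mink_nonneg[of x] by (cases "mink x = 0") auto
qed

text \<open>Normalising by \<open>mink\<close> inverts \<open>radial\<close> on the sphere. There
  \<open>mink\<close> is at least \<open>1 / (k + 1)\<close>, so dividing by it is
  Lipschitz.\<close>

lemma lift_normalized_diff:
  assumes x: "n2 x = 1" and y: "n2 y = 1" and i: "i \<le> Suc k"
  shows "\<bar>lift x i / mink x - lift y i / mink y\<bar> \<le> 2 * real (k + 2) ^ 3 * n2 (\<lambda>i. x i - y i)"
proof -
  let ?K = "real (k + 2)" and ?d = "n2 (\<lambda>i. x i - y i)"
  have g: "0 < mink x" "0 < mink y" using sphere_mink x y by auto
  have inv: "1 / mink x \<le> ?K" using sphere_mink[OF x] by (simp add: field_simps)
  have d1: "n1 (\<lambda>i. x i - y i) \<le> ?K * ?d"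
    by (rule order_trans[OF n1_le_n2]) (intro mult_right_mono, auto)
  have "lift x i / mink x - lift y i / mink y
      = (1 / mink x) * ((lift x i - lift y i) + (lift y i / mink y) * (mink y - mink x))"
    using g by (simp add: field_simps)
  then have "\<bar>lift x i / mink x - lift y i / mink y\<bar>
      = (1 / mink x) * \<bar>(lift x i - lift y i) + (lift y i / mink y) * (mink y - mink x)\<bar>"
    using g by (simp only: abs_mult) simp
  also have "\<dots> \<le> ?K * \<bar>(lift x i - lift y i) + (lift y i / mink y) * (mink y - mink x)\<bar>"
    using inv by (rule mult_right_mono) simp
  also have "\<bar>(lift x i - lift y i) + (lift y i / mink y) * (mink y - mink x)\<bar>
      \<le> \<bar>lift x i - lift y i\<bar> + \<bar>lift y i / mink y\<bar> * \<bar>mink y - mink x\<bar>"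
    using abs_triangle_ineq[of "lift x i - lift y i" "(lift y i / mink y) * (mink y - mink x)"] by (simp only: abs_mult)
  also have "\<dots> \<le> ?K * ?d + 1 * (?K * (?K * ?d))"
  proof (intro add_mono mult_mono)
    show "\<bar>lift x i - lift y i\<bar> \<le> ?K * ?d" using lift_diff[of x i y] d1 by linarith
    show "\<bar>lift y i / mink y\<bar> \<le> 1" using lift_le_mink[OF i, of y] g by (simp add: field_simps)
    have "?K * n1 (\<lambda>i. x i - y i) \<le> ?K * (?K * ?d)" using d1 by (intro mult_left_mono) auto
    then show "\<bar>mink y - mink x\<bar> \<le> ?K * (?K * ?d)" using mink_diff[of x y] abs_minus_commute[of "mink y" "mink x"] by linarith
  qed auto
  also have "?K * ?d + 1 * (?K * (?K * ?d)) \<le> 2 * (?K * (?K * ?d))"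
  proof -
    have "1 * (?K * ?d) \<le> ?K * (?K * ?d)" by (intro mult_right_mono) auto
    then show ?thesis by simp
  qed
  finally show ?thesis by (simp add: power3_eq_cube mult_left_mono mult_ac)
qed

end

lemma unit_sphere_n2: "x \<in> unit_sphere k \<longleftrightarrow> (\<forall>i>k. x i = 0) \<and> simplex_ball.n2 k x = 1"
  by (simp add: unit_sphere_def simplex_ball.n2_def L2_set_def)

lemma unit_ball_n2: "x \<in> unit_ball k \<longleftrightarrow> (\<forall>i>k. x i = 0) \<and> simplex_ball.n2 k x \<le> 1"
  by (simp add: unit_ball_def simplex_ball.n2_def L2_set_def)

text \<open>The boundary values are carried to the sphere by \<open>\<Psi>\<close>, filled in the
  ball and pulled back by \<open>\<Phi>\<close>; they are kept because \<open>\<Psi>\<close> inverts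
  \<open>\<Phi>\<close> on the boundary. The factor 6 is 2 from \<open>\<Psi>\<close> times 3 from
  \<open>\<Phi>\<close>, and the exponent 6 is 4 + 2.\<close>

lemma simplex_filling:
  fixes f :: "('w \<Rightarrow> real) \<Rightarrow> 'b::metric_space"
  assumes fill: "\<And>L (f :: (nat \<Rightarrow> real) \<Rightarrow> 'b). 0 \<le> L \<Longrightarrow> lipschitz_from_eucl k L (unit_sphere k) f \<Longrightarrow>
      \<exists>F. lipschitz_from_eucl k (\<gamma> * L) (unit_ball k) F \<and> (\<forall>x\<in>unit_sphere k. F x = f x)"
    and \<gamma>: "0 \<le> \<gamma>" and T: "finite T" "card T = k + 2" and L: "0 \<le> L"
    and f: "\<And>\<theta> \<eta>. \<theta> \<in> simplex_boundary T \<Longrightarrow> \<eta> \<in> simplex_boundary T \<Longrightarrow> dist (f \<theta>) (f \<eta>) \<le> L * l1_dist T \<theta> \<eta>"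
  shows "\<exists>F. (\<forall>\<theta>\<in>simplex_boundary T. F \<theta> = f \<theta>) \<and>
     (\<forall>\<theta>\<in>std_simplex T. \<forall>\<eta>\<in>std_simplex T. dist (F \<theta>) (F \<eta>) \<le> (6 * \<gamma> * real (k + 2) ^ 6) * L * l1_dist T \<theta> \<eta>)"
proof -
  interpret simplex_ball k .
  let ?K = "real (k + 2)"
  obtain e where e: "bij_betw e {..Suc k} T"
    using ex_bij_betw_nat_finite[OF T(1)] T(2) by (metis add_2_eq_Suc' atLeast0LessThan lessThan_Suc_atMost)
  define \<iota> where "\<iota> = inv_into {..Suc k} e"
  have eT: "e i \<in> T" if "i \<le> Suc k" for i using that e by (auto simp: bij_betw_def)
  have \<iota>: "\<iota> w \<le> Suc k" "e (\<iota> w) = w" if "w \<in> T" for w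
    using that e bij_betw_inv_into_right[OF e that] inv_into_into[of w e "{..Suc k}"]
    by (auto simp: \<iota>_def bij_betw_def)
  have \<iota>e: "\<iota> (e i) = i" if "i \<le> Suc k" for i
    unfolding \<iota>_def using that by (intro bij_betw_inv_into_left[OF e]) auto
  have sumT: "sum g T = (\<Sum>i\<le>Suc k. g (e i))" for g :: "'w \<Rightarrow> real"
    using sum.reindex_bij_betw[OF e, of g] by simp
  define Y where "Y \<theta> i = (if i \<le> k then \<theta> (e i) - 1 / ?K else 0)" for \<theta> :: "'w \<Rightarrow> real" and i
  have liftY: "lift (Y \<theta>) i = \<theta> (e i) - 1 / ?K" if "\<theta> \<in> std_simplex T" "i \<le> Suc k" for \<theta> i
  proof (cases "i \<le> k")
    case False
    then have i: "i = Suc k" using that by simp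
    have "(\<Sum>i\<le>k. \<theta> (e i)) + \<theta> (e (Suc k)) = 1" using that(1) sumT[of \<theta>] by (simp add: std_simplex_def)
    moreover have "(\<Sum>j\<le>k. Y \<theta> j) = (\<Sum>i\<le>k. \<theta> (e i)) - real (k + 1) / ?K"
      by (simp add: Y_def sum_subtractf)
    moreover have "real (k + 1) / ?K = 1 - 1 / ?K" by (simp add: field_simps)
    ultimately show ?thesis using False i by (simp add: lift_def)
  qed (simp add: lift_def Y_def)
  have KliftY: "- (?K * lift (Y \<theta>) i) = 1 - ?K * \<theta> (e i)" if "\<theta> \<in> std_simplex T" "i \<le> Suc k" for \<theta> i
    unfolding liftY[OF that] by (simp add: field_simps)
  have mY_le: "mink (Y \<theta>) \<le> 1" if \<theta>: "\<theta> \<in> std_simplex T" for \<theta>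
  proof (rule mink_le)
    fix i assume "i \<le> Suc k"
    moreover have "0 \<le> ?K * \<theta> (e i)" using \<theta> by (simp add: std_simplex_def)
    ultimately show "- (?K * lift (Y \<theta>) i) \<le> 1" using KliftY[OF \<theta>] by simp
  qed
  have mY_eq: "mink (Y \<theta>) = 1" if \<theta>: "\<theta> \<in> simplex_boundary T" for \<theta>
  proof -
    obtain w where w: "w \<in> T" "\<theta> w = 0" and s: "\<theta> \<in> std_simplex T" using \<theta> by (auto simp: simplex_boundary_def)
    have "1 \<le> mink (Y \<theta>)" using mink_ge[OF \<iota>(1)[OF w(1)], of "Y \<theta>"] KliftY[OF s \<iota>(1)[OF w(1)]] \<iota>(2)[OF w(1)] w by simp
    then show ?thesis using mY_le[OF s] by simp
  qed
  define \<Phi> where "\<Phi> \<theta> = radial (Y \<theta>)" for \<theta>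
  have \<Phi>0: "\<forall>i>k. \<Phi> \<theta> i = 0" for \<theta> by (simp add: \<Phi>_def radial_def Y_def)
  have \<Phi>_ball: "\<Phi> \<theta> \<in> unit_ball k" if "\<theta> \<in> std_simplex T" for \<theta>
    unfolding unit_ball_n2 using \<Phi>0 mY_le[OF that] by (simp add: \<Phi>_def n2_radial)
  have \<Phi>_sphere: "\<Phi> \<theta> \<in> unit_sphere k" if "\<theta> \<in> simplex_boundary T" for \<theta>
    unfolding unit_sphere_n2 using \<Phi>0 mY_eq[OF that] by (simp add: \<Phi>_def n2_radial)
  have \<Phi>_lip: "eucl_dist k (\<Phi> \<theta>) (\<Phi> \<eta>) \<le> 3 * ?K ^ 2 * l1_dist T \<theta> \<eta>" for \<theta> \<eta>
  proof -
    have "n1 (\<lambda>i. Y \<theta> i - Y \<eta> i) = (\<Sum>i\<le>k. \<bar>\<theta> (e i) - \<eta> (e i)\<bar>)" by (simp add: n1_def Y_def)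
    also have "\<dots> \<le> l1_dist T \<theta> \<eta>" by (simp add: l1_dist_def sumT)
    finally have "3 * ?K ^ 2 * n1 (\<lambda>i. Y \<theta> i - Y \<eta> i) \<le> 3 * ?K ^ 2 * l1_dist T \<theta> \<eta>" by (intro mult_left_mono) auto
    then show ?thesis unfolding eucl_dist_eq \<Phi>_def using radial_diff[of "Y \<theta>" "Y \<eta>"] by linarith
  qed
  define \<Psi> where "\<Psi> x w = (if w \<in> T then 1 / ?K + lift x (\<iota> w) / mink x else 0)" for x w
  have \<Psi>_boundary: "\<Psi> x \<in> simplex_boundary T" if "x \<in> unit_sphere k" for x
  proof -
    have g: "0 < mink x" using that sphere_mink unfolding unit_sphere_n2 by blast
    have "0 \<le> \<Psi> x w" for w
    proof (cases "w \<in> T")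
      case True
      have "- (?K * lift x (\<iota> w)) \<le> mink x" using mink_ge[OF \<iota>(1)[OF True]] .
      then show ?thesis using g True by (simp add: \<Psi>_def field_simps)
    qed (simp add: \<Psi>_def)
    moreover have "sum (\<Psi> x) T = (\<Sum>i\<le>Suc k. 1 / ?K + lift x i / mink x)"
      unfolding sumT using eT \<iota>e by (intro sum.cong) (auto simp: \<Psi>_def)
    then have "sum (\<Psi> x) T = 1" unfolding sum.distrib sum_divide_distrib[symmetric] sum_lift by simp
    moreover obtain i where i: "i \<le> Suc k" "mink x = - (?K * lift x i)" using mink_attain by blast
    then have "lift x i / mink x = - 1 / ?K" using g by (auto simp: field_simps)
    then have "\<Psi> x (e i) = 0" using i eT \<iota>e by (simp add: \<Psi>_def)
    ultimately show ?thesis using eT[OF i(1)] by (auto simp: simplex_boundary_def std_simplex_def \<Psi>_def)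
  qed
  have \<Psi>_lip: "l1_dist T (\<Psi> x) (\<Psi> y) \<le> 2 * ?K ^ 4 * eucl_dist k x y"
    if "x \<in> unit_sphere k" "y \<in> unit_sphere k" for x y
  proof -
    have "\<bar>\<Psi> x w - \<Psi> y w\<bar> \<le> 2 * ?K ^ 3 * eucl_dist k x y" if w: "w \<in> T" for w
      using lift_normalized_diff[of x y "\<iota> w"] \<iota>(1)[OF w] w \<open>x \<in> _\<close> \<open>y \<in> _\<close>
      unfolding unit_sphere_n2 eucl_dist_eq by (simp add: \<Psi>_def)
    then have "l1_dist T (\<Psi> x) (\<Psi> y) \<le> (\<Sum>w\<in>T. 2 * ?K ^ 3 * eucl_dist k x y)"
      unfolding l1_dist_def by (rule sum_mono)
    also have "\<dots> = 2 * ?K ^ 4 * eucl_dist k x y" using T(2) by (simp add: power3_eq_cube power4_eq_xxxx)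
    finally show ?thesis .
  qed
  have \<Psi>\<Phi>: "\<Psi> (\<Phi> \<theta>) = \<theta>" if \<theta>: "\<theta> \<in> simplex_boundary T" for \<theta>
  proof
    fix w
    have s: "\<theta> \<in> std_simplex T" using \<theta> by (simp add: simplex_boundary_def)
    define c where "c = 1 / n2 (Y \<theta>)"
    have \<Phi>c: "\<Phi> \<theta> = (\<lambda>i. c * Y \<theta> i)" using mY_eq[OF \<theta>] by (simp add: \<Phi>_def radial_def c_def fun_eq_iff)
    have c0: "0 \<le> c" by (simp add: c_def)
    have "n2 (\<Phi> \<theta>) = 1" using \<Phi>_sphere[OF \<theta>] by (simp add: unit_sphere_n2)
    then have "c \<noteq> 0" unfolding \<Phi>c n2_scale by auto
    then have "lift (\<Phi> \<theta>) i / mink (\<Phi> \<theta>) = lift (Y \<theta>) i" for i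
      unfolding \<Phi>c lift_scale mink_scale[OF c0] using mY_eq[OF \<theta>] by simp
    then show "\<Psi> (\<Phi> \<theta>) w = \<theta> w"
      using liftY[OF s \<iota>(1)] \<iota>(2) s by (simp add: \<Psi>_def std_simplex_def)
  qed
  have "lipschitz_from_eucl k (L * (2 * ?K ^ 4)) (unit_sphere k) (\<lambda>x. f (\<Psi> x))"
    unfolding lipschitz_from_eucl_def
  proof (intro ballI)
    fix x y assume xy: "x \<in> unit_sphere k" "y \<in> unit_sphere k"
    have "dist (f (\<Psi> x)) (f (\<Psi> y)) \<le> L * l1_dist T (\<Psi> x) (\<Psi> y)" using \<Psi>_boundary xy by (intro f)
    also have "\<dots> \<le> L * (2 * ?K ^ 4 * eucl_dist k x y)" using \<Psi>_lip[OF xy] L by (rule mult_left_mono)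
    finally show "dist (f (\<Psi> x)) (f (\<Psi> y)) \<le> L * (2 * ?K ^ 4) * eucl_dist k x y" by (simp add: mult_ac)
  qed
  then obtain G where G: "lipschitz_from_eucl k (\<gamma> * (L * (2 * ?K ^ 4))) (unit_ball k) G"
    "\<forall>x\<in>unit_sphere k. G x = f (\<Psi> x)" using fill[of "L * (2 * ?K ^ 4)"] L by auto
  show ?thesis
  proof (intro exI[of _ "\<lambda>\<theta>. G (\<Phi> \<theta>)"] conjI ballI)
    show "G (\<Phi> \<theta>) = f \<theta>" if "\<theta> \<in> simplex_boundary T" for \<theta>
      using G(2) \<Phi>_sphere[OF that] \<Psi>\<Phi>[OF that] by simp
    fix \<theta> \<eta> assume \<theta>: "\<theta> \<in> std_simplex T" "\<eta> \<in> std_simplex T"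
    have "dist (G (\<Phi> \<theta>)) (G (\<Phi> \<eta>)) \<le> \<gamma> * (L * (2 * ?K ^ 4)) * eucl_dist k (\<Phi> \<theta>) (\<Phi> \<eta>)"
      using G(1) \<Phi>_ball \<theta> by (auto simp: lipschitz_from_eucl_def)
    also have "\<dots> \<le> \<gamma> * (L * (2 * ?K ^ 4)) * (3 * ?K ^ 2 * l1_dist T \<theta> \<eta>)"
      using \<gamma> L by (intro mult_left_mono \<Phi>_lip) auto
    also have "\<dots> = (6 * \<gamma> * (?K ^ 4 * ?K ^ 2)) * L * l1_dist T \<theta> \<eta>" by (simp only: mult_ac)
    also have "?K ^ 4 * ?K ^ 2 = ?K ^ 6" by (simp flip: power_add)
    finally show "dist (G (\<Phi> \<theta>)) (G (\<Phi> \<eta>)) \<le> (6 * \<gamma> * ?K ^ 6) * L * l1_dist T \<theta> \<eta>" .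
  qed
qed

section \<open>Extension over the skeleta of a simplicial complex\<close>

lemma std_simplex_subset: "finite T \<Longrightarrow> S \<subseteq> T \<Longrightarrow> \<theta> \<in> std_simplex T \<Longrightarrow> (\<And>w. w \<in> T - S \<Longrightarrow> \<theta> w = 0) \<Longrightarrow> \<theta> \<in> std_simplex S"
  unfolding std_simplex_def using sum.mono_neutral_right[of T S \<theta>] by auto

lemma std_simplex_mono: "finite T \<Longrightarrow> S \<subseteq> T \<Longrightarrow> \<theta> \<in> std_simplex S \<Longrightarrow> \<theta> \<in> std_simplex T"
  unfolding std_simplex_def using sum.mono_neutral_left[of T S \<theta>] by auto

lemma std_simplex_singleton: "\<theta> \<in> std_simplex {w} \<longleftrightarrow> \<theta> = indicator {w}"
proof
  assume "\<theta> \<in> std_simplex {w}"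
  then show "\<theta> = indicator {w}" by (auto simp: std_simplex_def fun_eq_iff indicator_def)
next
  assume "\<theta> = indicator {w}"
  then show "\<theta> \<in> std_simplex {w}" by (simp add: std_simplex_def)
qed

text \<open>Two boundary points on different faces are joined through a point common to both faces.
  For an edge there is no such point; its ends are at \<open>l1_dist\<close> at least 1 and
  \<open>D\<close> bounds the distance of their images, whence the summand 1 in
  \<open>5 * C + 1\<close>.\<close>

lemma simplex_boundary_lipschitz:
  fixes F :: "('w \<Rightarrow> real) \<Rightarrow> 'b::metric_space"
  assumes T: "finite T" and D: "0 \<le> D" "0 \<le> C"
    and vert: "\<And>v w. v \<in> T \<Longrightarrow> w \<in> T \<Longrightarrow> dist (F (indicator {v})) (F (indicator {w})) \<le> D"
    and face: "\<And>u \<theta> \<eta>. u \<in> T \<Longrightarrow> \<theta> \<in> std_simplex (T - {u}) \<Longrightarrow> \<eta> \<in> std_simplex (T - {u}) \<Longrightarrow>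
        dist (F \<theta>) (F \<eta>) \<le> C * D * l1_dist (T - {u}) \<theta> \<eta>"
    and \<theta>: "\<theta> \<in> simplex_boundary T" and \<eta>: "\<eta> \<in> simplex_boundary T"
  shows "dist (F \<theta>) (F \<eta>) \<le> (5 * C + 1) * D * l1_dist T \<theta> \<eta>"
proof -
  have CD: "0 \<le> C * D" using D by simp
  have face': "dist (F \<theta>) (F \<eta>) \<le> C * D * l1_dist T \<theta> \<eta>"
    if "u \<in> T" "\<theta> \<in> std_simplex T" "\<eta> \<in> std_simplex T" "\<theta> u = 0" "\<eta> u = 0" for u \<theta> \<eta>
  proof -
    have "\<theta> \<in> std_simplex (T - {u})" "\<eta> \<in> std_simplex (T - {u})"
      using that T by (auto intro!: std_simplex_subset[OF T])
    from face[OF that(1) this] show ?thesis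
      using l1_dist_mono[OF T, of "T - {u}" \<theta> \<eta>] CD by (meson Diff_subset mult_left_mono order_trans)
  qed
  obtain v w where v: "v \<in> T" "\<theta> v = 0" and w: "w \<in> T" "\<eta> w = 0"
    and s: "\<theta> \<in> std_simplex T" "\<eta> \<in> std_simplex T"
    using \<theta> \<eta> by (auto simp: simplex_boundary_def)
  let ?l = "l1_dist T \<theta> \<eta>"
  consider "\<theta> w = 0" | u where "u \<in> T" "u \<noteq> v" "u \<noteq> w" "\<theta> w \<noteq> 0" | "T = {v, w}" "v \<noteq> w" "\<theta> w \<noteq> 0"
    using v w by blast
  then show ?thesis
  proof cases
    case 1
    then have "dist (F \<theta>) (F \<eta>) \<le> C * D * ?l" using face' w s by blast
    also have "\<dots> \<le> (5 * C + 1) * D * ?l" using D by (intro mult_right_mono) auto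
    finally show ?thesis .
  next
    case 2
    \<comment> \<open>The weight at \<open>w\<close> is moved to a third vertex \<open>u\<close>, so
      that \<open>\<zeta>\<close> lies on the faces opposite \<open>v\<close> and \<open>w\<close>.
      The move costs \<open>2 * \<theta> w\<close>, at most \<open>2 * ?l\<close> as
      \<open>\<eta> w = 0\<close>; the way on to \<open>\<eta>\<close> costs at most
      \<open>3 * ?l\<close>, in all 5.\<close>
    define \<zeta> where "\<zeta> = \<theta>(w := 0, u := \<theta> u + \<theta> w)"
    define R where "R = T - {w, u}"
    have TR: "T = insert w (insert u R)" "w \<notin> insert u R" "u \<notin> R" "finite R" using 2 w T by (auto simp: R_def)
    have R: "x \<noteq> w \<and> x \<noteq> u" if "x \<in> R" for x using that by (auto simp: R_def)
    have nn: "0 \<le> \<theta> x" for x using s(1) by (auto simp: std_simplex_def)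
    have eqR: "sum \<zeta> R = sum \<theta> R" using R by (intro sum.cong) (auto simp: \<zeta>_def)
    have "sum \<zeta> T = sum \<theta> T" using TR 2 eqR by (simp add: \<zeta>_def)
    then have \<zeta>: "\<zeta> \<in> std_simplex T" using s(1) 2 w nn by (auto simp: std_simplex_def \<zeta>_def)
    have z0: "\<zeta> w = 0" "\<zeta> v = 0" using 2 v by (auto simp: \<zeta>_def)
    have "(\<Sum>x\<in>R. \<bar>\<theta> x - \<zeta> x\<bar>) = 0" using R by (intro sum.neutral) (auto simp: \<zeta>_def)
    then have "l1_dist T \<theta> \<zeta> = 2 * \<theta> w" unfolding l1_dist_def using TR 2 nn[of w] by (simp add: \<zeta>_def)
    also have "\<theta> w \<le> ?l" using l1_dist_coord[OF T w(1), of \<theta> \<eta>] w nn[of w] by simp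
    finally have 1: "l1_dist T \<theta> \<zeta> \<le> 2 * ?l" by simp
    then have 2: "l1_dist T \<zeta> \<eta> \<le> 3 * ?l" using l1_dist_triangle[of T \<zeta> \<eta> \<theta>] by (simp add: l1_dist_commute)
    have "dist (F \<theta>) (F \<eta>) \<le> dist (F \<theta>) (F \<zeta>) + dist (F \<zeta>) (F \<eta>)" by (rule dist_triangle)
    also have "\<dots> \<le> C * D * l1_dist T \<theta> \<zeta> + C * D * l1_dist T \<zeta> \<eta>"
      using face'[of v \<theta> \<zeta>] face'[of w \<zeta> \<eta>] v w s \<zeta> z0 by (intro add_mono) auto
    also have "\<dots> \<le> C * D * (2 * ?l) + C * D * (3 * ?l)" using 1 2 CD by (intro add_mono mult_left_mono)
    also have "\<dots> = (5 * C) * D * ?l" by simp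
    also have "\<dots> \<le> (5 * C + 1) * D * ?l" using D by (intro mult_right_mono) auto
    finally show ?thesis .
  next
    case 3
    have "\<theta> \<in> std_simplex {w}" "\<eta> \<in> std_simplex {v}"
      using 3 s v w by (auto intro!: std_simplex_subset[of T])
    then have i: "\<theta> = indicator {w}" "\<eta> = indicator {v}" by (simp_all add: std_simplex_singleton)
    have "1 \<le> ?l" using l1_dist_coord[OF T w(1), of \<theta> \<eta>] 3 by (simp add: i)
    then have "D * 1 \<le> D * ?l" using D by (intro mult_left_mono) auto
    moreover have "dist (F \<theta>) (F \<eta>) \<le> D" using vert[of w v] v w by (simp add: i)
    moreover have "D * ?l \<le> (5 * C + 1) * D * ?l" using D by (intro mult_right_mono) (auto simp: mult_le_cancel_right1)
    ultimately show ?thesis by linarith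
  qed
qed

definition simplicial_complex :: "'w set set \<Rightarrow> bool" where
  "simplicial_complex K \<longleftrightarrow> (\<forall>T\<in>K. finite T \<and> (\<forall>S\<subseteq>T. S \<in> K))"

text \<open>The bound scales with the spread \<open>D\<close> of the vertex values on the simplex at
  hand and says nothing across simplices: those of a Whitney nerve have no common scale.
  \<open>card T \<le> Suc j\<close> means dimension at most \<open>j\<close>.\<close>

definition simplexwise_lipschitz ::
    "real \<Rightarrow> 'w set set \<Rightarrow> nat \<Rightarrow> ('w \<Rightarrow> 'b::metric_space) \<Rightarrow> (('w \<Rightarrow> real) \<Rightarrow> 'b) \<Rightarrow> bool" where
  "simplexwise_lipschitz C K j f F \<longleftrightarrow> (\<forall>w. F (indicator {w}) = f w) \<and>
     (\<forall>T\<in>K. card T \<le> Suc j \<longrightarrow> (\<forall>D\<ge>0. (\<forall>v\<in>T. \<forall>w\<in>T. dist (f v) (f w) \<le> D) \<longrightarrow>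
        (\<forall>\<theta>\<in>std_simplex T. \<forall>\<eta>\<in>std_simplex T. dist (F \<theta>) (F \<eta>) \<le> C * D * l1_dist T \<theta> \<eta>)))"

lemma simplexwise_lipschitzD:
  assumes "simplexwise_lipschitz C K j f F" "T \<in> K" "card T \<le> Suc j" "0 \<le> D"
    "\<And>v w. v \<in> T \<Longrightarrow> w \<in> T \<Longrightarrow> dist (f v) (f w) \<le> D" "\<theta> \<in> std_simplex T" "\<eta> \<in> std_simplex T"
  shows "dist (F \<theta>) (F \<eta>) \<le> C * D * l1_dist T \<theta> \<eta>"
  using assms unfolding simplexwise_lipschitz_def by simp

text \<open>Every simplex with \<open>j + 2\<close> vertices is filled separately from its boundary.
  A point is interior to exactly one simplex, its support, so the fillings fit together, and on
  boundaries they agree with \<open>F\<close>.\<close>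

lemma extend_skeleton:
  fixes f :: "'w \<Rightarrow> 'b::metric_space"
  assumes fill: "\<And>L (f :: (nat \<Rightarrow> real) \<Rightarrow> 'b). 0 \<le> L \<Longrightarrow> lipschitz_from_eucl j L (unit_sphere j) f \<Longrightarrow>
      \<exists>F. lipschitz_from_eucl j (\<gamma> * L) (unit_ball j) F \<and> (\<forall>x\<in>unit_sphere j. F x = f x)"
    and \<gamma>: "0 \<le> \<gamma>" and K: "simplicial_complex K" and C: "0 \<le> C" and F: "simplexwise_lipschitz C K j f F"
  shows "\<exists>F'. simplexwise_lipschitz (C + 6 * \<gamma> * real (j + 2) ^ 6 * (5 * C + 1)) K (Suc j) f F'"
proof -
  define c where "c = 6 * \<gamma> * real (j + 2) ^ 6"
  have c: "0 \<le> c" using \<gamma> by (simp add: c_def)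
  \<comment> \<open>One filling has to serve every admissible \<open>D\<close> at once, so it is
    made for the least of them, the largest distance between vertex values.\<close>
  define \<delta> where "\<delta> T = Max ((\<lambda>(v, w). dist (f v) (f w)) ` (T \<times> T))" for T
  define P where "P T G \<longleftrightarrow> (\<forall>\<theta>\<in>simplex_boundary T. G \<theta> = F \<theta>) \<and>
     (\<forall>\<theta>\<in>std_simplex T. \<forall>\<eta>\<in>std_simplex T. dist (G \<theta>) (G \<eta>) \<le> c * ((5 * C + 1) * \<delta> T) * l1_dist T \<theta> \<eta>)" for T G
  have fin: "finite T" if "T \<in> K" for T using K that by (simp add: simplicial_complex_def)
  have \<delta>: "dist (f v) (f w) \<le> \<delta> T" if "T \<in> K" "v \<in> T" "w \<in> T" for T v w
    unfolding \<delta>_def using fin[OF that(1)] that by (intro Max_ge) auto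
  have \<delta>_le: "\<delta> T \<le> D" if "T \<in> K" "T \<noteq> {}" "\<And>v w. v \<in> T \<Longrightarrow> w \<in> T \<Longrightarrow> dist (f v) (f w) \<le> D" for T D
    unfolding \<delta>_def using fin[OF that(1)] that by (subst Max_le_iff) auto
  have \<delta>_nonneg: "0 \<le> \<delta> T" if "T \<in> K" "T \<noteq> {}" for T
  proof -
    obtain v where "v \<in> T" using \<open>T \<noteq> {}\<close> by blast
    then show ?thesis using \<delta>[OF \<open>T \<in> K\<close>, of v v] by simp
  qed
  have ex: "\<exists>G. P T G" if T: "T \<in> K" "card T = j + 2" for T
  proof -
    have ne: "T \<noteq> {}" using T by auto
    show ?thesis unfolding P_def c_def
    proof (rule simplex_filling[OF fill \<gamma> fin[OF T(1)] T(2)])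
      show "0 \<le> (5 * C + 1) * \<delta> T" using C \<delta>_nonneg[OF T(1) ne] by simp
      fix \<theta> \<eta> assume "\<theta> \<in> simplex_boundary T" "\<eta> \<in> simplex_boundary T"
      then show "dist (F \<theta>) (F \<eta>) \<le> (5 * C + 1) * \<delta> T * l1_dist T \<theta> \<eta>"
      proof (rule simplex_boundary_lipschitz[OF fin[OF T(1)] \<delta>_nonneg[OF T(1) ne] C, rotated -2])
        show "dist (F (indicator {v})) (F (indicator {w})) \<le> \<delta> T" if "v \<in> T" "w \<in> T" for v w
          using F \<delta>[OF T(1) that] by (simp add: simplexwise_lipschitz_def)
        fix u \<theta> \<eta> assume u: "u \<in> T" "\<theta> \<in> std_simplex (T - {u})" "\<eta> \<in> std_simplex (T - {u})"
        show "dist (F \<theta>) (F \<eta>) \<le> C * \<delta> T * l1_dist (T - {u}) \<theta> \<eta>"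
        proof (rule simplexwise_lipschitzD[OF F _ _ _ _ u(2,3)])
          show "T - {u} \<in> K" using K T(1) by (auto simp: simplicial_complex_def)
          show "card (T - {u}) \<le> Suc j" using u(1) T(2) by simp
        qed (use \<delta>[OF T(1)] \<delta>_nonneg[OF T(1) ne] in auto)
      qed
    qed
  qed
  define G where "G T = (SOME G. P T G)" for T
  have G: "P T (G T)" if "T \<in> K" "card T = j + 2" for T
    unfolding G_def using ex[OF that] by (rule someI_ex)
  define supp where "supp \<theta> = {w. \<theta> w \<noteq> 0}" for \<theta> :: "'w \<Rightarrow> real"
  define F' where "F' \<theta> = (if supp \<theta> \<in> K \<and> card (supp \<theta>) = j + 2 then G (supp \<theta>) \<theta> else F \<theta>)" for \<theta>
  have small: "F' \<theta> = F \<theta>" if "\<theta> \<in> std_simplex T" "T \<in> K" "card T \<le> Suc j" for \<theta> T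
  proof -
    have "supp \<theta> \<subseteq> T" using that by (auto simp: supp_def std_simplex_def)
    then have "card (supp \<theta>) \<le> Suc j" using card_mono[OF fin[OF that(2)]] that(3) order_trans by blast
    then show ?thesis by (simp add: F'_def)
  qed
  have big: "F' \<theta> = G T \<theta>" if \<theta>: "\<theta> \<in> std_simplex T" and T: "T \<in> K" "card T = j + 2" for \<theta> T
  proof (cases "supp \<theta> = T")
    case True
    then show ?thesis using T by (simp add: F'_def)
  next
    case False
    have "supp \<theta> \<subseteq> T" using \<theta> by (auto simp: supp_def std_simplex_def)
    then have sub: "supp \<theta> \<subset> T" using False by blast
    then have "card (supp \<theta>) < j + 2" using psubset_card_mono[OF fin[OF T(1)] sub] T(2) by simp
    then have "F' \<theta> = F \<theta>" by (simp add: F'_def)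
    moreover have "\<theta> \<in> simplex_boundary T" using sub \<theta> by (auto simp: supp_def simplex_boundary_def)
    ultimately show ?thesis using G[OF T] by (simp add: P_def)
  qed
  have "simplexwise_lipschitz (C + c * (5 * C + 1)) K (Suc j) f F'"
    unfolding simplexwise_lipschitz_def
  proof (intro conjI allI ballI impI)
    fix w
    have "supp (indicator {w}) = {w}" by (auto simp: supp_def indicator_def)
    then show "F' (indicator {w}) = f w" using F by (simp add: F'_def simplexwise_lipschitz_def)
  next
    fix T D \<theta> \<eta> assume T: "T \<in> K" "card T \<le> Suc (Suc j)" and D: "0 \<le> D" "\<forall>v\<in>T. \<forall>w\<in>T. dist (f v) (f w) \<le> D"
      and \<theta>: "\<theta> \<in> std_simplex T" "\<eta> \<in> std_simplex T"
    show "dist (F' \<theta>) (F' \<eta>) \<le> (C + c * (5 * C + 1)) * D * l1_dist T \<theta> \<eta>"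
    proof (cases "card T \<le> Suc j")
      case True
      have "dist (F \<theta>) (F \<eta>) \<le> C * D * l1_dist T \<theta> \<eta>"
        using D by (intro simplexwise_lipschitzD[OF F T(1) True _ _ \<theta>]) auto
      also have "\<dots> \<le> (C + c * (5 * C + 1)) * D * l1_dist T \<theta> \<eta>"
        using D C c by (intro mult_right_mono) auto
      finally show ?thesis using small[OF _ T(1) True] \<theta> by simp
    next
      case False
      then have card: "card T = j + 2" using T by simp
      then have ne: "T \<noteq> {}" by auto
      have "dist (G T \<theta>) (G T \<eta>) \<le> c * ((5 * C + 1) * \<delta> T) * l1_dist T \<theta> \<eta>"
        using G[OF T(1) card] \<theta> by (simp add: P_def)
      also have "\<dots> \<le> c * ((5 * C + 1) * D) * l1_dist T \<theta> \<eta>"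
        using D C c \<delta>_le[OF T(1) ne, of D] by (intro mult_right_mono mult_left_mono) auto
      also have "\<dots> = (c * (5 * C + 1)) * D * l1_dist T \<theta> \<eta>" by (simp only: mult.assoc)
      also have "\<dots> \<le> (C + c * (5 * C + 1)) * D * l1_dist T \<theta> \<eta>"
        using D C by (intro mult_right_mono) auto
      finally show ?thesis using big[OF _ T(1) card] \<theta> by simp
    qed
  qed
  then show ?thesis unfolding c_def by blast
qed

text \<open>Filling spheres of dimension \<open>j\<close> yields the skeleton of dimension
  \<open>j + 1\<close>, so connectedness up to \<open>m\<close> reaches dimension
  \<open>m + 1\<close>. \<open>C\<close> is fixed before \<open>K\<close> and \<open>f\<close>,
  hence uniform in them.\<close>

lemma skeleton_map:
  assumes conn: "lipschitz_connected TYPE('b::metric_space) m" and "j \<le> Suc m"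
  shows "\<exists>C\<ge>0. \<forall>(K :: 'w set set) (f :: 'w \<Rightarrow> 'b). simplicial_complex K \<longrightarrow> (\<exists>F. simplexwise_lipschitz C K j f F)"
  using assms(2)
proof (induction j)
  case 0
  show ?case
  proof (intro exI[of _ 0] conjI allI impI)
    fix K :: "'w set set" and f :: "'w \<Rightarrow> 'b" assume K: "simplicial_complex K"
    define F where "F \<theta> = f (SOME w. \<theta> = indicator {w})" for \<theta> :: "'w \<Rightarrow> real"
    have ind: "indicator {v} = (indicator {w} :: 'w \<Rightarrow> real) \<longleftrightarrow> v = w" for v w
      by (auto simp: fun_eq_iff indicator_def split: if_splits)
    have "simplexwise_lipschitz 0 K 0 f F"
      unfolding simplexwise_lipschitz_def
    proof (intro conjI allI ballI impI)
      show "F (indicator {w}) = f w" for w by (simp add: F_def ind)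
      fix T D \<theta> \<eta> assume T: "T \<in> K" "card T \<le> Suc 0" and \<theta>: "\<theta> \<in> std_simplex T" "\<eta> \<in> std_simplex T"
      have "T \<noteq> {}" using \<theta> by (auto simp: std_simplex_def)
      moreover have "finite T" using K T by (simp add: simplicial_complex_def)
      ultimately have "card T = 1" using T(2) by (simp add: le_Suc_eq)
      then obtain w where "T = {w}" by (rule card_1_singletonE)
      then show "dist (F \<theta>) (F \<eta>) \<le> 0 * D * l1_dist T \<theta> \<eta>" using \<theta> by (simp add: std_simplex_singleton)
    qed
    then show "\<exists>F. simplexwise_lipschitz 0 K 0 f F" by blast
  qed simp
next
  case (Suc j)
  obtain C where C: "0 \<le> C" "\<And>(K :: 'w set set) (f :: 'w \<Rightarrow> 'b). simplicial_complex K \<Longrightarrow> \<exists>F. simplexwise_lipschitz C K j f F"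
    using Suc by auto
  obtain \<gamma> where \<gamma>: "1 \<le> \<gamma>" and fill: "\<forall>k\<le>m. \<forall>L (f :: (nat \<Rightarrow> real) \<Rightarrow> 'b). 0 \<le> L \<longrightarrow>
      lipschitz_from_eucl k L (unit_sphere k) f \<longrightarrow>
      (\<exists>F. lipschitz_from_eucl k (\<gamma> * L) (unit_ball k) F \<and> (\<forall>x\<in>unit_sphere k. F x = f x))"
    using conn unfolding lipschitz_connected_def by (elim exE conjE)
  have j: "j \<le> m" using Suc.prems by simp
  show ?case
  proof (intro exI[of _ "C + 6 * \<gamma> * real (j + 2) ^ 6 * (5 * C + 1)"] conjI allI impI)
    show "0 \<le> C + 6 * \<gamma> * real (j + 2) ^ 6 * (5 * C + 1)" using C \<gamma> by simp
    fix K :: "'w set set" and f :: "'w \<Rightarrow> 'b" assume K: "simplicial_complex K"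
    obtain F where "simplexwise_lipschitz C K j f F" using C(2)[OF K] by blast
    then show "\<exists>F. simplexwise_lipschitz (C + 6 * \<gamma> * real (j + 2) ^ 6 * (5 * C + 1)) K (Suc j) f F"
      using fill[rule_format, OF j] \<gamma> C(1) K by (intro extend_skeleton) auto
  qed
qed

section \<open>The Lipschitz extension theorem\<close>

text \<open>Only \<open>sum p T\<close> survives in the denominator: in the second term of the
  splitting the weights \<open>q w\<close> sum up to cancel the factor
  \<open>1 / sum q T\<close>.\<close>

lemma l1_dist_normalize:
  fixes p q :: "'w \<Rightarrow> real"
  assumes T: "finite T" and q: "\<And>w. w \<in> T \<Longrightarrow> 0 \<le> q w" and P: "0 < sum p T" and Q: "0 < sum q T"
  shows "l1_dist T (\<lambda>w. p w / sum p T) (\<lambda>w. q w / sum q T) \<le> 2 * l1_dist T p q / sum p T"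
proof -
  let ?P = "sum p T" and ?Q = "sum q T"
  have "\<bar>p w / ?P - q w / ?Q\<bar> \<le> \<bar>p w - q w\<bar> / ?P + q w * (\<bar>?Q - ?P\<bar> / (?P * ?Q))" if "w \<in> T" for w
  proof -
    have "p w / ?P - q w / ?Q = (p w - q w) / ?P + q w * ((?Q - ?P) / (?P * ?Q))"
      using P Q by (simp add: field_simps)
    also have "\<bar>\<dots>\<bar> \<le> \<bar>(p w - q w) / ?P\<bar> + \<bar>q w * ((?Q - ?P) / (?P * ?Q))\<bar>" by (rule abs_triangle_ineq)
    also have "\<dots> = \<bar>p w - q w\<bar> / ?P + q w * (\<bar>?Q - ?P\<bar> / (?P * ?Q))"
      using P Q q[OF that] by (simp add: abs_mult)
    finally show ?thesis .
  qed
  then have "l1_dist T (\<lambda>w. p w / ?P) (\<lambda>w. q w / ?Q) \<le> (\<Sum>w\<in>T. \<bar>p w - q w\<bar> / ?P + q w * (\<bar>?Q - ?P\<bar> / (?P * ?Q)))"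
    unfolding l1_dist_def by (rule sum_mono)
  also have "\<dots> = l1_dist T p q / ?P + \<bar>?Q - ?P\<bar> / ?P"
    using Q by (simp add: sum.distrib l1_dist_def sum_divide_distrib[symmetric] sum_distrib_right[symmetric])
  also have "\<bar>?Q - ?P\<bar> \<le> l1_dist T p q"
    unfolding l1_dist_def sum_subtractf[symmetric] by (rule order_trans[OF sum_abs]) (simp add: abs_minus_commute)
  finally show ?thesis using P by (simp add: divide_right_mono add_divide_distrib[symmetric])
qed

lemma l1_dist_simplex_le:
  assumes "finite T" "\<theta> \<in> std_simplex T" "\<eta> \<in> std_simplex T" shows "l1_dist T \<theta> \<eta> \<le> 2"
proof -
  have "l1_dist T \<theta> \<eta> \<le> (\<Sum>w\<in>T. \<theta> w + \<eta> w)"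
    unfolding l1_dist_def using assms by (intro sum_mono) (simp add: std_simplex_def abs_le_iff)
  then show ?thesis using assms by (simp add: sum.distrib std_simplex_def)
qed

text \<open>The vertices of the nerve are the members of the cover; \<open>F\<close> extends the vertex map
  \<open>W \<mapsto> f (base W)\<close> to the nerve, where \<open>base W\<close> is a point of \<open>Z\<close> near \<open>W\<close>. A simplex is any set of
  cover members inside one \<open>star x\<close>, which is wide enough to contain the supports of \<open>\<theta> y\<close> for all
  \<open>y\<close> near \<open>x\<close>.\<close>

locale whitney_nerve =
  fixes Z :: "'a::metric_space set" and f :: "'a \<Rightarrow> 'b::metric_space" and L :: real
    and \<W> :: "nat \<Rightarrow> 'a set set" and n :: nat and a \<beta> C :: real
  assumes Z: "closed Z" "Z \<noteq> {}" and L: "0 \<le> L"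
    and f: "\<And>x y. x \<in> Z \<Longrightarrow> y \<in> Z \<Longrightarrow> dist (f x) (f y) \<le> L * dist x y"
    and a: "0 < a" "a \<le> 1" and \<beta>: "0 \<le> \<beta>" and C: "0 \<le> C"
    and cover: "(\<Union>k\<le>n. \<Union>(\<W> k)) = - Z"
    and sep: "\<And>k. rel_separated Z a (\<W> k)" and bdd: "\<And>k. rel_bounded Z \<beta> (\<W> k)"
    and skeleton: "\<And>(K :: 'a set set set) (g :: 'a set \<Rightarrow> 'b). simplicial_complex K \<Longrightarrow>
        \<exists>F. simplexwise_lipschitz C K n g F"
begin

abbreviation "d x \<equiv> infdist x Z"

text \<open>With \<open>a / 8\<close>, two sets that both come within
  \<open>2 * \<epsilon> * d x\<close> of \<open>x\<close> are closer than
  \<open>a / 2 * d x\<close>, whereas the separation of one colour is at least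
  \<open>3 / 4 * a * d x\<close> there.\<close>

definition "\<epsilon> = a / 8"

lemma \<epsilon>: "0 < \<epsilon>" "\<epsilon> \<le> 1 / 8" using a by (auto simp: \<epsilon>_def)

definition "\<A> = (\<Union>k\<le>n. \<W> k) - {{}}"

lemma d_pos: "0 < d x \<longleftrightarrow> x \<notin> Z"
  using in_closed_iff_infdist_zero[OF Z, of x] infdist_nonneg[of x Z] by auto

lemma d_le: "z \<in> Z \<Longrightarrow> d x \<le> dist x z" by (rule infdist_le)

lemma d_triangle: "d x \<le> d y + dist x y" by (rule infdist_triangle)

lemma \<A>_outside: "W \<in> \<A> \<Longrightarrow> x \<in> W \<Longrightarrow> 0 < d x" unfolding d_pos using cover by (auto simp: \<A>_def)

lemma \<A>_cover: assumes "x \<notin> Z" obtains W where "W \<in> \<A>" "x \<in> W"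
proof -
  have "x \<in> (\<Union>k\<le>n. \<Union>(\<W> k))" using assms unfolding cover by simp
  then show ?thesis using that by (auto simp: \<A>_def)
qed

lemma \<A>_bounded: "W \<in> \<A> \<Longrightarrow> x \<in> W \<Longrightarrow> y \<in> W \<Longrightarrow> dist x y \<le> \<beta> * d x"
  using rel_boundedD[OF bdd] by (auto simp: \<A>_def)

definition "star x = {W\<in>\<A>. \<exists>y\<in>W. dist x y < 2 * \<epsilon> * d x}"

text \<open>At most one member of each colour comes that close to \<open>x\<close>; this is where
  the bound \<open>n\<close> on the dimension of the nerve comes from.\<close>

lemma star_card: assumes x: "x \<notin> Z" shows "finite (star x)" "card (star x) \<le> Suc n"
proof -
  have dx: "0 < d x" using x d_pos by blast
  have "\<exists>k. k \<le> n \<and> W \<in> \<W> k" if "W \<in> star x" for W using that by (auto simp: star_def \<A>_def)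
  then obtain \<kappa> where \<kappa>: "\<And>W. W \<in> star x \<Longrightarrow> \<kappa> W \<le> n \<and> W \<in> \<W> (\<kappa> W)" by metis
  have inj: "inj_on \<kappa> (star x)"
  proof (rule inj_onI, rule ccontr)
    fix V W assume VW: "V \<in> star x" "W \<in> star x" "\<kappa> V = \<kappa> W" "V \<noteq> W"
    then obtain y z where yz: "y \<in> V" "dist x y < 2 * \<epsilon> * d x" "z \<in> W" "dist x z < 2 * \<epsilon> * d x"
      by (auto simp: star_def)
    have "V \<in> \<W> (\<kappa> V)" "W \<in> \<W> (\<kappa> V)" using \<kappa>[OF VW(1)] \<kappa>[OF VW(2)] VW(3) by simp_all
    then have 1: "a * d y \<le> dist y z" using rel_separatedD[OF sep _ _ VW(4) yz(1,3)] by blast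
    have "\<epsilon> * d x \<le> 1 / 8 * d x" using \<epsilon> dx by (intro mult_right_mono) auto
    then have "3 / 4 * d x \<le> d y" using yz(2) d_triangle[of x y] by linarith
    then have "a * (3 / 4 * d x) \<le> a * d y" using a by (intro mult_left_mono) auto
    moreover have "dist y z < 4 * (\<epsilon> * d x)" using yz dist_triangle[of y z x] by (simp add: dist_commute)
    moreover have "0 < a * d x" using a dx by simp
    ultimately show False using 1 by (simp add: \<epsilon>_def)
  qed
  have sub: "\<kappa> ` star x \<subseteq> {..n}" using \<kappa> by auto
  then show "finite (star x)" using inj finite_imageD finite_subset by blast
  show "card (star x) \<le> Suc n" using card_inj_on_le[OF inj sub] by simp
qed

text \<open>The factor 2 is slack for a distance to \<open>Z\<close> that need not be
  attained.\<close>

definition "base W = (SOME z. z \<in> Z \<and> (\<exists>w\<in>W. dist w z \<le> 2 * d w))"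

lemma base: assumes "W \<in> \<A>" shows "base W \<in> Z" "\<exists>w\<in>W. dist w (base W) \<le> 2 * d w"
proof -
  obtain w where w: "w \<in> W" using assms by (auto simp: \<A>_def)
  have "d w < 2 * d w" using \<A>_outside[OF assms w] by simp
  then obtain z where "z \<in> Z" "dist w z < 2 * d w" using infdist_lessD Z by blast
  then have "\<exists>z. z \<in> Z \<and> (\<exists>w\<in>W. dist w z \<le> 2 * d w)" using w less_imp_le by blast
  from someI_ex[OF this] show "base W \<in> Z" "\<exists>w\<in>W. dist w (base W) \<le> 2 * d w" by (auto simp: base_def)
qed

definition "c1 = 3 + 4 * \<beta>"

lemma c1: "3 \<le> c1" using \<beta> by (simp add: c1_def)

text \<open>The way from \<open>x\<close> through \<open>y\<close> and \<open>w\<close> to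
  \<open>base W\<close> costs at most \<open>1/4 + 5/4 * \<beta> + 5/2 + 5/2 * \<beta>\<close> times
  \<open>d x\<close>, which \<open>c1\<close> rounds up.\<close>

lemma base_near: assumes W: "W \<in> star x" shows "dist x (base W) \<le> c1 * d x"
proof -
  have WA: "W \<in> \<A>" using W by (simp add: star_def)
  obtain y where y: "y \<in> W" "dist x y < 2 * \<epsilon> * d x" using W by (auto simp: star_def)
  obtain w where w: "w \<in> W" "dist w (base W) \<le> 2 * d w" using base(2)[OF WA] by blast
  have "\<epsilon> * d x \<le> 1 / 8 * d x" using \<epsilon> infdist_nonneg by (intro mult_right_mono) auto
  then have xy: "dist x y \<le> d x / 4" using y by simp
  then have dy: "d y \<le> 5 / 4 * d x" using d_triangle[of y x] by (simp add: dist_commute)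
  have yw: "dist y w \<le> \<beta> * d y" using \<A>_bounded[OF WA y(1) w(1)] .
  also have "\<dots> \<le> \<beta> * (5 / 4 * d x)" using dy \<beta> by (rule mult_left_mono)
  finally have yw: "dist y w \<le> 5 / 4 * (\<beta> * d x)" by simp
  have "d w \<le> d y + dist y w" using d_triangle[of w y] by (simp add: dist_commute)
  then have "dist w (base W) \<le> 5 / 2 * d x + 5 / 2 * (\<beta> * d x)" using w dy yw by simp
  moreover have "dist x (base W) \<le> dist x y + dist y w + dist w (base W)"
    using dist_triangle[of x "base W" y] dist_triangle[of y "base W" w] by linarith
  moreover have "0 \<le> \<beta> * d x" using \<beta> infdist_nonneg by (rule mult_nonneg_nonneg)
  moreover have "c1 * d x = 3 * d x + 4 * (\<beta> * d x)" by (simp add: c1_def algebra_simps)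
  ultimately show ?thesis using xy yw infdist_nonneg[of x Z] by linarith
qed

definition "nerve = {T. \<exists>x. x \<notin> Z \<and> T \<subseteq> star x}"

lemma nerve: "simplicial_complex nerve"
  unfolding simplicial_complex_def nerve_def using star_card(1) by (auto intro: finite_subset)

definition "F = (SOME F. simplexwise_lipschitz C nerve n (\<lambda>W. f (base W)) F)"

lemma F: "simplexwise_lipschitz C nerve n (\<lambda>W. f (base W)) F"
  unfolding F_def by (rule someI_ex[OF skeleton[OF nerve]])

text \<open>Points of \<open>Z\<close> near \<open>x\<close> are spread by at most
  \<open>2 * c1 * d x\<close>, and so are the vertex values up to the factor \<open>L\<close>. This
  \<open>d x\<close> later cancels the \<open>1 / d x\<close> in
  \<open>\<theta>_near\<close>.\<close>

lemma F_star:
  assumes x: "x \<notin> Z" and \<theta>: "\<theta> \<in> std_simplex (star x)" "\<eta> \<in> std_simplex (star x)"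
  shows "dist (F \<theta>) (F \<eta>) \<le> C * (2 * c1 * L * d x) * l1_dist (star x) \<theta> \<eta>"
proof (rule simplexwise_lipschitzD[OF F _ star_card(2)[OF x] _ _ \<theta>])
  show "star x \<in> nerve" using x by (auto simp: nerve_def)
  show "0 \<le> 2 * c1 * L * d x" using c1 L infdist_nonneg[of x Z] by simp
  fix V W assume VW: "V \<in> star x" "W \<in> star x"
  have "dist (base V) (base W) \<le> 2 * (c1 * d x)"
    using base_near[OF VW(1)] base_near[OF VW(2)] dist_triangle[of "base V" "base W" x] by (simp add: dist_commute)
  then have "L * dist (base V) (base W) \<le> L * (2 * (c1 * d x))" using L by (rule mult_left_mono)
  moreover have "base V \<in> Z" "base W \<in> Z" using VW base(1) by (auto simp: star_def)
  then have "dist (f (base V)) (f (base W)) \<le> L * dist (base V) (base W)" by (rule f)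
  ultimately show "dist (f (base V)) (f (base W)) \<le> 2 * c1 * L * d x" by (simp add: mult_ac)
qed

definition "\<phi> W x = max 0 (\<epsilon> * d x - infdist x W)"

lemma \<phi>_nonneg [simp]: "0 \<le> \<phi> W x" by (simp add: \<phi>_def)

lemma \<phi>_lipschitz: "\<bar>\<phi> W x - \<phi> W y\<bar> \<le> 2 * dist x y"
proof -
  have "\<bar>\<epsilon> * d x - \<epsilon> * d y\<bar> = \<epsilon> * \<bar>d x - d y\<bar>" using \<epsilon> by (simp add: abs_mult right_diff_distrib[symmetric])
  also have "\<dots> \<le> 1 * dist x y" using \<epsilon> infdist_triangle_abs[of x Z y] by (intro mult_mono) auto
  finally have "\<bar>\<epsilon> * d x - \<epsilon> * d y\<bar> \<le> dist x y" by simp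
  moreover have "\<bar>max 0 p - max 0 q\<bar> \<le> \<bar>p - q\<bar>" for p q :: real by (simp add: max_def)
  ultimately show ?thesis
    using infdist_triangle_abs[of x W y] unfolding \<phi>_def by (smt (verit))
qed

lemma \<phi>_pos: assumes "W \<in> \<A>" "0 < \<phi> W x" obtains y where "y \<in> W" "dist x y < \<epsilon> * d x"
proof -
  have "infdist x W < \<epsilon> * d x" "W \<noteq> {}" using assms by (auto simp: \<phi>_def \<A>_def)
  then show ?thesis using infdist_lessD that by blast
qed

definition "\<Phi> x = (\<Sum>W\<in>star x. \<phi> W x)"

definition "\<theta> x W = (if W \<in> star x then \<phi> W x / \<Phi> x else 0)"

lemma \<phi>_outside_star: assumes "x \<notin> Z" "W \<in> \<A>" "W \<notin> star x" shows "\<phi> W x = 0"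
proof (rule ccontr)
  assume "\<phi> W x \<noteq> 0"
  then have "0 < \<phi> W x" using \<phi>_nonneg[of W x] by linarith
  then obtain y where y: "y \<in> W" "dist x y < \<epsilon> * d x" using \<phi>_pos[OF assms(2)] by blast
  have "0 < \<epsilon> * d x" using \<epsilon> d_pos assms(1) by simp
  then have "dist x y < 2 * \<epsilon> * d x" using y by simp
  then show False using y assms by (auto simp: star_def)
qed

lemma \<Phi>_ge: assumes "x \<notin> Z" shows "\<epsilon> * d x \<le> \<Phi> x" "0 < \<Phi> x"
proof -
  have e: "0 < \<epsilon> * d x" using \<epsilon> d_pos assms by simp
  obtain W where W: "W \<in> \<A>" "x \<in> W" using \<A>_cover[OF assms] .
  have eq: "\<phi> W x = \<epsilon> * d x" using W e by (simp add: \<phi>_def)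
  then have "W \<in> star x" using \<phi>_outside_star[OF assms W(1)] e by (metis less_irrefl)
  then have "\<phi> W x \<le> \<Phi> x" unfolding \<Phi>_def using star_card(1)[OF assms] by (intro member_le_sum) auto
  then show "\<epsilon> * d x \<le> \<Phi> x" "0 < \<Phi> x" using eq e by auto
qed

lemma \<theta>_simplex: assumes "x \<notin> Z" shows "\<theta> x \<in> std_simplex (star x)"
proof -
  have "sum (\<theta> x) (star x) = (\<Sum>W\<in>star x. \<phi> W x / \<Phi> x)" by (intro sum.cong) (auto simp: \<theta>_def)
  also have "\<dots> = 1" unfolding sum_divide_distrib[symmetric] using \<Phi>_ge(2)[OF assms] by (simp add: \<Phi>_def)
  finally show ?thesis using \<Phi>_ge(2)[OF assms] by (auto simp: std_simplex_def \<theta>_def)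
qed

text \<open>\<open>\<phi> W\<close> reaches only half as far as membership in a star, so a move by
  \<open>\<epsilon> / 2 * d x\<close> brings in no weight from outside \<open>star x\<close>:
  \<open>1/2 + 17/16 < 2\<close>.\<close>

lemma near_star:
  assumes x: "x \<notin> Z" and y: "y \<notin> Z" and xy: "dist x y \<le> \<epsilon> / 2 * d x" and W: "W \<in> star y" "W \<notin> star x"
  shows "\<phi> W y = 0"
proof (rule ccontr)
  assume "\<phi> W y \<noteq> 0"
  then have "0 < \<phi> W y" using \<phi>_nonneg[of W y] by linarith
  moreover have WA: "W \<in> \<A>" using W by (simp add: star_def)
  ultimately obtain w where w: "w \<in> W" "dist y w < \<epsilon> * d y" using \<phi>_pos by blast
  have dx: "0 < d x" using x d_pos by blast
  have "\<epsilon> / 2 * d x \<le> 1 / 16 * d x" using \<epsilon> dx by (intro mult_right_mono) auto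
  then have "d y \<le> 17 / 16 * d x" using d_triangle[of y x] xy by (simp add: dist_commute)
  then have "\<epsilon> * d y \<le> \<epsilon> * (17 / 16 * d x)" using \<epsilon> by (intro mult_left_mono) auto
  moreover have "0 < \<epsilon> * d x" using \<epsilon> dx by simp
  ultimately have "dist x w < 2 * \<epsilon> * d x" using w xy dist_triangle[of x w y] by simp
  then show False using W w WA by (auto simp: star_def)
qed

text \<open>\<open>star y\<close> may differ from \<open>star x\<close>, but the members of just one
  of them carry no weight at \<open>y\<close>, so both points can be normalised over
  \<open>star x\<close> and compared in one simplex.\<close>

lemma \<theta>_near:
  assumes x: "x \<notin> Z" and y: "y \<notin> Z" and xy: "dist x y \<le> \<epsilon> / 2 * d x"
  shows "\<theta> y \<in> std_simplex (star x)" "l1_dist (star x) (\<theta> x) (\<theta> y) \<le> 4 * real (Suc n) * dist x y / (\<epsilon> * d x)"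
proof -
  note fin = star_card(1)[OF x] star_card(1)[OF y]
  have out: "\<phi> W y = 0" if "W \<in> star x - star y \<union> (star y - star x)" for W
    using that near_star[OF x y xy] \<phi>_outside_star[OF y] by (auto simp: star_def)
  have "\<theta> y \<in> std_simplex (star y \<inter> star x)"
    by (rule std_simplex_subset[OF fin(2) _ \<theta>_simplex[OF y]]) (auto simp: \<theta>_def near_star[OF x y xy])
  then show "\<theta> y \<in> std_simplex (star x)" using std_simplex_mono[OF fin(1)] by blast
  have \<Phi>y: "(\<Sum>W\<in>star x. \<phi> W y) = \<Phi> y"
    unfolding \<Phi>_def using out by (intro sum.mono_neutral_cong fin) auto
  have "l1_dist (star x) (\<theta> x) (\<theta> y)
      = l1_dist (star x) (\<lambda>W. \<phi> W x / (\<Sum>W\<in>star x. \<phi> W x)) (\<lambda>W. \<phi> W y / (\<Sum>W\<in>star x. \<phi> W y))"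
    unfolding l1_dist_def \<Phi>y \<Phi>_def[of x, symmetric] using out by (intro sum.cong) (auto simp: \<theta>_def)
  also have "\<dots> \<le> 2 * l1_dist (star x) (\<lambda>W. \<phi> W x) (\<lambda>W. \<phi> W y) / (\<Sum>W\<in>star x. \<phi> W x)"
    using \<Phi>_ge(2)[OF x] \<Phi>_ge(2)[OF y] unfolding \<Phi>y[symmetric] unfolding \<Phi>_def[of x]
    by (intro l1_dist_normalize fin) auto
  also have "\<dots> = 2 * l1_dist (star x) (\<lambda>W. \<phi> W x) (\<lambda>W. \<phi> W y) / \<Phi> x" by (simp add: \<Phi>_def)
  also have "\<dots> \<le> 2 * (2 * real (Suc n) * dist x y) / (\<epsilon> * d x)"
  proof (intro frac_le mult_left_mono)
    have "l1_dist (star x) (\<lambda>W. \<phi> W x) (\<lambda>W. \<phi> W y) \<le> (\<Sum>W\<in>star x. 2 * dist x y)"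
      unfolding l1_dist_def by (intro sum_mono \<phi>_lipschitz)
    also have "\<dots> = real (card (star x)) * (2 * dist x y)" by simp
    also have "\<dots> \<le> real (Suc n) * (2 * dist x y)" using star_card(2)[OF x] by (intro mult_right_mono) auto
    finally show "l1_dist (star x) (\<lambda>W. \<phi> W x) (\<lambda>W. \<phi> W y) \<le> 2 * real (Suc n) * dist x y" by (simp add: algebra_simps)
  qed (use \<Phi>_ge[OF x] \<epsilon> d_pos x in auto)
  finally show "l1_dist (star x) (\<theta> x) (\<theta> y) \<le> 4 * real (Suc n) * dist x y / (\<epsilon> * d x)" by (simp add: algebra_simps)
qed

definition "ext x = (if x \<in> Z then f x else F (\<theta> x))"

text \<open>A vertex of the simplex links \<open>ext x\<close> to a value of \<open>f\<close> on
  \<open>Z\<close>. The factor 4 is 2 from the spread of the vertex values times 2, a bound for the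
  \<open>l1_dist\<close> diameter of a simplex.\<close>

lemma ext_anchor: "\<exists>z\<in>Z. dist x z \<le> c1 * d x \<and> dist (ext x) (f z) \<le> (4 * C * c1) * (L * d x)"
proof (cases "x \<in> Z")
  case True
  then show ?thesis by (intro bexI[of _ x]) (auto simp: ext_def)
next
  case False
  obtain W where W: "W \<in> \<A>" "x \<in> W" using \<A>_cover[OF False] .
  have "0 < 2 * \<epsilon> * d x" using \<epsilon> d_pos False by simp
  then have Ws: "W \<in> star x" using W by (auto simp: star_def intro!: bexI[of _ x])
  note fin = star_card(1)[OF False]
  have ind: "indicator {W} \<in> std_simplex (star x)"
    using std_simplex_mono[OF fin, of "{W}"] Ws by (auto simp: std_simplex_singleton)
  have "dist (F (\<theta> x)) (F (indicator {W})) \<le> C * (2 * c1 * L * d x) * l1_dist (star x) (\<theta> x) (indicator {W})"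
    by (rule F_star[OF False \<theta>_simplex[OF False] ind])
  also have "\<dots> \<le> C * (2 * c1 * L * d x) * 2"
    using l1_dist_simplex_le[OF fin \<theta>_simplex[OF False] ind] C c1 L infdist_nonneg[of x Z]
    by (intro mult_left_mono) auto
  finally have "dist (ext x) (f (base W)) \<le> (4 * C * c1) * (L * d x)"
    using F False by (simp add: ext_def simplexwise_lipschitz_def mult_ac)
  then show ?thesis using base_near[OF Ws] base(1)[OF W(1)] by blast
qed

definition "ext_const = 8 * C * c1 * real (Suc n) / \<epsilon> + (1 + 4 * c1 / \<epsilon> + 16 * C * c1 / \<epsilon>)"

lemma ext_near:
  assumes x: "x \<notin> Z" and xy: "dist x y \<le> \<epsilon> / 2 * d x"
  shows "dist (ext x) (ext y) \<le> ext_const * L * dist x y"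
proof -
  have dx: "0 < d x" using x d_pos by blast
  have "\<epsilon> / 2 * d x < 1 * d x" using \<epsilon> dx by (intro mult_strict_right_mono) auto
  then have y: "y \<notin> Z" using d_le[of y x] xy by force
  have "dist (ext x) (ext y) \<le> C * (2 * c1 * L * d x) * l1_dist (star x) (\<theta> x) (\<theta> y)"
    using F_star[OF x \<theta>_simplex[OF x] \<theta>_near(1)[OF x y xy]] x y by (simp add: ext_def)
  also have "\<dots> \<le> C * (2 * c1 * L * d x) * (4 * real (Suc n) * dist x y / (\<epsilon> * d x))"
    using \<theta>_near(2)[OF x y xy] C c1 L dx by (intro mult_left_mono) auto
  also have "\<dots> = (8 * C * c1 * real (Suc n) / \<epsilon>) * L * dist x y" using dx \<epsilon> by (simp add: field_simps)
  also have "\<dots> \<le> ext_const * L * dist x y"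
    unfolding ext_const_def using C c1 L \<epsilon> by (intro mult_right_mono) auto
  finally show ?thesis .
qed

text \<open>When the points are far apart relative to their distances to \<open>Z\<close>, their
  anchors in \<open>Z\<close> are at distance at most a constant times \<open>dist x y\<close>, and
  the Lipschitz bound of \<open>f\<close> takes over.\<close>

lemma ext_far:
  assumes "d x \<le> 2 / \<epsilon> * dist x y" "d y \<le> 2 / \<epsilon> * dist x y"
  shows "dist (ext x) (ext y) \<le> ext_const * L * dist x y"
proof -
  obtain z where z: "z \<in> Z" "dist x z \<le> c1 * d x" "dist (ext x) (f z) \<le> (4 * C * c1) * (L * d x)"
    using ext_anchor by blast
  obtain w where w: "w \<in> Z" "dist y w \<le> c1 * d y" "dist (ext y) (f w) \<le> (4 * C * c1) * (L * d y)"
    using ext_anchor by blast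
  define e where "e = 2 / \<epsilon> * dist x y"
  have e: "d x \<le> e" "d y \<le> e" using assms by (simp_all add: e_def)
  have cd: "c1 * d x \<le> c1 * e" "c1 * d y \<le> c1 * e"
    by (intro mult_left_mono e; use c1 in linarith)+
  have Cd: "(4 * C * c1) * (L * d x) \<le> (4 * C * c1) * (L * e)"
    "(4 * C * c1) * (L * d y) \<le> (4 * C * c1) * (L * e)"
    by (intro mult_left_mono e L; use c1 C in simp)+
  have "dist z w \<le> dist x y + 2 * (c1 * e)"
    using z w cd dist_triangle[of z w x] dist_triangle[of x w y] by (simp add: dist_commute)
  then have "L * dist z w \<le> L * (dist x y + 2 * (c1 * e))" using L by (rule mult_left_mono)
  moreover have "dist (f z) (f w) \<le> L * dist z w" using f z w by blast
  moreover have "dist (ext x) (ext y) \<le> dist (ext x) (f z) + dist (f z) (f w) + dist (ext y) (f w)"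
    using dist_triangle[of "ext x" "ext y" "f z"] dist_triangle[of "f z" "ext y" "f w"] by (simp add: dist_commute)
  ultimately have "dist (ext x) (ext y) \<le> L * (dist x y + 2 * (c1 * e)) + 2 * ((4 * C * c1) * (L * e))"
    using z w Cd by linarith
  also have "\<dots> = (1 + 4 * c1 / \<epsilon> + 16 * C * c1 / \<epsilon>) * L * dist x y" by (simp add: e_def algebra_simps)
  also have "\<dots> \<le> ext_const * L * dist x y"
    unfolding ext_const_def using C c1 L \<epsilon> by (intro mult_right_mono) auto
  finally show ?thesis .
qed

lemma ext_lipschitz: "dist (ext x) (ext y) \<le> ext_const * L * dist x y"
proof -
  have big: "d x \<le> 2 / \<epsilon> * dist x y" if "\<not> (x \<notin> Z \<and> dist x y \<le> \<epsilon> / 2 * d x)" for x y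
  proof (cases "x \<in> Z")
    case True
    then show ?thesis using \<epsilon> by simp
  next
    case False
    then have "\<epsilon> * d x \<le> 2 * dist x y" using that by simp
    then show ?thesis using \<epsilon> by (simp add: field_simps)
  qed
  consider "x \<notin> Z" "dist x y \<le> \<epsilon> / 2 * d x" | "y \<notin> Z" "dist y x \<le> \<epsilon> / 2 * d y"
    | "d x \<le> 2 / \<epsilon> * dist x y" "d y \<le> 2 / \<epsilon> * dist y x" using big[of x y] big[of y x] by blast
  then show ?thesis
  proof cases
    case 1
    then show ?thesis by (rule ext_near)
  next
    case 2
    then show ?thesis using ext_near[of y x] by (simp add: dist_commute)
  next
    case 3
    then show ?thesis using ext_far[of x y] by (simp add: dist_commute)
  qed
qed

end

text \<open>The constant precedes \<open>Z\<close>, \<open>f\<close> and \<open>L\<close>, because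
  the closed set and the level \<open>t\<close> vary in the truncation argument.\<close>

theorem lipschitz_extension:
  assumes nag: "nagata_cond TYPE('a::metric_space) n" and n: "1 \<le> n"
    and R: "0 < R" "\<And>x y :: 'a. dist x y < R"
    and conn: "lipschitz_connected TYPE('b::metric_space) (n - 1)"
  shows "\<exists>c\<ge>1. \<forall>(Z :: 'a set) (f :: 'a \<Rightarrow> 'b) L. closed Z \<longrightarrow> Z \<noteq> {} \<longrightarrow> 0 \<le> L \<longrightarrow>
     (\<forall>x\<in>Z. \<forall>y\<in>Z. dist (f x) (f y) \<le> L * dist x y) \<longrightarrow>
     (\<exists>g. (\<forall>x\<in>Z. g x = f x) \<and> (\<forall>x y. dist (g x) (g y) \<le> c * L * dist x y))"
proof -
  obtain a \<beta> where a: "0 < a" "a \<le> 1" "0 \<le> \<beta>" and wh: "\<And>Z :: 'a set. closed Z \<Longrightarrow> Z \<noteq> {} \<Longrightarrow> \<exists>\<W> :: nat \<Rightarrow> 'a set set.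
      (\<Union>k\<le>n. \<Union>(\<W> k)) = - Z \<and> (\<forall>k. rel_separated Z a (\<W> k) \<and> rel_bounded Z \<beta> (\<W> k))"
    by (rule whitney_families[OF nag R]) (rule that)
  \<comment> \<open>Building up an \<open>n\<close>-dimensional nerve takes fillings of spheres of
    dimension up to \<open>n - 1\<close>, which is what \<open>conn\<close> grants.\<close>
  have "n \<le> Suc (n - 1)" using n by simp
  from skeleton_map[OF conn this]
  obtain C where C: "0 \<le> C" and sk: "\<forall>(K :: 'a set set set) (g :: 'a set \<Rightarrow> 'b). simplicial_complex K \<longrightarrow>
      (\<exists>F. simplexwise_lipschitz C K n g F)" by (elim exE conjE)
  \<comment> \<open>This is \<open>ext_const\<close> written out, because \<open>c\<close> has to be
    fixed before the locale is interpreted for a particular \<open>Z\<close>.\<close>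
  define c where "c = 8 * C * (3 + 4 * \<beta>) * real (Suc n) / (a / 8) + (1 + 4 * (3 + 4 * \<beta>) / (a / 8) + 16 * C * (3 + 4 * \<beta>) / (a / 8))"
  show ?thesis
  proof (intro exI[of _ c] conjI allI impI)
    show "1 \<le> c" unfolding c_def using a C by (simp add: add_nonneg_nonneg)
    fix Z :: "'a set" and f :: "'a \<Rightarrow> 'b" and L
    assume Z: "closed Z" "Z \<noteq> {}" and L: "0 \<le> L" and f: "\<forall>x\<in>Z. \<forall>y\<in>Z. dist (f x) (f y) \<le> L * dist x y"
    obtain \<W> :: "nat \<Rightarrow> 'a set set" where \<W>: "(\<Union>k\<le>n. \<Union>(\<W> k)) = - Z"
      "\<forall>k. rel_separated Z a (\<W> k) \<and> rel_bounded Z \<beta> (\<W> k)" using wh[OF Z] by (elim exE conjE)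
    interpret whitney_nerve Z f L \<W> n a \<beta> C
      by unfold_locales (use Z L f a C \<W> sk in auto)
    have "ext_const = c" by (simp add: ext_const_def c_def c1_def \<epsilon>_def)
    then show "\<exists>g. (\<forall>x\<in>Z. g x = f x) \<and> (\<forall>x y. dist (g x) (g y) \<le> c * L * dist x y)"
      using ext_lipschitz by (intro exI[of _ ext]) (simp add: ext_def)
  qed
qed

section \<open>Lipschitz truncation of Sobolev maps\<close>

lemma enn_powr_ennreal [simp]: "0 \<le> r \<Longrightarrow> enn_powr (ennreal r) q = ennreal (r powr q)"
  by (simp add: enn_powr_def)

lemma enn_powr_top [simp]: "enn_powr top q = top" by (simp add: enn_powr_def)

lemma enn_powr_less_top [simp]: "enn_powr x q < top \<longleftrightarrow> x < top"
  by (auto simp: enn_powr_def less_top)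

lemma enn_powr_mono: assumes "x \<le> y" "0 \<le> q" shows "enn_powr x q \<le> enn_powr y q"
proof (cases y)
  case (real r)
  then obtain s where "x = ennreal s" "0 \<le> s" "s \<le> r" using assms(1) by (cases x) (auto simp: top_unique)
  then show ?thesis using real assms(2) by (simp add: powr_mono2 ennreal_leI)
qed (simp add: enn_powr_def)

lemma enn_powr_measurable [measurable]:
  assumes [measurable]: "f \<in> borel_measurable M" shows "(\<lambda>x. enn_powr (f x) q) \<in> borel_measurable M"
  unfolding enn_powr_def by measurable

lemma powr_add_le:
  fixes a b p :: real assumes "0 \<le> a" "0 \<le> b" "0 \<le> p"
  shows "(a + b) powr p \<le> 2 powr p * (a powr p + b powr p)"
proof -
  have "(a + b) powr p \<le> (2 * max a b) powr p" using assms by (intro powr_mono2) auto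
  also have "\<dots> = 2 powr p * max a b powr p" using assms by (simp add: powr_mult)
  also have "\<dots> \<le> 2 powr p * (a powr p + b powr p)" by (intro mult_left_mono) (auto simp: max_def)
  finally show ?thesis .
qed

lemma enn_powr_add_le:
  assumes "0 \<le> p" "0 \<le> b" shows "enn_powr (x + ennreal b) p \<le> ennreal (2 powr p) * (enn_powr x p + ennreal (b powr p))"
proof (cases x)
  case (real a)
  have "enn_powr (x + ennreal b) p = ennreal ((a + b) powr p)" using real assms by (simp flip: ennreal_plus)
  also have "\<dots> \<le> ennreal (2 powr p * (a powr p + b powr p))" using real assms by (intro ennreal_leI powr_add_le)
  finally show ?thesis using real by (simp add: ennreal_mult ennreal_plus)
next
  case top
  then show ?thesis by (simp add: ennreal_mult_top enn_powr_def)
qed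

lemma Lp_norm_le:
  assumes "0 < p" "0 \<le> e" "(\<integral>\<^sup>+x. enn_powr (f x) p \<partial>M) \<le> ennreal (e powr p)"
  shows "Lp_norm M p f \<le> ennreal e"
proof -
  have "Lp_norm M p f \<le> enn_powr (ennreal (e powr p)) (1 / p)"
    unfolding Lp_norm_def using assms by (intro enn_powr_mono) auto
  then show ?thesis using assms by (simp add: powr_powr)
qed

lemma Lp_norm_finite_iff: "Lp_norm M p f < \<infinity> \<longleftrightarrow> (\<integral>\<^sup>+x. enn_powr (f x) p \<partial>M) < \<infinity>"
  by (simp add: Lp_norm_def)

text \<open>Composition with a 1-Lipschitz function keeps upper gradients. For
  \<open>c = lam b\<close> this yields the real functions \<open>dist (u x) b\<close>, to which the
  Poincare inequality applies.\<close>

lemma upper_gradient_dist: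
  assumes "upper_gradient_on UNIV f g"
  shows "upper_gradient_on U (\<lambda>x. norm (f x - c)) g"
  unfolding upper_gradient_on_def
proof (intro conjI allI impI)
  show "g \<in> borel_measurable borel" using assms by (simp add: upper_gradient_on_def)
  fix \<gamma> and a b :: real assume "rectifiable_curve \<gamma> a b U"
  then have "ennreal (norm (f (\<gamma> b) - f (\<gamma> a))) \<le> line_integral g \<gamma> a b"
    using assms by (auto simp: upper_gradient_on_def rectifiable_curve_def)
  moreover have "\<bar>norm (f (\<gamma> b) - c) - norm (f (\<gamma> a) - c)\<bar> \<le> norm (f (\<gamma> b) - f (\<gamma> a))"
    using norm_triangle_ineq3[of "f (\<gamma> b) - c" "f (\<gamma> a) - c"] by simp
  ultimately show "ennreal (norm (norm (f (\<gamma> b) - c) - norm (f (\<gamma> a) - c))) \<le> line_integral g \<gamma> a b"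
    by (simp add: order_trans[OF ennreal_leI])
qed

lemma diameter_ball_le: fixes x :: "'a::metric_space" assumes "0 < r" shows "diameter (ball x r) \<le> 2 * r"
proof -
  have ne: "ball x r \<noteq> {}" using assms by auto
  have "dist y z \<le> 2 * r" if "y \<in> ball x r" "z \<in> ball x r" for y z
    using that dist_triangle[of y z x] by (simp add: dist_commute)
  then show ?thesis unfolding diameter_def using ne by (auto intro!: cSUP_least)
qed

context bounded_doubling
begin

lemma poincare_oscillation:
  fixes u :: "'a \<Rightarrow> real"
  assumes PI: "\<forall>x r (u :: 'a \<Rightarrow> real) g. r > 0 \<longrightarrow> set_integrable M (ball x (\<sigma> * r)) u \<longrightarrow>
        upper_gradient_on (ball x (\<sigma> * r)) u g \<longrightarrow>
        ennreal (ball_avg M (ball x r) (\<lambda>y. \<bar>u y - ball_avg M (ball x r) u\<bar>))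
          \<le> ennreal (CP * diameter (ball x r)) *
             enn_powr ((\<integral>\<^sup>+ y\<in>ball x (\<sigma> * r). enn_powr (g y) p \<partial>M) / emeasure M (ball x (\<sigma> * r))) (1 / p)"
    and CP: "0 < CP" and \<sigma>: "1 \<le> \<sigma>" and p: "1 \<le> p"
    and u: "integrable M u" and g: "upper_gradient_on (ball x (\<sigma> * r)) u g" and r: "0 < r" and t: "0 < t"
    and avg: "(\<integral>\<^sup>+ y\<in>ball x (\<sigma> * r). enn_powr (g y) p \<partial>M) \<le> ennreal (t powr p) * emeasure M (ball x (\<sigma> * r))"
  shows "(LINT y:ball x r|M. \<bar>u y - ball_avg M (ball x r) u\<bar>) \<le> 2 * CP * t * r * measure M (ball x r)"
proof -
  let ?B = "ball x (\<sigma> * r)" and ?A = "LINT y:ball x r|M. \<bar>u y - ball_avg M (ball x r) u\<bar>"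
  have \<mu>: "0 < measure M ?B" "0 < measure M (ball x r)" using r \<sigma> by (auto intro!: measure_ball_pos)
  have "(\<integral>\<^sup>+ y\<in>?B. enn_powr (g y) p \<partial>M) / emeasure M ?B \<le> ennreal (t powr p)"
    using avg \<mu>(1) by (intro divide_le_posI_ennreal) (auto simp: emeasure_eq_measure mult.commute)
  then have "enn_powr ((\<integral>\<^sup>+ y\<in>?B. enn_powr (g y) p \<partial>M) / emeasure M ?B) (1 / p) \<le> enn_powr (ennreal (t powr p)) (1 / p)"
    using p by (intro enn_powr_mono) auto
  also have "\<dots> = ennreal t" using p t by (simp add: powr_powr)
  finally have 1: "enn_powr ((\<integral>\<^sup>+ y\<in>?B. enn_powr (g y) p \<partial>M) / emeasure M ?B) (1 / p) \<le> ennreal t" .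
  have "set_integrable M ?B u" unfolding set_integrable_def using u by (intro integrable_mult_indicator) auto
  then have "ennreal (ball_avg M (ball x r) (\<lambda>y. \<bar>u y - ball_avg M (ball x r) u\<bar>))
     \<le> ennreal (CP * diameter (ball x r)) * enn_powr ((\<integral>\<^sup>+ y\<in>?B. enn_powr (g y) p \<partial>M) / emeasure M ?B) (1 / p)"
    using PI r g by blast
  also have "\<dots> \<le> ennreal (CP * (2 * r)) * ennreal t"
    using diameter_ball_le[OF r, of x] CP by (intro mult_mono 1 ennreal_leI mult_left_mono) auto
  also have "\<dots> = ennreal (CP * (2 * r) * t)" using CP r t by (simp add: ennreal_mult)
  finally have "1 / measure M (ball x r) * ?A \<le> CP * (2 * r) * t"
    using CP r t unfolding ball_avg_def[of M _ "\<lambda>y. \<bar>u y - ball_avg M (ball x r) u\<bar>"] by (subst (asm) ennreal_le_iff) auto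
  then show ?thesis using \<mu>(2) by (simp add: field_simps)
qed

text \<open>Dominated convergence, as \<open>H\<close> is finite almost everywhere; this improves
  the weak-type bound from big O to little o.\<close>

lemma tail_integral_small:
  fixes H :: "'a \<Rightarrow> ennreal"
  assumes H [measurable]: "H \<in> borel_measurable M" and fin: "(\<integral>\<^sup>+x. H x \<partial>M) < \<infinity>" and e: "0 < e"
  shows "\<forall>\<^sub>F j in sequentially. (\<integral>\<^sup>+x. H x * indicator {x. ennreal (real j) < H x} x \<partial>M) < e"
proof -
  have [measurable]: "{x. ennreal (real j) < H x} \<in> sets M" for j
    using measurable_sets[OF H, of "{ennreal (real j)<..}"] by (simp add: vimage_def)
  have "(\<lambda>j. \<integral>\<^sup>+x. H x * indicator {x. ennreal (real j) < H x} x \<partial>M) \<longlonglongrightarrow> (\<integral>\<^sup>+x. 0 \<partial>M)"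
  proof (rule nn_integral_dominated_convergence[where w=H])
    have "AE x in M. H x \<noteq> \<infinity>" using fin by (intro nn_integral_noteq_infinite) auto
    then show "AE x in M. (\<lambda>j. H x * indicator {x. ennreal (real j) < H x} x) \<longlonglongrightarrow> 0"
    proof eventually_elim
      case (elim x)
      then obtain h where h: "H x = ennreal h" "0 \<le> h" by (cases "H x") auto
      have "\<forall>\<^sub>F j in sequentially. H x * indicator {x. ennreal (real j) < H x} x = 0"
        using eventually_ge_at_top[of "nat \<lceil>h\<rceil>"]
      proof eventually_elim
        case (elim j)
        then have "h \<le> real j" by linarith
        then show ?case using h by (simp add: indicator_def ennreal_leI not_less)
      qed
      then show ?case by (rule tendsto_eventually)
    qed
  qed (use fin in \<open>auto simp: indicator_def\<close>)
  then show ?thesis using e by (intro order_tendstoD) auto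
qed

end

context bounded_doubling
begin

lemma lusin_lipschitz:
  fixes u :: "'a \<Rightarrow> 'b::metric_space" and lam :: "'b \<Rightarrow> 'v::banach"
  assumes p: "1 \<le> p" and PI: "supports_poincare M p" and dense: "countable D" "closure D = (UNIV :: 'b set)"
    and iso: "isometric_embedding lam" and meas: "(\<lambda>x. lam (u x)) \<in> borel_measurable M"
    and g: "upper_gradient_on UNIV (\<lambda>x. lam (u x)) g"
    and H_def: "H = (\<lambda>x. enn_powr (g x) p + ennreal (norm (lam (u x)) powr p))"
    and fin: "(\<integral>\<^sup>+x. H x \<partial>M) < \<infinity>"
  shows "\<exists>c\<ge>0. \<forall>\<eta>>0. \<exists>t\<ge>1. \<exists>E. closed E \<and> (\<forall>x\<in>E. \<forall>y\<in>E. dist (u x) (u y) \<le> c * t * dist x y) \<and>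
     (\<forall>x\<in>E. norm (lam (u x)) \<le> t) \<and> t powr p * measure M (- E) \<le> \<eta> \<and>
     (\<integral>\<^sup>+x. H x * indicator (- E) x \<partial>M) \<le> ennreal \<eta>"
proof -
  note [measurable] = meas
  have "g \<in> borel_measurable borel" using g by (simp add: upper_gradient_on_def)
  then have gm [measurable]: "g \<in> borel_measurable M" unfolding measurable_cong_sets[OF sets_M refl] .
  have Hm [measurable]: "H \<in> borel_measurable M" unfolding H_def by measurable
  have isoD: "norm (lam y - lam z) = dist y z" for y z using iso by (simp add: isometric_embedding_def)
  obtain CP \<sigma> where CP: "0 < CP" and \<sigma>: "1 \<le> \<sigma>" and pc: "\<forall>x r (u :: 'a \<Rightarrow> real) g. r > 0 \<longrightarrow> set_integrable M (ball x (\<sigma> * r)) u \<longrightarrow>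
        upper_gradient_on (ball x (\<sigma> * r)) u g \<longrightarrow>
        ennreal (ball_avg M (ball x r) (\<lambda>y. \<bar>u y - ball_avg M (ball x r) u\<bar>))
          \<le> ennreal (CP * diameter (ball x r)) *
             enn_powr ((\<integral>\<^sup>+ y\<in>ball x (\<sigma> * r). enn_powr (g y) p \<partial>M) / emeasure M (ball x (\<sigma> * r))) (1 / p)"
    using PI unfolding supports_poincare_def by (elim exE conjE)
  define r where "r k = R / 2 ^ k" for k :: nat
  have r_pos: "0 < r k" for k using R_pos by (simp add: r_def)
  have "\<forall>k. \<exists>S. is_net S (r k)" using net_exists r_pos by blast
  then obtain N where N: "\<And>k. is_net (N k) (r k)" by metis
  define B where "B p = ball (fst p) (snd p)" for p :: "'a \<times> real"
  \<comment> \<open>\<open>4 * r k\<close> is the radius at which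
    \<open>lipschitz_off_null_set\<close> wants oscillation bounds; \<open>\<sigma>\<close> enlarges
    it to the ball on the right of the Poincare inequality.\<close>
  define Fam where "Fam = (\<Union>k. (\<lambda>z. (z, \<sigma> * (4 * r k))) ` N k)"
  have "finite (N k)" for k using N by (simp add: is_net_def)
  then have countFam: "countable Fam" unfolding Fam_def by (intro countable_UN) (auto intro: countable_finite)
  define bad where "bad s = {q \<in> Fam. ennreal s * emeasure M (B q) < (\<integral>\<^sup>+x\<in>B q. H x \<partial>M)}" for s
  \<comment> \<open>The level will be \<open>s = t powr p\<close>. Bad balls are removed as a whole,
    so every ball of the family that meets \<open>E s\<close> is good; the condition on the norm
    keeps \<open>lam (u x)\<close> bounded by \<open>t\<close>.\<close>
  define E where "E s = {x. norm (lam (u x)) powr p \<le> s} - (\<Union>q\<in>bad s. B q)" for s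
  have openbad: "open (\<Union>q\<in>bad s. B q)" for s by (auto simp: B_def)
  have Em: "E s \<in> sets M" for s
  proof -
    have "{x \<in> space M. norm (lam (u x)) powr p \<le> s} \<in> sets M" by measurable
    moreover have "(\<Union>q\<in>bad s. B q) \<in> sets M" using openbad[of s] by simp
    ultimately show ?thesis unfolding E_def by (simp add: sets.Diff)
  qed
  define \<tau> where "\<tau> s = (\<integral>\<^sup>+x. H x * indicator {x. ennreal (s / 2) < H x} x \<partial>M)" for s
  have tm [measurable]: "{x. ennreal s < H x} \<in> sets M" for s
    using measurable_sets[OF Hm, of "{ennreal s<..}"] by (simp add: vimage_def)
  have split: "(\<integral>\<^sup>+x\<in>A. H x \<partial>M) \<le> (\<integral>\<^sup>+x\<in>A. H x * indicator {x. ennreal (s / 2) < H x} x \<partial>M) + ennreal (s / 2) * emeasure M A"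
    if A [measurable]: "A \<in> sets M" for A s
  proof -
    have "(\<integral>\<^sup>+x\<in>A. H x \<partial>M) \<le> (\<integral>\<^sup>+x. H x * indicator {x. ennreal (s / 2) < H x} x * indicator A x + ennreal (s / 2) * indicator A x \<partial>M)"
      by (intro nn_integral_mono) (auto simp: indicator_def not_less)
    also have "\<dots> = (\<integral>\<^sup>+x\<in>A. H x * indicator {x. ennreal (s / 2) < H x} x \<partial>M) + (\<integral>\<^sup>+x. ennreal (s / 2) * indicator A x \<partial>M)"
      by (rule nn_integral_add) measurable
    finally show ?thesis unfolding nn_integral_cmult_indicator[OF A] .
  qed
  \<comment> \<open>On a bad ball the part of \<open>H\<close> up to \<open>s / 2\<close>
    contributes at most \<open>s / 2\<close> to the average, so the part above \<open>s / 2\<close>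
    still has average at least \<open>s / 2\<close>.\<close>
  have badset: "ennreal (s / 2) * emeasure M (\<Union>q\<in>bad s. B q) \<le> ennreal (Cd ^ 2) * \<tau> s" if s: "0 < s" for s
    unfolding B_def \<tau>_def
  proof (rule weak_type)
    show "countable (bad s)" using countFam by (rule countable_subset[rotated]) (auto simp: bad_def)
    fix q assume q: "q \<in> bad s"
    let ?X = "\<integral>\<^sup>+x\<in>ball (fst q) (snd q). H x * indicator {x. ennreal (s / 2) < H x} x \<partial>M"
    let ?Y = "ennreal (s / 2) * emeasure M (ball (fst q) (snd q))"
    have "ennreal s = ennreal (s / 2) + ennreal (s / 2)" using s by (simp flip: ennreal_plus)
    then have "?Y + ?Y \<le> (\<integral>\<^sup>+x\<in>ball (fst q) (snd q). H x \<partial>M)"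
      using q by (simp add: bad_def B_def distrib_right[symmetric] less_imp_le)
    also have "\<dots> \<le> ?X + ?Y" by (rule split) simp
    finally have "?Y + ?Y \<le> ?Y + ?X" by (simp only: add.commute)
    moreover have "?Y < top" by (simp add: ennreal_mult_less_top emeasure_eq_measure)
    ultimately show "?Y \<le> ?X" by (auto simp: ennreal_add_left_cancel_le)
  qed measurable
  have levelm: "{x. s < norm (lam (u x)) powr p} \<in> sets M" for s
  proof -
    have "{x \<in> space M. s < norm (lam (u x)) powr p} \<in> sets M" by measurable
    then show ?thesis by simp
  qed
  have level: "ennreal s * emeasure M {x. s < norm (lam (u x)) powr p} \<le> \<tau> s" if s: "0 < s" for s
  proof -
    have "ennreal s * emeasure M {x. s < norm (lam (u x)) powr p} = (\<integral>\<^sup>+x. ennreal s * indicator {x. s < norm (lam (u x)) powr p} x \<partial>M)"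
      by (rule nn_integral_cmult_indicator[OF levelm, symmetric])
    also have "\<dots> \<le> \<tau> s" unfolding \<tau>_def
    proof (rule nn_integral_mono)
      fix x
      show "ennreal s * indicator {x. s < norm (lam (u x)) powr p} x \<le> H x * indicator {x. ennreal (s / 2) < H x} x"
      proof (cases "s < norm (lam (u x)) powr p")
        case True
        then have "ennreal s \<le> ennreal (norm (lam (u x)) powr p)" by (intro ennreal_leI) simp
        then have 1: "ennreal s \<le> H x" unfolding H_def by (rule order_trans) simp
        have "ennreal (s / 2) < ennreal s" using s by (simp add: ennreal_less_iff)
        then have "ennreal (s / 2) < H x" using 1 by (rule less_le_trans)
        then show ?thesis using 1 by (simp add: indicator_def)
      qed simp
    qed
    finally show ?thesis .
  qed
  have Ecompl: "ennreal s * emeasure M (- E s) \<le> ennreal (2 * Cd ^ 2 + 1) * \<tau> s" if s: "0 < s" for s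
  proof -
    have "- E s = {x. s < norm (lam (u x)) powr p} \<union> (\<Union>q\<in>bad s. B q)" by (auto simp: E_def)
    then have "emeasure M (- E s) \<le> emeasure M {x. s < norm (lam (u x)) powr p} + emeasure M (\<Union>q\<in>bad s. B q)"
      using openbad[of s] levelm[of s] by (simp add: emeasure_subadditive)
    then have "ennreal s * emeasure M (- E s) \<le> ennreal s * (emeasure M {x. s < norm (lam (u x)) powr p} + emeasure M (\<Union>q\<in>bad s. B q))"
      by (rule mult_left_mono) simp
    also have "\<dots> = ennreal s * emeasure M {x. s < norm (lam (u x)) powr p} + ennreal s * emeasure M (\<Union>q\<in>bad s. B q)"
      by (rule distrib_left)
    also have "\<dots> \<le> \<tau> s + (ennreal (Cd ^ 2) * \<tau> s + ennreal (Cd ^ 2) * \<tau> s)"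
    proof (rule add_mono[OF level[OF s]])
      have "ennreal s = ennreal (s / 2) + ennreal (s / 2)" using s by (simp flip: ennreal_plus)
      then have "ennreal s * emeasure M (\<Union>q\<in>bad s. B q)
          = ennreal (s / 2) * emeasure M (\<Union>q\<in>bad s. B q) + ennreal (s / 2) * emeasure M (\<Union>q\<in>bad s. B q)"
        by (simp only: distrib_right)
      also have "\<dots> \<le> ennreal (Cd ^ 2) * \<tau> s + ennreal (Cd ^ 2) * \<tau> s" using badset[OF s] by (intro add_mono)
      finally show "ennreal s * emeasure M (\<Union>q\<in>bad s. B q) \<le> ennreal (Cd ^ 2) * \<tau> s + ennreal (Cd ^ 2) * \<tau> s" .
    qed
    also have "\<dots> = (1 + (ennreal (Cd ^ 2) + ennreal (Cd ^ 2))) * \<tau> s" by (simp only: distrib_right mult_1)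
    also have "1 + (ennreal (Cd ^ 2) + ennreal (Cd ^ 2)) = ennreal (2 * Cd ^ 2 + 1)"
      by (simp add: add.commute flip: ennreal_plus ennreal_1)
    finally show ?thesis .
  qed
  have normint: "integrable M (\<lambda>x. norm (lam (u x)))"
  proof (rule integrableI_bounded)
    have "(\<integral>\<^sup>+x. ennreal (norm (norm (lam (u x)))) \<partial>M) \<le> (\<integral>\<^sup>+x. 1 + H x \<partial>M)"
    proof (rule nn_integral_mono)
      fix x
      have "norm (lam (u x)) \<le> 1 + norm (lam (u x)) powr p"
      proof (cases "norm (lam (u x)) \<le> 1")
        case False
        then have "norm (lam (u x)) powr 1 \<le> norm (lam (u x)) powr p" using p by (intro powr_mono) auto
        then show ?thesis using False by simp
      qed (simp add: add_increasing2)
      then have "ennreal (norm (lam (u x))) \<le> ennreal (1 + norm (lam (u x)) powr p)" by (rule ennreal_leI)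
      also have "\<dots> \<le> 1 + H x" unfolding H_def by (simp add: ennreal_plus add_left_mono)
      finally show "ennreal (norm (norm (lam (u x)))) \<le> 1 + H x" by simp
    qed
    also have "\<dots> = (\<integral>\<^sup>+x. 1 \<partial>M) + (\<integral>\<^sup>+x. H x \<partial>M)" by (rule nn_integral_add) auto
    also have "\<dots> < \<infinity>" using fin by (simp add: emeasure_eq_measure)
    finally show "(\<integral>\<^sup>+x. ennreal (norm (norm (lam (u x)))) \<partial>M) < \<infinity>" .
  qed measurable
  have lip_b: "\<exists>Z\<in>null_sets M. \<forall>x\<in>E (t powr p) - Z. \<forall>y\<in>E (t powr p) - Z.
      \<bar>dist (u x) b - dist (u y) b\<bar> \<le> 20 * Cd ^ 4 * (8 * CP * t) * dist x y" if t: "0 < t" for t b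
  proof -
    define w where "w x = norm (lam (u x) - lam b)" for x
    have wint: "integrable M w"
      unfolding w_def
    proof (rule Bochner_Integration.integrable_bound)
      show "integrable M (\<lambda>x. norm (lam (u x)) + norm (lam b))" using normint by simp
      show "AE x in M. norm (norm (lam (u x) - lam b)) \<le> norm (norm (lam (u x)) + norm (lam b))"
        by (simp add: norm_triangle_ineq4)
      show "(\<lambda>x. norm (lam (u x) - lam b)) \<in> borel_measurable M"
        by (rule borel_measurable_continuous_on[OF _ meas]) (intro continuous_intros)
    qed
    have "\<exists>Z\<in>null_sets M. \<forall>x\<in>E (t powr p) - Z. \<forall>y\<in>E (t powr p) - Z.
        \<bar>w x - w y\<bar> \<le> 20 * Cd ^ 4 * (8 * CP * t) * dist x y"
    proof (rule lipschitz_off_null_set[OF wint Em, where N=N and c="\<lambda>z k. ball_avg M (ball z (4 * r k)) w"])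
      show "is_net (N k) (R / 2 ^ k)" for k using N[of k] by (simp add: r_def)
      fix k z assume z: "z \<in> N k" "ball z (R / 2 ^ k) \<inter> E (t powr p) \<noteq> {}"
      then obtain x where x: "dist z x < r k" "x \<in> E (t powr p)" by (auto simp: r_def)
      let ?q = "(z, \<sigma> * (4 * r k))"
      have "1 * r k \<le> \<sigma> * (4 * r k)" using \<sigma> r_pos[of k] by (simp only: mult.assoc[symmetric]) (intro mult_right_mono, auto)
      then have "x \<in> B ?q" using x by (simp add: B_def)
      then have "?q \<notin> bad (t powr p)" using x(2) by (auto simp: E_def)
      moreover have "?q \<in> Fam" using z(1) by (auto simp: Fam_def)
      ultimately have HB: "(\<integral>\<^sup>+x\<in>B ?q. H x \<partial>M) \<le> ennreal (t powr p) * emeasure M (B ?q)"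
        by (simp add: bad_def not_less)
      have "(LINT y:ball z (4 * r k)|M. \<bar>w y - ball_avg M (ball z (4 * r k)) w\<bar>) \<le> 2 * CP * t * (4 * r k) * measure M (ball z (4 * r k))"
      proof (rule poincare_oscillation[OF pc CP \<sigma> p wint])
        show "upper_gradient_on (ball z (\<sigma> * (4 * r k))) w g" unfolding w_def by (rule upper_gradient_dist[OF g])
        have "(\<integral>\<^sup>+x\<in>B ?q. enn_powr (g x) p \<partial>M) \<le> (\<integral>\<^sup>+x\<in>B ?q. H x \<partial>M)"
          unfolding H_def by (intro nn_integral_mono mult_right_mono) auto
        then show "(\<integral>\<^sup>+x\<in>ball z (\<sigma> * (4 * r k)). enn_powr (g x) p \<partial>M) \<le> ennreal (t powr p) * emeasure M (ball z (\<sigma> * (4 * r k)))"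
          using HB unfolding B_def fst_conv snd_conv by (rule order_trans)
      qed (use t r_pos[of k] in auto)
      also have "2 * CP * t * (4 * r k) = 8 * CP * t * (R / 2 ^ k)" by (simp add: r_def)
      finally show "(LINT y:ball z (4 * (R / 2 ^ k))|M. \<bar>w y - ball_avg M (ball z (4 * r k)) w\<bar>)
          \<le> 8 * CP * t * (R / 2 ^ k) * measure M (ball z (4 * (R / 2 ^ k)))" by (simp only: r_def)
    qed (use CP t in auto)
    then show ?thesis by (simp add: w_def isoD)
  qed
  define c where "c = 20 * Cd ^ 4 * (8 * CP)"
  have c: "0 \<le> c" using CP Cd_ge_1 by (simp add: c_def)
  have lip: "\<exists>Z\<in>null_sets M. \<forall>x\<in>E (t powr p) - Z. \<forall>y\<in>E (t powr p) - Z. dist (u x) (u y) \<le> c * t * dist x y"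
    if t: "0 < t" for t
  proof -
    have "\<forall>b. \<exists>Z. Z \<in> null_sets M \<and> (\<forall>x\<in>E (t powr p) - Z. \<forall>y\<in>E (t powr p) - Z.
      \<bar>dist (u x) b - dist (u y) b\<bar> \<le> c * t * dist x y)"
      using lip_b[OF t] by (simp add: c_def Bex_def mult.assoc)
    then obtain Z where Z: "\<And>b. Z b \<in> null_sets M" "\<And>b x y. x \<in> E (t powr p) - Z b \<Longrightarrow> y \<in> E (t powr p) - Z b \<Longrightarrow>
      \<bar>dist (u x) b - dist (u y) b\<bar> \<le> c * t * dist x y" by metis
    show ?thesis
    \<comment> \<open>Distances to the points of a dense set determine
      \<open>dist (u x) (u y)\<close>, and countability of \<open>D\<close> keeps the union of the
      exceptional sets null.\<close>
    proof (intro bexI[of _ "\<Union>b\<in>D. Z b"] ballI)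
      show "(\<Union>b\<in>D. Z b) \<in> null_sets M" using Z(1) dense(1) by (intro null_sets_UN') auto
      fix x y assume xy: "x \<in> E (t powr p) - (\<Union>b\<in>D. Z b)" "y \<in> E (t powr p) - (\<Union>b\<in>D. Z b)"
      show "dist (u x) (u y) \<le> c * t * dist x y"
      proof (rule field_le_epsilon)
        fix e :: real assume e: "0 < e"
        have "u x \<in> closure D" using dense(2) by simp
        then obtain b where b: "b \<in> D" "dist b (u x) < e / 2" using e closure_approachable[of "u x" D] half_gt_zero by blast
        have "\<bar>dist (u x) b - dist (u y) b\<bar> \<le> c * t * dist x y" using xy b(1) by (intro Z(2)[of _ b]) auto
        then show "dist (u x) (u y) \<le> c * t * dist x y + e"
          using b(2) dist_triangle[of "u x" "u y" b] by (simp add: dist_commute)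
      qed
    qed
  qed
  show ?thesis
  proof (rule exI[of _ c], intro conjI allI impI c)
    fix \<eta> :: real assume \<eta>: "0 < \<eta>"
    define K where "K = 2 * Cd ^ 2 + 1"
    have K: "1 \<le> K" using Cd_ge_1 by (simp add: K_def)
    \<comment> \<open>The budget is \<open>\<eta> / 4\<close> for the complement of
      \<open>E s\<close>, after the factor \<open>K\<close> from \<open>Ecompl\<close>, and
      \<open>\<eta> / 4\<close> for passing to a closed subset. The integral of \<open>H\<close> off
      that subset, split at height \<open>s / 2\<close>, then costs \<open>\<eta> / 4\<close> for
      each part.\<close>
    have "\<forall>\<^sub>F j in sequentially. (\<integral>\<^sup>+x. H x * indicator {x. ennreal (real j) < H x} x \<partial>M) < ennreal (\<eta> / (4 * K))"
      using \<eta> K by (intro tail_integral_small Hm fin) auto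
    then obtain j where j: "1 \<le> j" "(\<integral>\<^sup>+x. H x * indicator {x. ennreal (real j) < H x} x \<partial>M) < ennreal (\<eta> / (4 * K))"
      unfolding eventually_sequentially by (metis le_add1 le_add2)
    \<comment> \<open>Twice \<open>j\<close>, since \<open>\<tau> s\<close> cuts \<open>H\<close> at
      \<open>s / 2\<close>; \<open>1 \<le> j\<close> is what yields
      \<open>1 \<le> t\<close>.\<close>
    define s where "s = 2 * real j"
    have s: "1 \<le> s" using j by (simp add: s_def)
    have \<tau>s: "\<tau> s \<le> ennreal (\<eta> / (4 * K))" using j(2) by (simp add: \<tau>_def s_def less_imp_le)
    define t where "t = s powr (1 / p)"
    have tp: "t powr p = s" using p s by (simp add: t_def powr_powr)
    have t: "1 \<le> t" unfolding t_def using s p by (intro ge_one_powr_ge_zero) auto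
    obtain Z where Z: "Z \<in> null_sets M" "\<forall>x\<in>E s - Z. \<forall>y\<in>E s - Z. dist (u x) (u y) \<le> c * t * dist x y"
      using lip[of t] t tp by auto
    have Zm: "Z \<in> sets borel" "E s \<in> sets borel" using Z(1) Em[of s] by (auto simp: null_sets_def)
    have "E s - Z \<in> sets borel" "0 < \<eta> / (4 * s)" using Zm \<eta> s by auto
    from closed_inner_open_outer[OF finite_measure_axioms sets_M this]
    obtain F U where F: "closed F" "open U" "F \<subseteq> E s - Z" "E s - Z \<subseteq> U" "measure M (U - F) < \<eta> / (4 * s)"
      by (elim exE conjE)
    have "measure M (- F) \<le> measure M (- E s) + measure M Z + measure M (U - F)"
    proof -
      have "measure M (- F) \<le> measure M ((- E s \<union> Z) \<union> (U - F))"
        using F Zm by (intro finite_measure_mono) auto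
      also have "\<dots> \<le> measure M (- E s \<union> Z) + measure M (U - F)" using F Zm by (intro measure_Un_le) auto
      also have "measure M (- E s \<union> Z) \<le> measure M (- E s) + measure M Z" using Zm by (intro measure_Un_le) auto
      finally show ?thesis by simp
    qed
    moreover have "measure M Z = 0" using Z(1) by (simp add: measure_eq_0_null_sets)
    ultimately have "s * measure M (- F) \<le> s * (measure M (- E s) + \<eta> / (4 * s))"
      using F(5) s by (intro mult_left_mono) auto
    also have "\<dots> = s * measure M (- E s) + \<eta> / 4" using s by (simp add: distrib_left)
    also have "s * measure M (- E s) \<le> \<eta> / 4"
    proof -
      have "ennreal (s * measure M (- E s)) = ennreal s * emeasure M (- E s)"
        using s by (simp add: emeasure_eq_measure ennreal_mult)
      also have "\<dots> \<le> ennreal K * \<tau> s" unfolding K_def using s by (intro Ecompl) auto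
      also have "\<dots> \<le> ennreal K * ennreal (\<eta> / (4 * K))" using \<tau>s by (rule mult_left_mono) simp
      also have "\<dots> = ennreal (\<eta> / 4)" using K \<eta> by (simp flip: ennreal_mult)
      finally show ?thesis using \<eta> by simp
    qed
    finally have small: "s * measure M (- F) \<le> \<eta> / 2" by simp
    have "(\<integral>\<^sup>+x. H x * indicator (- F) x \<partial>M) \<le> (\<integral>\<^sup>+x\<in>- F. H x * indicator {x. ennreal (s / 2) < H x} x \<partial>M) + ennreal (s / 2) * emeasure M (- F)"
      using F(1) by (intro split) auto
    also have "\<dots> \<le> ennreal (\<eta> / 4) + ennreal (\<eta> / 4)"
    proof (rule add_mono)
      have "(\<integral>\<^sup>+x\<in>- F. H x * indicator {x. ennreal (s / 2) < H x} x \<partial>M) \<le> \<tau> s"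
        unfolding \<tau>_def by (intro nn_integral_mono) (auto simp: indicator_def)
      also have "\<dots> \<le> ennreal (\<eta> / 4)" using \<tau>s K \<eta>
        by (elim order_trans) (intro ennreal_leI divide_left_mono, auto)
      finally show "(\<integral>\<^sup>+x\<in>- F. H x * indicator {x. ennreal (s / 2) < H x} x \<partial>M) \<le> ennreal (\<eta> / 4)" .
      have "ennreal (s / 2) * emeasure M (- F) = ennreal (s / 2 * measure M (- F))"
        unfolding emeasure_eq_measure using s by (intro ennreal_mult[symmetric]) auto
      also have "\<dots> \<le> ennreal (\<eta> / 4)" using small by (intro ennreal_leI) simp
      finally show "ennreal (s / 2) * emeasure M (- F) \<le> ennreal (\<eta> / 4)" .
    qed
    also have "\<dots> \<le> ennreal \<eta>" using \<eta> by (simp flip: ennreal_plus)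
    finally have "(\<integral>\<^sup>+x. H x * indicator (- F) x \<partial>M) \<le> ennreal \<eta>" .
    moreover have "norm (lam (u x)) \<le> t" if "x \<in> F" for x
    proof -
      have "norm (lam (u x)) powr p \<le> t powr p" using that F(3) tp by (auto simp: E_def)
      then show ?thesis using t p powr_less_mono2[of p t "norm (lam (u x))"] by force
    qed
    moreover have "\<forall>x\<in>F. \<forall>y\<in>F. dist (u x) (u y) \<le> c * t * dist x y" using F(3) Z(2) by blast
    moreover have "t powr p * measure M (- F) \<le> \<eta>" using small \<eta> tp by simp
    ultimately have "closed F \<and> (\<forall>x\<in>F. \<forall>y\<in>F. dist (u x) (u y) \<le> c * t * dist x y) \<and>
       (\<forall>x\<in>F. norm (lam (u x)) \<le> t) \<and> t powr p * measure M (- F) \<le> \<eta> \<and>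
       (\<integral>\<^sup>+x. H x * indicator (- F) x \<partial>M) \<le> ennreal \<eta>"
      using F(1) by simp
    then have "\<exists>E. closed E \<and> (\<forall>x\<in>E. \<forall>y\<in>E. dist (u x) (u y) \<le> c * t * dist x y) \<and>
       (\<forall>x\<in>E. norm (lam (u x)) \<le> t) \<and> t powr p * measure M (- E) \<le> \<eta> \<and>
       (\<integral>\<^sup>+x. H x * indicator (- E) x \<partial>M) \<le> ennreal \<eta>"
      by (rule exI[of _ F])
    with t show "\<exists>t\<ge>1. \<exists>E. closed E \<and> (\<forall>x\<in>E. \<forall>y\<in>E. dist (u x) (u y) \<le> c * t * dist x y) \<and>
       (\<forall>x\<in>E. norm (lam (u x)) \<le> t) \<and> t powr p * measure M (- E) \<le> \<eta> \<and>
       (\<integral>\<^sup>+x. H x * indicator (- E) x \<partial>M) \<le> ennreal \<eta>"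
      by (intro exI[of _ t] conjI)
  qed
qed

end

section \<open>Density of Lipschitz maps\<close>

lemma nagata_cond_mono: assumes "nagata_cond X m" "m \<le> n" shows "nagata_cond X n"
  using assms unfolding nagata_cond_def by (meson add_le_mono1 order_trans)

text \<open>Failure at \<open>n\<close> spreads to all smaller \<open>m\<close> by monotonicity,
  which pushes the infimum up to \<open>n + 1\<close>.\<close>

lemma nagata_dim_leD:
  assumes "nagata_dim TYPE('a::metric_space) \<le> enat n" shows "nagata_cond TYPE('a) n"
proof (rule ccontr)
  assume n: "\<not> nagata_cond TYPE('a) n"
  have "enat (Suc n) \<le> nagata_dim TYPE('a)"
    unfolding nagata_dim_def
  proof (rule INF_greatest)
    fix m assume "m \<in> {m. nagata_cond TYPE('a) m}"
    then have "\<not> m \<le> n" using n nagata_cond_mono by blast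
    then show "enat (Suc n) \<le> enat m" by simp
  qed
  then show False using assms by (metis Suc_n_not_le_n enat_ord_simps(1) order_trans)
qed

context bounded_doubling
begin

lemma lipschitz_in_N1p:
  fixes w :: "'a \<Rightarrow> 'v::banach"
  assumes L: "0 \<le> \<Lambda>" and w: "\<And>x y. norm (w x - w y) \<le> \<Lambda> * dist x y" and p: "1 \<le> p"
  shows "in_N1p M p w"
proof -
  have "continuous_on UNIV w"
    unfolding continuous_on_iff
  proof (intro ballI allI impI)
    fix x and e :: real assume e: "0 < e"
    show "\<exists>d>0. \<forall>y\<in>UNIV. dist y x < d \<longrightarrow> dist (w y) (w x) < e"
    proof (intro exI[of _ "e / (\<Lambda> + 1)"] conjI ballI impI)
      fix y assume "dist y x < e / (\<Lambda> + 1)"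
      then have "(\<Lambda> + 1) * dist y x < e" using L by (simp add: field_simps)
      moreover have "\<Lambda> * dist y x \<le> (\<Lambda> + 1) * dist y x" by (intro mult_right_mono) auto
      ultimately show "dist (w y) (w x) < e" using w[of y x] by (simp add: dist_norm)
    qed (use e L in auto)
  qed
  then have "w \<in> borel_measurable borel" by (rule borel_measurable_continuous_onI)
  then have m: "w \<in> borel_measurable M" unfolding measurable_cong_sets[OF sets_M refl] .
  define b where "b = norm (w undefined) + \<Lambda> * R"
  have b0: "0 \<le> b" using L R_pos by (simp add: b_def)
  have "norm (w x) \<le> b" for x
  proof -
    have "norm (w x) \<le> norm (w undefined) + norm (w x - w undefined)" using norm_triangle_sub[of "w x" "w undefined"] by simp
    also have "norm (w x - w undefined) \<le> \<Lambda> * R"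
      using w[of x undefined] L dist_less_R[of x undefined] by (meson less_imp_le mult_left_mono order_trans)
    finally show ?thesis by (simp add: b_def)
  qed
  then have "(\<integral>\<^sup>+x. enn_powr (ennreal (norm (w x))) p \<partial>M) \<le> (\<integral>\<^sup>+x. ennreal (b powr p) \<partial>M)"
    using p by (intro nn_integral_mono) (simp add: ennreal_leI powr_mono2)
  also have "\<dots> < \<infinity>" by (simp add: emeasure_eq_measure ennreal_mult_less_top)
  finally have "in_Lp M p w" using m unfolding in_Lp_def Lp_norm_finite_iff by simp
  \<comment> \<open>The truncation lemma with empty \<open>E\<close>, \<open>u = 0\<close> and
    \<open>v = - w\<close> yields the constant upper gradient \<open>\<Lambda>\<close> of a
    Lipschitz map.\<close>
  moreover have "upper_gradient_on UNIV (\<lambda>x. 0 :: 'v) (\<lambda>x. 0)" by (simp add: upper_gradient_on_def)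
  then have "upper_gradient_on UNIV (\<lambda>x. 0 - (- w x)) (\<lambda>x. (0 + ennreal \<Lambda>) * indicator (- {}) x)"
    using L w by (intro upper_gradient_truncate) (simp_all add: norm_minus_commute)
  then have "upper_gradient_on UNIV w (\<lambda>x. ennreal \<Lambda>)" by simp
  moreover have "Lp_norm M p (\<lambda>x. ennreal \<Lambda>) < \<infinity>"
    unfolding Lp_norm_finite_iff using L by (simp add: emeasure_eq_measure ennreal_mult_less_top)
  ultimately show ?thesis by (auto simp: in_N1p_def)
qed

text \<open>One estimate for two uses: the norm of \<open>lam (u x) - lam (v x)\<close>, where
  \<open>F\<close> is the norm of \<open>lam (u x)\<close>, and the truncated gradient, where
  \<open>F = g\<close>. Both vanish on \<open>E\<close> and exceed \<open>F\<close> by at most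
  \<open>B * t\<close> elsewhere.\<close>

lemma Lp_norm_truncated_le:
  assumes p: "1 \<le> p" and H: "H \<in> borel_measurable M" and E: "closed E" and B: "0 \<le> B" and t: "0 \<le> t"
    and small: "t powr p * measure M (- E) \<le> \<eta>" "(\<integral>\<^sup>+x. H x * indicator (- E) x \<partial>M) \<le> ennreal \<eta>"
    and \<eta>: "0 \<le> \<eta>" "2 powr p * (1 + B powr p) * \<eta> \<le> e powr p" and e: "0 \<le> e"
    and f: "\<And>x. f x \<le> (F x + ennreal (B * t)) * indicator (- E) x" and F: "\<And>x. enn_powr (F x) p \<le> H x"
  shows "Lp_norm M p f \<le> ennreal e"
proof (rule Lp_norm_le)
  have [measurable]: "- E \<in> sets M" using E by simp
  note H [measurable]
  have "(\<integral>\<^sup>+x. enn_powr (f x) p \<partial>M)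
      \<le> (\<integral>\<^sup>+x. ennreal (2 powr p) * (H x * indicator (- E) x + ennreal ((B * t) powr p) * indicator (- E) x) \<partial>M)"
  proof (rule nn_integral_mono)
    fix x
    show "enn_powr (f x) p \<le> ennreal (2 powr p) * (H x * indicator (- E) x + ennreal ((B * t) powr p) * indicator (- E) x)"
    proof (cases "x \<in> E")
      case True
      then have "f x = 0" using f[of x] by simp
      then show ?thesis using p by (simp add: enn_powr_def)
    next
      case False
      then have "enn_powr (f x) p \<le> enn_powr (F x + ennreal (B * t)) p"
        using f[of x] p by (intro enn_powr_mono) auto
      also have "\<dots> \<le> ennreal (2 powr p) * (enn_powr (F x) p + ennreal ((B * t) powr p))"
        using p B t by (intro enn_powr_add_le) auto
      also have "\<dots> \<le> ennreal (2 powr p) * (H x + ennreal ((B * t) powr p))"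
        using F by (intro mult_left_mono add_right_mono) auto
      finally show ?thesis using False by simp
    qed
  qed
  also have "\<dots> = ennreal (2 powr p) * (\<integral>\<^sup>+x. H x * indicator (- E) x + ennreal ((B * t) powr p) * indicator (- E) x \<partial>M)"
    by (rule nn_integral_cmult) measurable
  also have "(\<integral>\<^sup>+x. H x * indicator (- E) x + ennreal ((B * t) powr p) * indicator (- E) x \<partial>M)
      = (\<integral>\<^sup>+x. H x * indicator (- E) x \<partial>M) + (\<integral>\<^sup>+x. ennreal ((B * t) powr p) * indicator (- E) x \<partial>M)"
    by (rule nn_integral_add) measurable
  also have "(\<integral>\<^sup>+x. ennreal ((B * t) powr p) * indicator (- E) x \<partial>M) = ennreal ((B * t) powr p) * emeasure M (- E)"
    by (rule nn_integral_cmult_indicator) measurable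
  also have "\<dots> = ennreal (B powr p * (t powr p * measure M (- E)))"
    unfolding emeasure_eq_measure using B t by (subst ennreal_mult[symmetric]) (auto simp: powr_mult mult.assoc)
  also have "(\<integral>\<^sup>+x. H x * indicator (- E) x \<partial>M) + ennreal (B powr p * (t powr p * measure M (- E))) \<le> ennreal \<eta> + ennreal (B powr p * \<eta>)"
    using small by (intro add_mono ennreal_leI mult_left_mono) auto
  also have "\<dots> = ennreal ((1 + B powr p) * \<eta>)" using \<eta>(1) by (subst ennreal_plus[symmetric]) (auto simp: distrib_right)
  finally have "(\<integral>\<^sup>+x. enn_powr (f x) p \<partial>M) \<le> ennreal (2 powr p) * ennreal ((1 + B powr p) * \<eta>)"
    by (simp add: mult_left_mono)
  also have "\<dots> = ennreal (2 powr p * (1 + B powr p) * \<eta>)" using \<eta>(1) by (subst ennreal_mult[symmetric]) (auto simp: mult.assoc)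
  also have "\<dots> \<le> ennreal (e powr p)" using \<eta>(2) by (rule ennreal_leI)
  finally show "(\<integral>\<^sup>+x. enn_powr (f x) p \<partial>M) \<le> ennreal (e powr p)" .
qed (use p e in auto)

end

theorem theorem1p16:
  fixes M :: "'a::metric_space measure" and p :: real and n :: nat and Cd :: real
    and lam :: "'b::metric_space \<Rightarrow> 'v::banach"
  assumes "mm_space M"
    and "bounded (UNIV :: 'a set)"
    and "doubling M Cd"
    and "1 \<le> p"
    and "n \<ge> 1"
    and "supports_poincare M p"
    and "nagata_dim TYPE('a) \<le> enat n"
    and "\<exists>D :: 'b set. countable D \<and> closure D = UNIV"
    and "lipschitz_connected TYPE('b) (n - 1)"
    and "isometric_embedding lam"
  shows "\<forall>u. in_N1p_map M p lam u \<longrightarrow>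
           (\<forall>\<epsilon> > 0. \<exists>v :: 'a \<Rightarrow> 'b. Lipschitz_map v \<and> in_N1p_map M p lam v \<and>
              N1p_map_dist M p lam u v < ennreal \<epsilon>)"
proof (intro allI impI)
  fix u :: "'a \<Rightarrow> 'b" and \<epsilon> :: real assume u: "in_N1p_map M p lam u" and \<epsilon>: "0 < \<epsilon>"
  note p = \<open>1 \<le> p\<close>
  obtain a e where ae: "\<And>y :: 'a. dist a y \<le> e" using assms(2) by (auto simp: bounded_def)
  \<comment> \<open>The summand 1 makes the bound on distances strict.\<close>
  define R where "R = 2 * e + 1"
  have R: "dist x y < R" for x y :: 'a
    using ae[of x] ae[of y] dist_triangle[of x y a] by (simp add: R_def dist_commute)
  have R0: "0 < R" using R[of a a] by simp
  interpret bounded_doubling M Cd R by unfold_locales (use assms R R0 in auto)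
  have isoD: "norm (lam y - lam z) = dist y z" for y z using assms(10) by (simp add: isometric_embedding_def)
  obtain g where uL: "in_Lp M p (lam \<circ> u)" and g: "upper_gradient_on UNIV (lam \<circ> u) g" "Lp_norm M p g < \<infinity>"
    using u by (auto simp: in_N1p_map_def in_N1p_def)
  define H where "H = (\<lambda>x. enn_powr (g x) p + ennreal (norm (lam (u x)) powr p))"
  have "g \<in> borel_measurable borel" using g(1) by (simp add: upper_gradient_on_def)
  then have gm [measurable]: "g \<in> borel_measurable M" unfolding measurable_cong_sets[OF sets_M refl] .
  have lm [measurable]: "(\<lambda>x. lam (u x)) \<in> borel_measurable M" using uL by (simp add: in_Lp_def comp_def)
  have Hm: "H \<in> borel_measurable M" unfolding H_def by measurable
  have "(\<integral>\<^sup>+x. H x \<partial>M) = (\<integral>\<^sup>+x. enn_powr (g x) p \<partial>M) + (\<integral>\<^sup>+x. ennreal (norm (lam (u x)) powr p) \<partial>M)"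
    unfolding H_def by (rule nn_integral_add) measurable
  then have Hfin: "(\<integral>\<^sup>+x. H x \<partial>M) < \<infinity>"
    using g(2) uL unfolding Lp_norm_finite_iff in_Lp_def by simp
  obtain D :: "'b set" where D: "countable D" "closure D = UNIV" using assms(8) by blast
  have g': "upper_gradient_on UNIV (\<lambda>x. lam (u x)) g" using g(1) by (simp add: comp_def)
  obtain c where c: "0 \<le> c" and lus: "\<forall>\<eta>>0. \<exists>t\<ge>1. \<exists>E. closed E \<and> (\<forall>x\<in>E. \<forall>y\<in>E. dist (u x) (u y) \<le> c * t * dist x y) \<and>
     (\<forall>x\<in>E. norm (lam (u x)) \<le> t) \<and> t powr p * measure M (- E) \<le> \<eta> \<and>
     (\<integral>\<^sup>+x. H x * indicator (- E) x \<partial>M) \<le> ennreal \<eta>"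
    using lusin_lipschitz[OF p assms(6) D assms(10) lm g' H_def Hfin] by (elim exE conjE)
  obtain C where C: "1 \<le> C" and extend: "\<forall>(Z :: 'a set) (f :: 'a \<Rightarrow> 'b) L. closed Z \<longrightarrow> Z \<noteq> {} \<longrightarrow> 0 \<le> L \<longrightarrow>
     (\<forall>x\<in>Z. \<forall>y\<in>Z. dist (f x) (f y) \<le> L * dist x y) \<longrightarrow>
     (\<exists>g. (\<forall>x\<in>Z. g x = f x) \<and> (\<forall>x y. dist (g x) (g y) \<le> C * L * dist x y))"
    using lipschitz_extension[OF nagata_dim_leD[OF assms(7)] assms(5) R0 R assms(9)] by (elim exE conjE)
  \<comment> \<open>\<open>B * t\<close> has to dominate both \<open>\<Lambda>\<close>, for the
    gradient, and \<open>t + \<Lambda> * R\<close>, the bound on \<open>lam (v x)\<close>.\<close>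
  define B where "B = 1 + C * c * (R + 1)"
  have B: "0 \<le> B" "1 + C * c * R \<le> B" "C * c \<le> B"
    using C c R0 by (auto simp: B_def algebra_simps)
  define K where "K = 2 powr p * (1 + B powr p)"
  have K: "0 < K" by (simp add: K_def add_pos_nonneg)
  \<comment> \<open>The second bound forces \<open>E\<close> to be nonempty, as the extension
    theorem requires: for empty \<open>E\<close> and \<open>t \<ge> 1\<close> the whole measure
    would be at most \<open>\<eta>\<close>.\<close>
  define \<eta> where "\<eta> = min ((\<epsilon> / 3) powr p / K) (measure M UNIV / 2)"
  have \<mu>: "0 < measure M UNIV" using measure_ball_pos[OF R0] by (simp add: ball_R)
  have "\<eta> \<le> (\<epsilon> / 3) powr p / K" "\<eta> \<le> measure M UNIV / 2" "0 < \<eta>"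
    unfolding \<eta>_def using K \<epsilon> \<mu> by (intro min.cobounded1 min.cobounded2 min_less_iff_conj[THEN iffD2] conjI; simp)+
  then have \<eta>: "0 < \<eta>" "K * \<eta> \<le> (\<epsilon> / 3) powr p" "\<eta> < measure M UNIV"
    using K \<mu> by (simp_all add: field_simps)
  obtain t E where t: "1 \<le> t" and E: "closed E" "\<forall>x\<in>E. \<forall>y\<in>E. dist (u x) (u y) \<le> c * t * dist x y"
    "\<forall>x\<in>E. norm (lam (u x)) \<le> t" "t powr p * measure M (- E) \<le> \<eta>"
    "(\<integral>\<^sup>+x. H x * indicator (- E) x \<partial>M) \<le> ennreal \<eta>"
    using lus[rule_format, OF \<eta>(1)] by (elim exE conjE)
  have "E \<noteq> {}"
  proof
    assume "E = {}"
    moreover have "1 \<le> t powr p" using t p by (intro ge_one_powr_ge_zero) auto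
    then have "1 * measure M UNIV \<le> t powr p * measure M UNIV" by (rule mult_right_mono) simp
    ultimately show False using E(4) \<eta>(3) by simp
  qed
  then obtain x0 where x0: "x0 \<in> E" by blast
  define \<Lambda> where "\<Lambda> = C * (c * t)"
  have \<Lambda>: "0 \<le> \<Lambda>" using C c t by (simp add: \<Lambda>_def)
  have "0 \<le> c * t" using c t by simp
  then obtain v where v: "\<forall>x\<in>E. v x = u x" "\<forall>x y. dist (v x) (v y) \<le> \<Lambda> * dist x y"
    using extend[rule_format, OF E(1) \<open>E \<noteq> {}\<close>, of "c * t" u] E(2) by (auto simp: \<Lambda>_def)
  have lamv: "norm (lam (v x) - lam (v y)) \<le> \<Lambda> * dist x y" for x y using v(2) by (simp add: isoD)
  have \<Lambda>B: "\<Lambda> \<le> B * t" "t + \<Lambda> * R \<le> B * t"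
    using mult_right_mono[OF B(3), of t] mult_right_mono[OF B(2), of t] t by (simp_all add: \<Lambda>_def algebra_simps)
  have small: "Lp_norm M p f \<le> ennreal (\<epsilon> / 3)"
    if "\<And>x. f x \<le> (F x + ennreal (B * t)) * indicator (- E) x" "\<And>x. enn_powr (F x) p \<le> H x" for f F
    using p Hm E(1) B(1) _ E(4,5) _ \<eta>(2)[unfolded K_def] _ that
    by (rule Lp_norm_truncated_le) (use t \<eta> \<epsilon> in auto)
  have "Lp_norm M p (\<lambda>x. ennreal (norm (lam (u x) - lam (v x)))) \<le> ennreal (\<epsilon> / 3)"
  proof (rule small)
    fix x
    show "ennreal (norm (lam (u x) - lam (v x))) \<le> (ennreal (norm (lam (u x))) + ennreal (B * t)) * indicator (- E) x"
    proof (cases "x \<in> E")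
      case False
      \<comment> \<open>\<open>v\<close> agrees with \<open>u\<close> at \<open>x0\<close>, where
        the norm is at most \<open>t\<close>, and \<open>lam (v x)\<close> varies by at most
        \<open>\<Lambda> * R\<close> over the whole space.\<close>
      have "norm (lam (v x)) \<le> norm (lam (u x0)) + norm (lam (v x) - lam (v x0))"
        using norm_triangle_sub[of "lam (v x)" "lam (v x0)"] v(1) x0 by simp
      also have "\<dots> \<le> t + \<Lambda> * R"
        using E(3) x0 lamv[of x x0] mult_left_mono[OF less_imp_le[OF R[of x x0]] \<Lambda>] by fastforce
      finally have "norm (lam (u x) - lam (v x)) \<le> norm (lam (u x)) + B * t"
        using norm_triangle_ineq4[of "lam (u x)" "lam (v x)"] \<Lambda>B(2) by linarith
      then show ?thesis using False B(1) t by (simp add: ennreal_leI flip: ennreal_plus)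
    qed (use v(1) in simp)
    show "enn_powr (ennreal (norm (lam (u x)))) p \<le> H x" by (simp add: H_def)
  qed
  moreover have "Lp_norm M p (\<lambda>x. (g x + ennreal \<Lambda>) * indicator (- E) x) \<le> ennreal (\<epsilon> / 3)"
  proof (rule small)
    fix x
    show "(g x + ennreal \<Lambda>) * indicator (- E) x \<le> (g x + ennreal (B * t)) * indicator (- E) x"
      using \<Lambda>B(1) by (intro mult_right_mono add_left_mono ennreal_leI) auto
    show "enn_powr (g x) p \<le> H x" by (simp add: H_def)
  qed
  moreover have "upper_gradient_on UNIV (\<lambda>x. lam (u x) - lam (v x)) (\<lambda>x. (g x + ennreal \<Lambda>) * indicator (- E) x)"
    using v(1) by (intro upper_gradient_truncate[OF E(1) _ g' lamv \<Lambda>]) simp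
  then have "(INF g\<in>{g. upper_gradient_on UNIV (\<lambda>x. lam (u x) - lam (v x)) g}. Lp_norm M p g)
      \<le> Lp_norm M p (\<lambda>x. (g x + ennreal \<Lambda>) * indicator (- E) x)" by (intro INF_lower) simp
  ultimately have "N1p_map_dist M p lam u v \<le> ennreal (\<epsilon> / 3) + ennreal (\<epsilon> / 3)"
    unfolding N1p_map_dist_def N1p_norm_def by (meson add_mono order_trans)
  also have "\<dots> = ennreal (\<epsilon> / 3 + \<epsilon> / 3)" using \<epsilon> by (intro ennreal_plus[symmetric]) auto
  also have "\<dots> < ennreal \<epsilon>" using \<epsilon> by (intro ennreal_lessI) auto
  finally have "N1p_map_dist M p lam u v < ennreal \<epsilon>" .
  moreover have "in_N1p_map M p lam v"
    unfolding in_N1p_map_def using lamv by (intro lipschitz_in_N1p[OF \<Lambda> _ p]) simp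
  moreover have "Lipschitz_map v" unfolding Lipschitz_map_def using v(2) by blast
  ultimately show "\<exists>v :: 'a \<Rightarrow> 'b. Lipschitz_map v \<and> in_N1p_map M p lam v \<and> N1p_map_dist M p lam u v < ennreal \<epsilon>" by blast
qed

end
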